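(* Suppose that $\mathbf{g}$ is a Riemannian metric on $M$ for which the isometric embedding system $\mathcal{I}$ into Euclidean $\mathbb{R}^3$ is Darboux integrable. Let $J$ be the complex structure on $M$ compatible with $\mathbf{g}$ and the orientation. Then $V=J\nabla q$ is a Killing field. Moreover, near any point there exist local coordinates $(s,t)$ on $M$ with respect to which $$\mathbf{g}=ds^2+q'(s)^2\,dt^2,\qquad V=\frac{\partial}{\partial t},$$ where $q(s)$ is a strictly monotone solution of the ODE $$q''=3\varepsilon q^{-1/3}.$$
   Context: $M$ is a connected, oriented smooth surface with Riemannian metric $\mathbf{g}$ whose Gauss curvature $K$ is either everywhere positive ($\varepsilon=1$, elliptic case) or everywhere negative ($\varepsilon=-1$, hyperbolic case). The function $q$ on $M$ is $q=(\varepsilon K)^{-3/4}$, and $\nabla q$ is its gradient with respect to $\mathbf{g}$. $\mathcal{F}_M$ is the oriented orthonormal frame bundle of $M$, with canonical (dual) 1-forms $\eta^1,\eta^2$ and connection form $\eta^1_2=-\eta^2_1$ satisfying $d\eta^1=-\eta^1_2\wedge\eta^2$, $d\eta^2=-\eta^2_1\wedge\eta^1$, $d\eta^1_2=K\,\eta^1\wedge\eta^2$. $\mathcal{F}_{\mathbb{R}^3}$ is the orthonormal frame bundle of Euclidean $\mathbb{R}^3$, with basepoint map $\rho$ and frame vectors $e_1,e_2,e_3$, and canonical and connection forms $\omega^i$, $\omega^i_j=-\omega^j_i$ defined by $d\rho=e_i\omega^i$, $de_i=e_j\omega^j_i$. Isometric embedding system: $\mathcal{I}$ is the Pfaffian exterior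 differential system on $\mathcal{F}_M\times\mathcal{F}_{\mathbb{R}^3}$ generated by $$\theta_0=\omega^3,\quad \theta_1=\omega^1-\eta^1,\quad \theta_2=\omega^2-\eta^2,\quad \theta_3=\omega^1_2-\eta^1_2 .$$ Darboux integrability. Put $k=\sqrt{|K|}$. If $K<0$, the singular systems are $V_\pm=\operatorname{span}\{\theta_0,\theta_1,\theta_2,\theta_3,\omega^3_1\mp k\eta^2,\omega^3_2\pm k\eta^1\}$; if $K>0$, they are the complex subbundle $W=\operatorname{span}_{\mathbb{C}}\{\theta_0,\theta_1,\theta_2,\theta_3,\omega^3_1-\mathrm{i}k\eta^2,\omega^3_2+\mathrm{i}k\eta^1\}$ of the complexified cotangent bundle and its conjugate $\overline{W}$. $\mathcal{I}$ is Darboux integrable if, locally, each of the two singular systems contains a (real, respectively complex) Frobenius subbundle of rank at least $2$ that intersects the span of $\theta_0,\theta_1,\theta_2,\theta_3$ only in $0$.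
   Formalization: The local normal form is stated only near points where V (equivalently ∇q) does not vanish, since V = ∂/∂t is impossible at a zero of V and Darboux integrable metrics with such zeros exist; the Killing property is stated on all of M. *)

theory Defs
  imports "HOL-Analysis.Analysis"
begin

subsection \<open>Smooth maps between normed spaces\<close>

(* For open S: all iterated directional derivatives up to order n exist as Frechet
   derivatives and are continuous, i.e. f is of class C^n on S. *)
primrec times_diff_on :: "nat \<Rightarrow> 'a::real_normed_vector set \<Rightarrow> ('a \<Rightarrow> 'b::real_normed_vector) \<Rightarrow> bool"
  where
    "times_diff_on 0 S f \<longleftrightarrow> continuous_on S f"
  | "times_diff_on (Suc n) S f \<longleftrightarrow>
       (\<forall>x\<in>S. f differentiable (at x)) \<and>
       (\<forall>v. times_diff_on n S (\<lambda>x. frechet_derivative f (at x) v))"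

definition smooth_on :: "'a::real_normed_vector set \<Rightarrow> ('a \<Rightarrow> 'b::real_normed_vector) \<Rightarrow> bool"
  where "smooth_on S f \<longleftrightarrow> (\<forall>n. times_diff_on n S f)"

subsection \<open>Oriented smooth surfaces\<close>

(* A chart is a domain together with a coordinate map that is only relevant on that domain. *)
type_synonym 'a chart = "'a set \<times> ('a \<Rightarrow> real^2)"

definition is_chart :: "'a topology \<Rightarrow> 'a chart \<Rightarrow> bool"
  where "is_chart M c \<longleftrightarrow>
    openin M (fst c) \<and> open (snd c ` fst c) \<and>
    homeomorphic_map (subtopology M (fst c)) (top_of_set (snd c ` fst c)) (snd c)"

definition chart_inv :: "'a chart \<Rightarrow> real^2 \<Rightarrow> 'a"
  where "chart_inv c = inv_into (fst c) (snd c)"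

definition overlap :: "'a chart \<Rightarrow> 'a chart \<Rightarrow> (real^2) set"
  where "overlap c d = snd c ` (fst c \<inter> fst d)"

definition transition :: "'a chart \<Rightarrow> 'a chart \<Rightarrow> real^2 \<Rightarrow> real^2"
  where "transition c d = snd d \<circ> chart_inv c"

definition oriented_surface :: "'a topology \<Rightarrow> 'a chart set \<Rightarrow> bool"
  where "oriented_surface M A \<longleftrightarrow>
    Hausdorff_space M \<and> second_countable M \<and>
    (\<forall>c\<in>A. is_chart M c) \<and> (\<Union>c\<in>A. fst c) = topspace M \<and>
    (\<forall>c\<in>A. \<forall>d\<in>A. smooth_on (overlap c d) (transition c d) \<and>
       (\<forall>x\<in>overlap c d. det (jacobian (transition c d) (at x)) > 0))"

(* Local coordinates for the smooth structure defined by A; they need not respect the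
   orientation. *)
definition smooth_chart :: "'a topology \<Rightarrow> 'a chart set \<Rightarrow> 'a chart \<Rightarrow> bool"
  where "smooth_chart M A d \<longleftrightarrow> is_chart M d \<and>
    (\<forall>c\<in>A. smooth_on (overlap c d) (transition c d) \<and> smooth_on (overlap d c) (transition d c))"

subsection \<open>Tensor fields on a surface, given by their components in charts\<close>

type_synonym 'a metric = "'a chart \<Rightarrow> real^2 \<Rightarrow> real^2^2"
type_synonym 'a vfield = "'a chart \<Rightarrow> real^2 \<Rightarrow> real^2"

definition ip :: "real^2^2 \<Rightarrow> real^2 \<Rightarrow> real^2 \<Rightarrow> real"
  where "ip G u v = u \<bullet> (G *v v)"

(* In the chart d the metric g has the component matrix h. *)
definition metric_components :: "'a chart set \<Rightarrow> 'a metric \<Rightarrow> 'a chart \<Rightarrow> (real^2 \<Rightarrow> real^2^2) \<Rightarrow> bool"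
  where "metric_components A g d h \<longleftrightarrow>
    (\<forall>c\<in>A. \<forall>x\<in>overlap c d. \<forall>u v.
       ip (g c x) u v =
       ip (h (transition c d x)) (jacobian (transition c d) (at x) *v u)
                                 (jacobian (transition c d) (at x) *v v))"

definition vfield_components :: "'a chart set \<Rightarrow> 'a vfield \<Rightarrow> 'a chart \<Rightarrow> (real^2 \<Rightarrow> real^2) \<Rightarrow> bool"
  where "vfield_components A V d W \<longleftrightarrow>
    (\<forall>c\<in>A. \<forall>x\<in>overlap c d. jacobian (transition c d) (at x) *v V c x = W (transition c d x))"

definition riemannian_metric :: "'a chart set \<Rightarrow> 'a metric \<Rightarrow> bool"
  where "riemannian_metric A g \<longleftrightarrow>
    (\<forall>c\<in>A. smooth_on (snd c ` fst c) (g c) \<and>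
       (\<forall>x\<in>snd c ` fst c. transpose (g c x) = g c x \<and> (\<forall>u. u \<noteq> 0 \<longrightarrow> ip (g c x) u u > 0)) \<and>
       metric_components A g c (g c))"

definition smooth_vfield :: "'a chart set \<Rightarrow> 'a vfield \<Rightarrow> bool"
  where "smooth_vfield A V \<longleftrightarrow>
    (\<forall>c\<in>A. smooth_on (snd c ` fst c) (V c) \<and> vfield_components A V c (V c))"

definition pd :: "2 \<Rightarrow> (real^2 \<Rightarrow> real) \<Rightarrow> real^2 \<Rightarrow> real"
  where "pd i f x = frechet_derivative f (at x) (axis i 1)"

definition christoffel :: "(real^2 \<Rightarrow> real^2^2) \<Rightarrow> 2 \<Rightarrow> 2 \<Rightarrow> 2 \<Rightarrow> real^2 \<Rightarrow> real"
  where "christoffel G k i j x =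
    (\<Sum>l\<in>UNIV. matrix_inv (G x) $ k $ l *
       (pd i (\<lambda>y. G y $ j $ l) x + pd j (\<lambda>y. G y $ i $ l) x - pd l (\<lambda>y. G y $ i $ j) x)) / 2"

(* The l-th component of R(d_i, d_j) d_k, with R(X,Y) = [nabla_X, nabla_Y] - nabla_[X,Y]. *)
definition riemann_curvature :: "(real^2 \<Rightarrow> real^2^2) \<Rightarrow> 2 \<Rightarrow> 2 \<Rightarrow> 2 \<Rightarrow> 2 \<Rightarrow> real^2 \<Rightarrow> real"
  where "riemann_curvature G l k i j x =
    pd i (christoffel G l j k) x - pd j (christoffel G l i k) x +
    (\<Sum>m\<in>UNIV. christoffel G m j k x * christoffel G l i m x -
                christoffel G m i k x * christoffel G l j m x)"

(* g(R(d_1, d_2) d_2, d_1) / det g *)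
definition gauss_formula :: "(real^2 \<Rightarrow> real^2^2) \<Rightarrow> real^2 \<Rightarrow> real"
  where "gauss_formula G x =
    (\<Sum>l\<in>UNIV. G x $ 1 $ l * riemann_curvature G l 2 1 2 x) / det (G x)"

(* K is the Gauss curvature of g, as a function on the surface. Its existence is the
   invariance of the formula under changes of coordinates. *)
definition is_gauss_curvature :: "'a chart set \<Rightarrow> 'a metric \<Rightarrow> ('a \<Rightarrow> real) \<Rightarrow> bool"
  where "is_gauss_curvature A g K \<longleftrightarrow>
    (\<forall>c\<in>A. \<forall>p\<in>fst c. K p = gauss_formula (g c) (snd c p))"

(* J is the complex structure (as an endomorphism field, by matrices in the charts) that is
   compatible with the metric and with the orientation: (u, J u) is positively oriented. *)
definition compatible_complex_structure ::
    "'a chart set \<Rightarrow> 'a metric \<Rightarrow> ('a chart \<Rightarrow> real^2 \<Rightarrow> real^2^2) \<Rightarrow> bool"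
  where "compatible_complex_structure A g J \<longleftrightarrow>
    (\<forall>c\<in>A. \<forall>x\<in>snd c ` fst c.
       J c x ** J c x = - mat 1 \<and>
       (\<forall>u v. ip (g c x) (J c x *v u) (J c x *v v) = ip (g c x) u v) \<and>
       (\<forall>u. u \<noteq> 0 \<longrightarrow> det (vector [u, J c x *v u] :: real^2^2) > 0))"

definition grad :: "'a metric \<Rightarrow> ('a \<Rightarrow> real) \<Rightarrow> 'a vfield"
  where "grad g f c x = matrix_inv (g c x) *v (\<chi> i. pd i (f \<circ> chart_inv c) x)"

(* Components of the Lie derivative of the metric G along the vector field V. *)
definition lie_metric :: "(real^2 \<Rightarrow> real^2^2) \<Rightarrow> (real^2 \<Rightarrow> real^2) \<Rightarrow> 2 \<Rightarrow> 2 \<Rightarrow> real^2 \<Rightarrow> real"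
  where "lie_metric G V i j x =
    (\<Sum>k\<in>UNIV. V x $ k * pd k (\<lambda>y. G y $ i $ j) x
               + G x $ k $ j * pd i (\<lambda>y. V y $ k) x
               + G x $ i $ k * pd j (\<lambda>y. V y $ k) x)"

definition killing_field :: "'a chart set \<Rightarrow> 'a metric \<Rightarrow> 'a vfield \<Rightarrow> bool"
  where "killing_field A g V \<longleftrightarrow> smooth_vfield A V \<and>
    (\<forall>c\<in>A. \<forall>x\<in>snd c ` fst c. \<forall>i j. lie_metric (g c) (V c) i j x = 0)"

subsection \<open>Differential forms along a submanifold of a Euclidean space\<close>

(* Velocities at z of curves in N; for an embedded submanifold N this is the tangent space.
   Only differentiability at 0 matters, so taking the curve to be total is no restriction. *)
definition tangent_space :: "'b::euclidean_space set \<Rightarrow> 'b \<Rightarrow> 'b set"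
  where "tangent_space N z =
    {w. \<exists>\<gamma>. \<gamma> 0 = z \<and> (\<forall>t::real. \<gamma> t \<in> N) \<and> (\<gamma> has_vector_derivative w) (at 0)}"

(* Scalars 'k are the reals, or the complex numbers for sections of the complexified cotangent
   bundle. A form on N is represented by a form on an open subset of the ambient space, of
   which only the restriction to tangent vectors of N is used. *)
type_synonym ('b, 'k) one_form = "'b \<Rightarrow> 'b \<Rightarrow> 'k"

definition smooth_one_form ::
    "'b::euclidean_space set \<Rightarrow> ('b, 'k::real_normed_field) one_form \<Rightarrow> bool"
  where "smooth_one_form U \<alpha> \<longleftrightarrow>
    (\<forall>z\<in>U. linear (\<alpha> z)) \<and> (\<forall>w. smooth_on U (\<lambda>z. \<alpha> z w))"

(* Exterior derivative with the convention (d \<alpha>)(X,Y) = X \<alpha>(Y) - Y \<alpha>(X) - \<alpha>([X,Y]),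
   evaluated on constant vector fields. It commutes with restriction to N. *)
definition ext_deriv ::
    "('b::euclidean_space, 'k::real_normed_field) one_form \<Rightarrow> 'b \<Rightarrow> 'b \<Rightarrow> 'b \<Rightarrow> 'k"
  where "ext_deriv \<alpha> z u v =
    frechet_derivative (\<lambda>y. \<alpha> y v) (at z) u - frechet_derivative (\<lambda>y. \<alpha> y u) (at z) v"

definition form_span ::
    "'b::euclidean_space set \<Rightarrow> ('b, 'k::real_normed_field) one_form list \<Rightarrow> 'b \<Rightarrow> ('b \<Rightarrow> 'k) set"
  where "form_span N \<alpha>s z =
    {\<beta>. \<exists>a. \<forall>w\<in>tangent_space N z. \<beta> w = (\<Sum>i<length \<alpha>s. a i * (\<alpha>s ! i) z w)}"

definition form_independent ::
    "'b::euclidean_space set \<Rightarrow> ('b, 'k::real_normed_field) one_form list \<Rightarrow> 'b \<Rightarrow> bool"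
  where "form_independent N \<alpha>s z \<longleftrightarrow>
    (\<forall>a. (\<forall>w\<in>tangent_space N z. (\<Sum>i<length \<alpha>s. a i * (\<alpha>s ! i) z w) = 0)
         \<longrightarrow> (\<forall>i<length \<alpha>s. a i = 0))"

(* Frobenius condition at z: each d\<alpha> lies in the algebraic ideal generated by the list. *)
definition frobenius_at ::
    "'b::euclidean_space set \<Rightarrow> ('b, 'k::real_normed_field) one_form list \<Rightarrow> 'b \<Rightarrow> bool"
  where "frobenius_at N \<alpha>s z \<longleftrightarrow>
    (\<forall>\<alpha>\<in>set \<alpha>s. \<exists>\<beta>. (\<forall>i<length \<alpha>s. linear (\<beta> i)) \<and>
       (\<forall>u\<in>tangent_space N z. \<forall>v\<in>tangent_space N z.
          ext_deriv \<alpha> z u v =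
          (\<Sum>i<length \<alpha>s. \<beta> i u * (\<alpha>s ! i) z v - \<beta> i v * (\<alpha>s ! i) z u)))"

(* Locally on N, the system spanned by the list vs contains a Frobenius subbundle of rank at
   least 2 (spanned by the smooth frame \<alpha>s) which meets the span of \<theta>s only in 0. *)
definition contains_frobenius ::
    "'b::euclidean_space set \<Rightarrow> ('b, 'k::real_normed_field) one_form list
       \<Rightarrow> ('b, 'k) one_form list \<Rightarrow> bool"
  where "contains_frobenius N \<theta>s vs \<longleftrightarrow>
    (\<forall>z\<^sub>0\<in>N. \<exists>U \<alpha>s. open U \<and> z\<^sub>0 \<in> U \<and> length \<alpha>s \<ge> 2 \<and> (\<forall>\<alpha>\<in>set \<alpha>s. smooth_one_form U \<alpha>) \<and>
       (\<forall>z\<in>N \<inter> U.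
          form_independent N \<alpha>s z \<and> frobenius_at N \<alpha>s z \<and>
          (\<forall>\<alpha>\<in>set \<alpha>s. \<alpha> z \<in> form_span N vs z) \<and>
          (\<forall>\<beta>\<in>form_span N \<alpha>s z \<inter> form_span N \<theta>s z. \<forall>w\<in>tangent_space N z. \<beta> w = 0)))"

subsection \<open>Frame bundles and the isometric embedding system\<close>

(* ((x, v), (\<rho>, e)): a point x of a chart image and a tangent frame v $ 1, v $ 2 there; a point
   \<rho> of R^3 and a frame e $ 1, e $ 2, e $ 3. The frame vectors are the rows of the matrices. *)
type_synonym frames = "((real^2) \<times> (real^2^2)) \<times> ((real^3) \<times> (real^3^3))"

(* The part of the product of the two frame bundles that lies over the chart c. *)
definition frame_product :: "'a metric \<Rightarrow> 'a chart \<Rightarrow> frames set"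
  where "frame_product g c =
    {(x, v). x \<in> snd c ` fst c \<and> (\<forall>i j. ip (g c x) (v $ i) (v $ j) = (if i = j then 1 else 0)) \<and>
             det v > 0}
    \<times> {(\<rho>, e). \<forall>i j. e $ i \<bullet> e $ j = (if i = j then 1 else 0)}"

(* eta G i and eta_conn G j i are the components with respect to the orthonormal frame v of
   dx = v_i eta^i and of the covariant differential nabla v_i = v_j eta^j_i for the Levi-Civita
   connection. *)
fun eta :: "(real^2 \<Rightarrow> real^2^2) \<Rightarrow> 2 \<Rightarrow> (frames, real) one_form"
  where "eta G i ((x, v), _) ((dx, dv), _) = ip (G x) (v $ i) dx"

fun eta_conn :: "(real^2 \<Rightarrow> real^2^2) \<Rightarrow> 2 \<Rightarrow> 2 \<Rightarrow> (frames, real) one_form"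
  where "eta_conn G j i ((x, v), _) ((dx, dv), _) =
    ip (G x) (v $ j)
       (dv $ i + (\<chi> k. \<Sum>l\<in>UNIV. \<Sum>m\<in>UNIV. christoffel G k l m x * dx $ l * v $ i $ m))"

(* Likewise d\<rho> = e_i omega^i and de_i = e_j omega^j_i. *)
fun omega :: "3 \<Rightarrow> (frames, real) one_form"
  where "omega i (_, (\<rho>, e)) (_, (d\<rho>, de)) = e $ i \<bullet> d\<rho>"

fun omega_conn :: "3 \<Rightarrow> 3 \<Rightarrow> (frames, real) one_form"
  where "omega_conn j i (_, (\<rho>, e)) (_, (d\<rho>, de)) = e $ j \<bullet> de $ i"

definition thetas :: "(real^2 \<Rightarrow> real^2^2) \<Rightarrow> (frames, 'k::real_normed_field) one_form list"
  where "thetas G =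
    [\<lambda>z w. of_real (omega 3 z w),
     \<lambda>z w. of_real (omega 1 z w - eta G 1 z w),
     \<lambda>z w. of_real (omega 2 z w - eta G 2 z w),
     \<lambda>z w. of_real (omega_conn 1 2 z w - eta_conn G 1 2 z w)]"

(* The singular systems, with \<kappa> = k, - k (hyperbolic) and \<kappa> = i k, - i k (elliptic). *)
definition singular_system ::
    "(real^2 \<Rightarrow> real^2^2) \<Rightarrow> (real^2 \<Rightarrow> 'k) \<Rightarrow> (frames, 'k::real_normed_field) one_form list"
  where "singular_system G \<kappa> = thetas G @
    [\<lambda>z w. of_real (omega_conn 3 1 z w) - \<kappa> (fst (fst z)) * of_real (eta G 2 z w),
     \<lambda>z w. of_real (omega_conn 3 2 z w) + \<kappa> (fst (fst z)) * of_real (eta G 1 z w)]"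

definition darboux_along ::
    "'a chart set \<Rightarrow> 'a metric \<Rightarrow> ('a \<Rightarrow> 'k::real_normed_field) \<Rightarrow> bool"
  where "darboux_along A g \<kappa> \<longleftrightarrow>
    (\<forall>c\<in>A. contains_frobenius (frame_product g c) (thetas (g c))
              (singular_system (g c) (\<kappa> \<circ> chart_inv c)))"

(* The two disjuncts are the hyperbolic and the elliptic case. *)
definition darboux_integrable ::
    "'a topology \<Rightarrow> 'a chart set \<Rightarrow> 'a metric \<Rightarrow> ('a \<Rightarrow> real) \<Rightarrow> bool"
  where "darboux_integrable M A g K \<longleftrightarrow>
    (\<forall>p\<in>topspace M. K p < 0) \<and>
      darboux_along A g (\<lambda>p. sqrt \<bar>K p\<bar>) \<and>
      darboux_along A g (\<lambda>p. - sqrt \<bar>K p\<bar>)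
    \<or> (\<forall>p\<in>topspace M. K p > 0) \<and>
      darboux_along A g (\<lambda>p. \<i> * complex_of_real (sqrt \<bar>K p\<bar>)) \<and>
      darboux_along A g (\<lambda>p. - \<i> * complex_of_real (sqrt \<bar>K p\<bar>))"

end

theory Submission
  imports Defs
begin

text \<open>Over a chart, a Frobenius subbundle as in the definition of Darboux integrability is spanned by
  \<open>\<omega>\<^sup>3\<^sub>1 - \<kappa> \<eta>\<^sup>2 + \<Sum> a\<^sub>i \<theta>\<^sub>i\<close> and \<open>\<omega>\<^sup>3\<^sub>2 + \<kappa> \<eta>\<^sup>1 + \<Sum> b\<^sub>i \<theta>\<^sub>i\<close>, where \<open>\<kappa>\<^sup>2 = - K\<close>; the elliptic and the hyperbolic
  case differ only in the field of scalars. With \<open>l = ln |K| / 4\<close>, the Frobenius condition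
  expresses \<open>dl\<close> by the \<open>a\<^sub>i\<close>, \<open>b\<^sub>i\<close> and prescribes their derivatives along the two fields
  \<open>H\<^sub>1 - \<kappa> P\<^sub>2\<close>, \<open>H\<^sub>2 + \<kappa> P\<^sub>1\<close> annihilated by the whole singular system. Symmetry of the Hessian of \<open>l\<close> is
  then one algebraic relation between the \<open>a\<^sub>i\<close>, \<open>b\<^sub>i\<close>, and differentiating it twice gives enough
  relations to conclude that the Hessian is \<open>3 dl \<otimes> dl - K g\<close>. For \<open>q = exp (- 3 l)\<close> this means that
  the Hessian of \<open>q\<close> is \<open>3\<epsilon> q\<^bsup>-1/3\<^esup> g\<close>. A gradient with pure trace covariant derivative becomes a
  Killing field after rotation by \<open>J\<close>. Moreover \<open>|\<nabla>q|\<^sup>2 - 9\<epsilon> q\<^bsup>2/3\<^esup>\<close> is locally constant, and the forms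
  \<open>ds = dq / |\<nabla>q|\<close> and \<open>dt = g (J \<nabla>q, _) / |\<nabla>q|\<^sup>2\<close> are closed, which provides the coordinates.\<close>

subsection \<open>Smooth maps\<close>

text \<open>Forms are given on open sets of an ambient Euclidean space, but only their values on
  tangent vectors of the frame bundle matter. Exterior derivatives are therefore evaluated on vector
  fields tangent to the bundle, and identities that hold only on the bundle are differentiated only
  in tangent directions. The Frobenius condition prescribes derivatives of the coefficients only
  along directions annihilated by the singular system. The two fields
  \<open>H\<^sub>1 - \<kappa> P\<^sub>2\<close> and \<open>H\<^sub>2 + \<kappa> P\<^sub>1\<close>
  suffice because rotating the Euclidean frame does not affect functions on the frame bundle of the
  surface: along these fields the components of \<open>dl\<close> change by the covariant Hessian.
  The exponent in \<open>q\<close> is forced by the Hessian equation. For a constant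
  \<open>c\<close>, the Hessian of \<open>exp (c l)\<close> is \<open>exp (c l)\<close> times
  \<open>(c^2 + 3 c) dl \<otimes> dl - c K g\<close>, so \<open>c = -3\<close> is the nonzero value
  that removes \<open>dl \<otimes> dl\<close>; as \<open>|K| = exp (4 l)\<close>, this is the power
  -3/4 of \<open>|K|\<close>.\<close>

lemma frechet_derivative_cong_open:
  assumes "open S" "x \<in> S" "\<And>y. y \<in> S \<Longrightarrow> f y = g y"
  shows "f differentiable (at x) \<longleftrightarrow> g differentiable (at x)"
    and "frechet_derivative f (at x) = frechet_derivative g (at x)"
proof -
  have *: "(f has_derivative D) (at x) \<longleftrightarrow> (g has_derivative D) (at x)" for D
    using has_derivative_transform_within_open[OF _ assms(1,2), of f D UNIV g]
      has_derivative_transform_within_open[OF _ assms(1,2), of g D UNIV f] assms(3) by auto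
  show "f differentiable (at x) \<longleftrightarrow> g differentiable (at x)"
    unfolding differentiable_def using * by blast
  show "frechet_derivative f (at x) = frechet_derivative g (at x)"
    unfolding frechet_derivative_def using * by simp
qed

lemma times_diff_on_cong:
  assumes "open S" "\<And>y. y \<in> S \<Longrightarrow> f y = g y" "times_diff_on n S f"
  shows "times_diff_on n S g"
  using assms(2,3)
proof (induction n arbitrary: f g)
  case 0
  then show ?case using continuous_on_cong[of S S f g] by simp
next
  case (Suc n)
  show ?case unfolding times_diff_on.simps
  proof (intro conjI ballI allI)
    fix x assume "x \<in> S"
    then show "g differentiable (at x)"
      using frechet_derivative_cong_open(1)[OF assms(1), of x f g] Suc.prems by auto
  next
    fix v
    show "times_diff_on n S (\<lambda>x. frechet_derivative g (at x) v)"
    proof (rule Suc.IH)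
      show "times_diff_on n S (\<lambda>x. frechet_derivative f (at x) v)" using Suc.prems by simp
      show "frechet_derivative f (at x) v = frechet_derivative g (at x) v" if "x \<in> S" for x
        using frechet_derivative_cong_open(2)[OF assms(1) that, of f g] Suc.prems by auto
    qed
  qed
qed

lemma times_diff_on_SucI:
  assumes "open S" "\<And>x. x \<in> S \<Longrightarrow> (f has_derivative f' x) (at x)"
    "\<And>v. times_diff_on n S (\<lambda>x. f' x v)"
  shows "times_diff_on (Suc n) S f"
  unfolding times_diff_on.simps
proof (intro conjI ballI allI)
  show "f differentiable (at x)" if "x \<in> S" for x using assms(2)[OF that] by (rule differentiableI)
  show "times_diff_on n S (\<lambda>x. frechet_derivative f (at x) v)" for v
    by (rule times_diff_on_cong[OF assms(1) _ assms(3)[of v]])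
      (use frechet_derivative_at[OF assms(2)] in metis)
qed

lemma times_diff_on_continuous: "times_diff_on n S f \<Longrightarrow> continuous_on S f"
  by (cases n) (auto intro: differentiable_imp_continuous_on simp: differentiable_on_def
      differentiable_at_withinI)

lemma times_diff_on_SucD: "times_diff_on (Suc n) S f \<Longrightarrow> times_diff_on n S f"
proof (induction n arbitrary: f)
  case 0
  then show ?case using times_diff_on_continuous by fastforce
next
  case (Suc n)
  show ?case using Suc.prems Suc.IH by (auto simp del: times_diff_on.simps(2) simp: times_diff_on.simps(2)[of "Suc n"] times_diff_on.simps(2)[of n])
qed

lemma times_diff_on_subset: "T \<subseteq> S \<Longrightarrow> times_diff_on n S f \<Longrightarrow> times_diff_on n T f"
  by (induction n arbitrary: f) (auto intro: continuous_on_subset)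

lemma times_diff_on_const: "times_diff_on n S (\<lambda>x. c)"
  by (induction n arbitrary: c) auto

lemma times_diff_on_linear_comp:
  assumes "open S" "bounded_linear h" "times_diff_on n S f"
  shows "times_diff_on n S (\<lambda>x. h (f x))"
  using assms(3)
proof (induction n arbitrary: f)
  case 0
  then show ?case using bounded_linear.continuous_on[OF assms(2)] by simp
next
  case (Suc n)
  show ?case
  proof (rule times_diff_on_SucI[OF assms(1)])
    show "((\<lambda>x. h (f x)) has_derivative (\<lambda>v. h (frechet_derivative f (at x) v))) (at x)" if "x \<in> S" for x
      using Suc.prems that
      by (intro bounded_linear.has_derivative[OF assms(2)]) (auto simp: frechet_derivative_works[symmetric])
    show "times_diff_on n S (\<lambda>x. h (frechet_derivative f (at x) v))" for v
      using Suc.prems by (intro Suc.IH) auto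
  qed
qed

lemma times_diff_on_add:
  assumes "open S" "times_diff_on n S f" "times_diff_on n S g"
  shows "times_diff_on n S (\<lambda>x. f x + g x)"
  using assms(2,3)
proof (induction n arbitrary: f g)
  case 0
  then show ?case by (auto intro: continuous_on_add)
next
  case (Suc n)
  show ?case
  proof (rule times_diff_on_SucI[OF assms(1)])
    show "((\<lambda>x. f x + g x) has_derivative
      (\<lambda>v. frechet_derivative f (at x) v + frechet_derivative g (at x) v)) (at x)" if "x \<in> S" for x
      using Suc.prems that by (intro has_derivative_add) (auto simp: frechet_derivative_works[symmetric])
    show "times_diff_on n S (\<lambda>x. frechet_derivative f (at x) v + frechet_derivative g (at x) v)" for v
      using Suc.prems by (intro Suc.IH) auto
  qed
qed

lemma times_diff_on_bilinear:
  assumes "open S" "bounded_bilinear B" "times_diff_on n S f" "times_diff_on n S g"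
  shows "times_diff_on n S (\<lambda>x. B (f x) (g x))"
  using assms(3,4)
proof (induction n arbitrary: f g)
  case 0
  then show ?case by (auto intro: bounded_bilinear.continuous_on[OF assms(2)])
next
  case (Suc n)
  show ?case
  proof (rule times_diff_on_SucI[OF assms(1)])
    show "((\<lambda>x. B (f x) (g x)) has_derivative
      (\<lambda>v. B (f x) (frechet_derivative g (at x) v) + B (frechet_derivative f (at x) v) (g x))) (at x)"
      if "x \<in> S" for x
      using Suc.prems that
      by (intro bounded_bilinear.FDERIV[OF assms(2)]) (auto simp: frechet_derivative_works[symmetric])
    show "times_diff_on n S (\<lambda>x. B (f x) (frechet_derivative g (at x) v) + B (frechet_derivative f (at x) v) (g x))" for v
      using Suc.prems times_diff_on_SucD[of n S f] times_diff_on_SucD[of n S g]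
      by (intro times_diff_on_add[OF assms(1)] Suc.IH) auto
  qed
qed

lemma times_diff_on_sum:
  assumes "open S" "\<And>i. i \<in> I \<Longrightarrow> times_diff_on n S (f i)"
  shows "times_diff_on n S (\<lambda>x. \<Sum>i\<in>I. f i x)"
proof (cases "finite I")
  case True
  then show ?thesis using assms(2)
    by (induction I) (auto simp: times_diff_on_const intro!: times_diff_on_add[OF assms(1)])
qed (simp add: times_diff_on_const)

text \<open>In the chain rule the direction fed to the derivative of \<open>g\<close> varies with
  \<open>x\<close>, while the induction handles fixed directions only. Expanding that direction over
  \<open>Basis\<close> leaves a finite sum of products, each covered by the induction
  hypothesis.\<close>

lemma times_diff_on_compose:
  fixes g :: "'b::euclidean_space \<Rightarrow> 'c::real_normed_vector"
  assumes "open S" "open T" "\<And>x. x \<in> S \<Longrightarrow> f x \<in> T" "times_diff_on n T g" "times_diff_on n S f"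
  shows "times_diff_on n S (\<lambda>x. g (f x))"
  using assms(4,5)
proof (induction n arbitrary: g)
  case 0
  then show ?case using assms(3) by (auto intro: continuous_on_compose2)
next
  case (Suc n)
  show ?case
  proof (rule times_diff_on_SucI[OF assms(1)])
    fix x assume x: "x \<in> S"
    have f: "(f has_derivative frechet_derivative f (at x)) (at x)"
      using Suc.prems x by (auto simp: frechet_derivative_works[symmetric])
    have g: "(g has_derivative frechet_derivative g (at (f x))) (at (f x))"
      using Suc.prems assms(3)[OF x] by (auto simp: frechet_derivative_works[symmetric])
    have "((\<lambda>x. g (f x)) has_derivative (\<lambda>v. frechet_derivative g (at (f x)) (frechet_derivative f (at x) v))) (at x)"
      using has_derivative_compose[OF f g] by simp
    moreover have rep: "frechet_derivative g (at (f x)) w =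
       (\<Sum>b\<in>Basis. (w \<bullet> b) *\<^sub>R frechet_derivative g (at (f x)) b)" for w
    proof -
      have "frechet_derivative g (at (f x)) w = frechet_derivative g (at (f x)) (\<Sum>b\<in>Basis. (w \<bullet> b) *\<^sub>R b)"
        by (simp only: euclidean_representation)
      then show ?thesis
        by (simp only: linear_sum[OF has_derivative_linear[OF g]] linear_cmul[OF has_derivative_linear[OF g]])
    qed
    moreover have "(\<lambda>v. frechet_derivative g (at (f x)) (frechet_derivative f (at x) v)) =
        (\<lambda>v. \<Sum>b\<in>Basis. (frechet_derivative f (at x) v \<bullet> b) *\<^sub>R frechet_derivative g (at (f x)) b)"
      by (rule ext) (rule rep)
    ultimately show "((\<lambda>x. g (f x)) has_derivative
      (\<lambda>v. \<Sum>b\<in>Basis. (frechet_derivative f (at x) v \<bullet> b) *\<^sub>R frechet_derivative g (at (f x)) b)) (at x)"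
      by metis
  next
    fix v
    have "times_diff_on n S (\<lambda>x. frechet_derivative g (at (f x)) b)" for b
      using Suc.prems times_diff_on_SucD[of n S f]
      by (intro Suc.IH[of "\<lambda>y. frechet_derivative g (at y) b"]) auto
    then show "times_diff_on n S (\<lambda>x. \<Sum>b\<in>Basis. (frechet_derivative f (at x) v \<bullet> b) *\<^sub>R frechet_derivative g (at (f x)) b)"
      using Suc.prems
      by (intro times_diff_on_sum[OF assms(1)] times_diff_on_bilinear[OF assms(1) bounded_bilinear_scaleR]
          times_diff_on_linear_comp[OF assms(1) bounded_linear_inner_left]) auto
  qed
qed

lemma times_diff_on_inverse: "times_diff_on n (- {0}) (inverse :: real \<Rightarrow> real)"
proof (induction n)
  case 0
  then show ?case by (auto intro!: continuous_intros)
next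
  case (Suc n)
  have o: "open (- {0::real})" by auto
  show ?case
  proof (rule times_diff_on_SucI[OF o])
    show "(inverse has_derivative (\<lambda>v. - (inverse x * v * inverse x))) (at x)" if "x \<in> - {0}" for x :: real
      using that by (auto intro!: derivative_eq_intros)
    have "times_diff_on n (- {0}) (\<lambda>x::real. (- v) * (inverse x * inverse x))" for v
      by (intro times_diff_on_bilinear[OF o bounded_bilinear_mult] times_diff_on_const Suc)
    then show "times_diff_on n (- {0}) (\<lambda>x::real. - (inverse x * v * inverse x))" for v
      by (simp add: mult.assoc mult.left_commute)
  qed
qed

lemma times_diff_on_exp: "times_diff_on n UNIV (exp :: real \<Rightarrow> real)"
proof (induction n)
  case (Suc n)
  show ?case
  proof (rule times_diff_on_SucI)
    show "(exp has_derivative (\<lambda>v. v * exp x)) (at x)" for x :: real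
      by (auto intro!: derivative_eq_intros)
    show "times_diff_on n UNIV (\<lambda>x::real. v * exp x)" for v
      by (intro times_diff_on_bilinear[OF _ bounded_bilinear_mult] times_diff_on_const Suc) auto
  qed auto
qed (auto intro!: continuous_intros)

lemma times_diff_on_ln: "times_diff_on n {0<..} (ln :: real \<Rightarrow> real)"
proof (cases n)
  case (Suc m)
  show ?thesis unfolding Suc
  proof (rule times_diff_on_SucI)
    show "(ln has_derivative (\<lambda>v. v * inverse x)) (at x)" if "x \<in> {0<..}" for x :: real
      using that by (auto intro!: derivative_eq_intros simp: field_simps)
    show "times_diff_on m {0<..} (\<lambda>x::real. v * inverse x)" for v
      by (intro times_diff_on_bilinear[OF _ bounded_bilinear_mult] times_diff_on_const
          times_diff_on_subset[OF _ times_diff_on_inverse]) auto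
  qed auto
qed (auto intro!: continuous_intros)

lemma smooth_on_cong: "open S \<Longrightarrow> smooth_on S f \<Longrightarrow> (\<And>x. x \<in> S \<Longrightarrow> f x = g x) \<Longrightarrow> smooth_on S g"
  unfolding smooth_on_def using times_diff_on_cong by metis

lemma smooth_on_subset: "smooth_on S f \<Longrightarrow> T \<subseteq> S \<Longrightarrow> smooth_on T f"
  unfolding smooth_on_def using times_diff_on_subset by metis

lemma smooth_on_const [simp]: "smooth_on S (\<lambda>x. c)"
  by (simp add: smooth_on_def times_diff_on_const)

lemma smooth_on_linear_comp: "open S \<Longrightarrow> bounded_linear h \<Longrightarrow> smooth_on S f \<Longrightarrow> smooth_on S (\<lambda>x. h (f x))"
  by (simp add: smooth_on_def times_diff_on_linear_comp)

lemma smooth_on_add: "open S \<Longrightarrow> smooth_on S f \<Longrightarrow> smooth_on S g \<Longrightarrow> smooth_on S (\<lambda>x. f x + g x)"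
  by (simp add: smooth_on_def times_diff_on_add)

lemma smooth_on_mult:
  fixes f g :: "'a::real_normed_vector \<Rightarrow> real"
  shows "open S \<Longrightarrow> smooth_on S f \<Longrightarrow> smooth_on S g \<Longrightarrow> smooth_on S (\<lambda>x. f x * g x)"
  by (simp add: smooth_on_def times_diff_on_bilinear[OF _ bounded_bilinear_mult])

lemma smooth_on_scaleR:
  shows "open S \<Longrightarrow> smooth_on S f \<Longrightarrow> smooth_on S g \<Longrightarrow> smooth_on S (\<lambda>x. f x *\<^sub>R g x)"
  by (simp add: smooth_on_def times_diff_on_bilinear[OF _ bounded_bilinear_scaleR])

lemma smooth_on_minus: "open S \<Longrightarrow> smooth_on S f \<Longrightarrow> smooth_on S (\<lambda>x. - f x)"
  by (rule smooth_on_linear_comp) (auto intro: bounded_linear_minus bounded_linear_ident)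

lemma smooth_on_diff: "open S \<Longrightarrow> smooth_on S f \<Longrightarrow> smooth_on S g \<Longrightarrow> smooth_on S (\<lambda>x. f x - g x)"
  using smooth_on_add[of S f "\<lambda>x. - g x"] smooth_on_minus[of S g] by simp

lemma smooth_on_sum: "open S \<Longrightarrow> (\<And>i. i \<in> I \<Longrightarrow> smooth_on S (f i)) \<Longrightarrow> smooth_on S (\<lambda>x. \<Sum>i\<in>I. f i x)"
  by (simp add: smooth_on_def times_diff_on_sum)

lemma smooth_on_compose:
  fixes g :: "'b::euclidean_space \<Rightarrow> 'c::real_normed_vector"
  shows "open S \<Longrightarrow> open T \<Longrightarrow> smooth_on T g \<Longrightarrow> smooth_on S f \<Longrightarrow> (\<And>x. x \<in> S \<Longrightarrow> f x \<in> T) \<Longrightarrow>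
    smooth_on S (\<lambda>x. g (f x))"
  unfolding smooth_on_def using times_diff_on_compose[of S T f _ g] by blast

lemma smooth_on_divide:
  fixes f g :: "'a::real_normed_vector \<Rightarrow> real"
  assumes "open S" "smooth_on S f" "smooth_on S g" "\<And>x. x \<in> S \<Longrightarrow> g x \<noteq> 0"
  shows "smooth_on S (\<lambda>x. f x / g x)"
proof -
  have "smooth_on S (\<lambda>x. inverse (g x))"
    by (rule smooth_on_compose[OF assms(1) _ _ assms(3), of "- {0}"])
      (use assms times_diff_on_inverse in \<open>auto simp: smooth_on_def\<close>)
  then show ?thesis using smooth_on_mult[OF assms(1,2)] by (simp add: divide_inverse)
qed

lemma smooth_on_exp:
  fixes f :: "'a::real_normed_vector \<Rightarrow> real"
  shows "open S \<Longrightarrow> smooth_on S f \<Longrightarrow> smooth_on S (\<lambda>x. exp (f x))"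
  by (rule smooth_on_compose[of S UNIV]) (use times_diff_on_exp in \<open>auto simp: smooth_on_def\<close>)

lemma smooth_on_ln:
  fixes f :: "'a::real_normed_vector \<Rightarrow> real"
  shows "open S \<Longrightarrow> smooth_on S f \<Longrightarrow> (\<And>x. x \<in> S \<Longrightarrow> f x > 0) \<Longrightarrow> smooth_on S (\<lambda>x. ln (f x))"
  by (rule smooth_on_compose[of S "{0<..}"]) (use times_diff_on_ln in \<open>auto simp: smooth_on_def\<close>)

lemma smooth_on_powr:
  fixes f :: "'a::real_normed_vector \<Rightarrow> real"
  assumes "open S" "smooth_on S f" "\<And>x. x \<in> S \<Longrightarrow> f x > 0"
  shows "smooth_on S (\<lambda>x. f x powr a)"
proof (rule smooth_on_cong[OF assms(1)])
  show "smooth_on S (\<lambda>x. exp (a * ln (f x)))"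
    by (intro smooth_on_exp smooth_on_mult smooth_on_ln assms smooth_on_const)
  show "exp (a * ln (f x)) = f x powr a" if "x \<in> S" for x
    using assms(3)[OF that] by (simp add: powr_def)
qed

lemma smooth_on_sqrt:
  fixes f :: "'a::real_normed_vector \<Rightarrow> real"
  assumes "open S" "smooth_on S f" "\<And>x. x \<in> S \<Longrightarrow> f x > 0"
  shows "smooth_on S (\<lambda>x. sqrt (f x))"
  by (rule smooth_on_cong[OF assms(1) smooth_on_powr[OF assms, of "1/2"]])
    (use assms(3) in \<open>auto simp: powr_half_sqrt less_imp_le\<close>)

lemma smooth_on_vec_nth: "open S \<Longrightarrow> smooth_on S f \<Longrightarrow> smooth_on S (\<lambda>x. f x $ i)"
  by (rule smooth_on_linear_comp[OF _ bounded_linear_vec_nth])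

lemma smooth_on_vec:
  fixes f :: "'a::real_normed_vector \<Rightarrow> real^'n"
  assumes "open S" "\<And>i. smooth_on S (\<lambda>x. f x $ i)"
  shows "smooth_on S f"
proof -
  have "smooth_on S (\<lambda>x. \<Sum>i\<in>UNIV. (f x $ i) *\<^sub>R axis i (1::real))"
    by (intro smooth_on_sum smooth_on_scaleR assms smooth_on_const)
  moreover have "(\<Sum>i\<in>UNIV. (f x $ i) *\<^sub>R axis i (1::real)) = f x" for x
    using basis_expansion[of "f x"] by (simp add: scalar_mult_eq_scaleR)
  ultimately show ?thesis by simp
qed

lemma smooth_on_has_derivative:
  assumes "smooth_on S f" "x \<in> S"
  shows "(f has_derivative frechet_derivative f (at x)) (at x)"
  using assms unfolding smooth_on_def
  by (metis frechet_derivative_works times_diff_on.simps(2))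

lemma smooth_on_continuous: "smooth_on S f \<Longrightarrow> continuous_on S f"
  unfolding smooth_on_def using times_diff_on_continuous by blast

lemma smooth_on_frechet: "smooth_on S f \<Longrightarrow> smooth_on S (\<lambda>x. frechet_derivative f (at x) v)"
  unfolding smooth_on_def by (metis times_diff_on.simps(2))

lemma smooth_on_pd: "smooth_on S f \<Longrightarrow> smooth_on S (pd i f)"
  using smooth_on_frechet[of S f "axis i 1"] unfolding pd_def[abs_def] by simp

text \<open>Smoothness inherited from an explicit differential; this is how the coordinates
  \<open>s\<close> and \<open>t\<close> become smooth, being known through \<open>ds\<close> and
  \<open>dt\<close>.\<close>

lemma smooth_onI:
  assumes "open S" "\<And>x. x \<in> S \<Longrightarrow> (f has_derivative f' x) (at x)" "\<And>v. smooth_on S (\<lambda>x. f' x v)"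
  shows "smooth_on S f"
  unfolding smooth_on_def
proof
  fix n
  have "times_diff_on (Suc n) S f"
    by (rule times_diff_on_SucI[OF assms(1,2)]) (use assms(3) in \<open>auto simp: smooth_on_def\<close>)
  then show "times_diff_on n S f" by (rule times_diff_on_SucD)
qed

subsection \<open>Partial derivatives in the plane\<close>

lemma linear_R2:
  fixes L :: "real^2 \<Rightarrow> 'b::real_vector"
  assumes "linear L" shows "L v = (v$1) *\<^sub>R L (axis 1 1) + (v$2) *\<^sub>R L (axis 2 1)"
proof -
  have "v = (v$1) *\<^sub>R axis 1 1 + (v$2) *\<^sub>R axis 2 1"
    by (simp add: vec_eq_iff forall_2 axis_def)
  from arg_cong[OF this, of L] show ?thesis
    by (simp only: linear_add[OF assms] linear_cmul[OF assms])
qed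

lemma has_derivative_pd:
  assumes "f differentiable (at x)"
  shows "(f has_derivative (\<lambda>v. pd 1 f x * v$1 + pd 2 f x * v$2)) (at x)"
proof -
  have d: "(f has_derivative frechet_derivative f (at x)) (at x)"
    using assms by (simp add: frechet_derivative_works[symmetric])
  have "frechet_derivative f (at x) v = pd 1 f x * v$1 + pd 2 f x * v$2" for v
    using linear_R2[OF has_derivative_linear[OF d], of v] by (simp add: pd_def mult.commute)
  then show ?thesis using d by (metis (no_types, lifting) ext)
qed

lemma pd_eqI:
  assumes "(f has_derivative D) (at x)" shows "pd i f x = D (axis i 1)"
  using frechet_derivative_at[OF assms] by (simp add: pd_def)

lemma smooth_on_differentiable: "smooth_on S f \<Longrightarrow> x \<in> S \<Longrightarrow> f differentiable (at x)"
  using smooth_on_has_derivative differentiableI by blast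

lemmas smooth_has_derivative_pd = has_derivative_pd[OF smooth_on_differentiable]

lemma pd_cong: "open S \<Longrightarrow> x \<in> S \<Longrightarrow> (\<And>y. y \<in> S \<Longrightarrow> f y = g y) \<Longrightarrow> pd i f x = pd i g x"
  unfolding pd_def using frechet_derivative_cong_open(2) by metis

lemma pd_add: "f differentiable (at x) \<Longrightarrow> g differentiable (at x) \<Longrightarrow>
    pd i (\<lambda>y. f y + g y) x = pd i f x + pd i g x"
  by (rule pd_eqI[where D = "\<lambda>v. frechet_derivative f (at x) v + frechet_derivative g (at x) v", folded pd_def])
    (auto intro!: has_derivative_add simp: frechet_derivative_works[symmetric])

lemma pd_mult: "f differentiable (at x) \<Longrightarrow> g differentiable (at x) \<Longrightarrow>
    pd i (\<lambda>y. f y * g y) x = f x * pd i g x + pd i f x * g x"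
  by (rule pd_eqI[where D = "\<lambda>v. f x * frechet_derivative g (at x) v + frechet_derivative f (at x) v * g x", folded pd_def])
    (auto intro!: has_derivative_mult simp: frechet_derivative_works[symmetric])

lemma pd_diff: "f differentiable (at x) \<Longrightarrow> g differentiable (at x) \<Longrightarrow>
    pd i (\<lambda>y. f y - g y) x = pd i f x - pd i g x"
  by (rule pd_eqI[where D = "\<lambda>v. frechet_derivative f (at x) v - frechet_derivative g (at x) v", folded pd_def])
    (auto intro!: has_derivative_diff simp: frechet_derivative_works[symmetric])

lemma pd_minus: "f differentiable (at x) \<Longrightarrow> pd i (\<lambda>y. - f y) x = - pd i f x"
  by (rule pd_eqI[where D = "\<lambda>v. - frechet_derivative f (at x) v", folded pd_def])
    (auto intro!: has_derivative_minus simp: frechet_derivative_works[symmetric])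

lemma pd_const: "pd i (\<lambda>y. c) x = 0"
  by (simp add: pd_def)

lemma pd_chain_real:
  assumes "f differentiable (at x)" "(\<phi> has_real_derivative d) (at (f x))"
  shows "pd i (\<lambda>y. \<phi> (f y)) x = d * pd i f x"
proof -
  have "((\<lambda>y. \<phi> (f y)) has_derivative (\<lambda>v. frechet_derivative f (at x) v * d)) (at x)"
    using has_derivative_compose[OF assms(1)[unfolded frechet_derivative_works] assms(2)[unfolded has_field_derivative_def]]
    by (simp add: mult.commute)
  from pd_eqI[OF this] show ?thesis by (simp add: pd_def)
qed

lemma has_real_derivative_line:
  assumes "(g has_derivative (\<lambda>d. d *\<^sub>R a)) (at s)" "(f has_derivative D) (at (g s))"
  shows "((\<lambda>s. f (g s)) has_real_derivative D a) (at s)"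
proof -
  have "(\<lambda>d. D (d *\<^sub>R a)) = (*) (D a)"
    by (rule ext) (simp add: linear_cmul[OF has_derivative_linear[OF assms(2)]])
  then show ?thesis
    using has_derivative_compose[OF assms] by (simp add: has_field_derivative_def)
qed

text \<open>Both mixed derivatives are limits of the same second difference quotient.\<close>

lemma second_difference_mvt:
  fixes f :: "real^2 \<Rightarrow> real"
  assumes ball: "ball x r \<subseteq> S" and f: "smooth_on S f" and h: "0 < h" "2 * h < r"
  shows "\<exists>y. dist x y \<le> 2 * h \<and>
     f (x + h *\<^sub>R axis i 1 + h *\<^sub>R axis j 1) - f (x + h *\<^sub>R axis i 1) - f (x + h *\<^sub>R axis j 1) + f x
       = h * h * pd j (pd i f) y"
proof -
  have inS: "x + s *\<^sub>R axis i 1 + t *\<^sub>R axis j 1 \<in> S" "dist x (x + s *\<^sub>R axis i 1 + t *\<^sub>R axis j 1) \<le> 2 * h"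
    if "0 \<le> s" "s \<le> h" "0 \<le> t" "t \<le> h" for s t
  proof -
    have "norm (s *\<^sub>R axis i (1::real) + t *\<^sub>R axis j 1 :: real^2) \<le> s + t"
      using norm_triangle_ineq[of "s *\<^sub>R axis i (1::real)" "t *\<^sub>R axis j 1 :: real^2"] that
      by (simp add: norm_axis_1)
    then show "dist x (x + s *\<^sub>R axis i 1 + t *\<^sub>R axis j 1) \<le> 2 * h"
      using that by (simp add: dist_norm norm_minus_commute algebra_simps)
    then show "x + s *\<^sub>R axis i 1 + t *\<^sub>R axis j 1 \<in> S" using ball h by auto
  qed
  define F where "F s = f (x + s *\<^sub>R axis i 1 + h *\<^sub>R axis j 1) - f (x + s *\<^sub>R axis i 1)" for s
  have dF: "(F has_real_derivative pd i f (x + s *\<^sub>R axis i 1 + h *\<^sub>R axis j 1) - pd i f (x + s *\<^sub>R axis i 1)) (at s)"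
    if "0 \<le> s" "s \<le> h" for s
  proof -
    have lin: "((\<lambda>s. x + s *\<^sub>R axis i 1 + t *\<^sub>R axis j 1) has_derivative (\<lambda>d. d *\<^sub>R axis i 1)) (at s)" for t
      by (auto intro!: derivative_eq_intros)
    have "((\<lambda>s. f (x + s *\<^sub>R axis i 1 + t *\<^sub>R axis j 1)) has_real_derivative pd i f (x + s *\<^sub>R axis i 1 + t *\<^sub>R axis j 1)) (at s)"
      if "0 \<le> t" "t \<le> h" for t
    proof -
      have D: "(f has_derivative frechet_derivative f (at (x + s *\<^sub>R axis i 1 + t *\<^sub>R axis j 1))) (at (x + s *\<^sub>R axis i 1 + t *\<^sub>R axis j 1))"
        using smooth_on_has_derivative[OF f inS(1)] that \<open>0 \<le> s\<close> \<open>s \<le> h\<close> by auto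
      from has_real_derivative_line[OF lin D] show ?thesis
        unfolding pd_def .
    qed
    from DERIV_diff[OF this[of h] this[of 0]] show ?thesis unfolding F_def[abs_def] using h by simp
  qed
  obtain s where s: "0 < s" "s < h" "F h - F 0 = (h - 0) * (pd i f (x + s *\<^sub>R axis i 1 + h *\<^sub>R axis j 1) - pd i f (x + s *\<^sub>R axis i 1))"
    using MVT2[of 0 h F, OF _ dF] h by auto
  define g where "g t = pd i f (x + s *\<^sub>R axis i 1 + t *\<^sub>R axis j 1)" for t
  have dg: "(g has_real_derivative pd j (pd i f) (x + s *\<^sub>R axis i 1 + t *\<^sub>R axis j 1)) (at t)"
    if "0 \<le> t" "t \<le> h" for t
  proof -
    have lin: "((\<lambda>t. x + s *\<^sub>R axis i 1 + t *\<^sub>R axis j 1) has_derivative (\<lambda>d. d *\<^sub>R axis j 1)) (at t)"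
      by (auto intro!: derivative_eq_intros)
    have D: "(pd i f has_derivative frechet_derivative (pd i f) (at (x + s *\<^sub>R axis i 1 + t *\<^sub>R axis j 1))) (at (x + s *\<^sub>R axis i 1 + t *\<^sub>R axis j 1))"
      using smooth_on_has_derivative[OF smooth_on_pd[OF f] inS(1)] that s by auto
    from has_real_derivative_line[OF lin D] show ?thesis
      unfolding pd_def g_def[abs_def] .
  qed
  obtain t where t: "0 < t" "t < h" "g h - g 0 = (h - 0) * pd j (pd i f) (x + s *\<^sub>R axis i 1 + t *\<^sub>R axis j 1)"
    using MVT2[of 0 h g, OF _ dg] h by auto
  show ?thesis
    by (rule exI[of _ "x + s *\<^sub>R axis i 1 + t *\<^sub>R axis j 1"])
      (use s t inS(2)[of s t] in \<open>auto simp: F_def g_def algebra_simps\<close>)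
qed

lemma pd_commute:
  assumes "open S" "x \<in> S" "smooth_on S f"
  shows "pd i (pd j f) x = pd j (pd i f) x"
proof (rule ccontr)
  assume ne: "pd i (pd j f) x \<noteq> pd j (pd i f) x"
  \<comment> \<open>Half the gap: a value common to nearby mixed derivatives cannot be closer than
    \<open>e\<close> to both.\<close>
  define e where "e = \<bar>pd i (pd j f) x - pd j (pd i f) x\<bar> / 2"
  have e: "e > 0" using ne by (simp add: e_def)
  have c: "continuous (at x) (pd i (pd j f))" "continuous (at x) (pd j (pd i f))"
    using assms smooth_on_continuous[OF smooth_on_pd[OF smooth_on_pd[OF assms(3)]]]
    by (auto simp: continuous_on_eq_continuous_at)
  obtain d1 where d1: "d1 > 0" "\<And>y. dist y x < d1 \<Longrightarrow> dist (pd i (pd j f) y) (pd i (pd j f) x) < e"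
    using c(1) e unfolding continuous_at_eps_delta by blast
  obtain d2 where d2: "d2 > 0" "\<And>y. dist y x < d2 \<Longrightarrow> dist (pd j (pd i f) y) (pd j (pd i f) x) < e"
    using c(2) e unfolding continuous_at_eps_delta by blast
  obtain r where r: "r > 0" "ball x r \<subseteq> S" using assms openE by metis
  define h where "h = min r (min d1 d2) / 4"
  have h: "0 < h" "2 * h < r" "2 * h < d1" "2 * h < d2"
    using r d1(1) d2(1) by (auto simp: h_def min_def)
  obtain y where y: "dist x y \<le> 2 * h"
     "f (x + h *\<^sub>R axis i 1 + h *\<^sub>R axis j 1) - f (x + h *\<^sub>R axis i 1) - f (x + h *\<^sub>R axis j 1) + f x
       = h * h * pd j (pd i f) y"
    using second_difference_mvt[OF r(2) assms(3) h(1,2)] by blast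
  obtain z where z: "dist x z \<le> 2 * h"
     "f (x + h *\<^sub>R axis j 1 + h *\<^sub>R axis i 1) - f (x + h *\<^sub>R axis j 1) - f (x + h *\<^sub>R axis i 1) + f x
       = h * h * pd i (pd j f) z"
    using second_difference_mvt[OF r(2) assms(3) h(1,2)] by blast
  have "h * h * pd j (pd i f) y = h * h * pd i (pd j f) z"
    using y(2) z(2) by (simp add: algebra_simps)
  then have "pd j (pd i f) y = pd i (pd j f) z" using h(1) by simp
  moreover have "\<bar>pd j (pd i f) y - pd j (pd i f) x\<bar> < e" "\<bar>pd i (pd j f) z - pd i (pd j f) x\<bar> < e"
    using d2(2)[of y] d1(2)[of z] y(1) z(1) h by (auto simp: dist_commute dist_real_def)
  ultimately show False unfolding e_def by argo
qed

subsection \<open>Riemannian metrics on plane domains\<close>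

lemma has_derivative_vec:
  fixes f :: "'a::real_normed_vector \<Rightarrow> 'b::euclidean_space^'n"
  assumes "\<And>i. ((\<lambda>x. f x $ i) has_derivative (\<lambda>h. f' h $ i)) (at x within S)"
  shows "(f has_derivative f') (at x within S)"
  unfolding has_derivative_componentwise_within[of f]
proof
  fix b :: "'b^'n" assume "b \<in> Basis"
  then obtain i u where b: "b = axis i u" "u \<in> Basis" by (auto simp: Basis_vec_def)
  have "((\<lambda>x. f x $ i \<bullet> u) has_derivative (\<lambda>h. f' h $ i \<bullet> u)) (at x within S)"
    using assms by (auto intro!: derivative_eq_intros)
  then show "((\<lambda>x. f x \<bullet> b) has_derivative (\<lambda>h. f' h \<bullet> b)) (at x within S)"
    by (simp add: b inner_axis)
qed

lemma ip_2: "ip M u v = M$1$1 * u$1 * v$1 + M$1$2 * u$1 * v$2 + M$2$1 * u$2 * v$1 + M$2$2 * u$2 * v$2"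
  by (simp add: ip_def inner_vec_def matrix_vector_mult_def sum_2 algebra_simps)

lemma matrix_inv_2:
  fixes M :: "real^2^2"
  assumes "det M \<noteq> 0"
  shows "matrix_inv M = vector [vector [M$2$2 / det M, - M$1$2 / det M], vector [- M$2$1 / det M, M$1$1 / det M]]"
    (is "_ = ?N")
proof -
  define D where "D = det M"
  have D: "D \<noteq> 0" "D = M$1$1 * M$2$2 - M$1$2 * M$2$1" using assms by (simp_all add: D_def det_2)
  have e: "(M$1$1 * M$2$2 - M$1$2 * M$2$1) / D = 1" using D by simp
  have MN: "M ** ?N = mat 1" "?N ** M = mat 1"
    unfolding vec_eq_iff forall_2 D_def[symmetric]
    using e by (simp_all add: matrix_matrix_mult_def mat_def sum_2 diff_divide_distrib mult.commute)
  then have "M ** matrix_inv M = mat 1 \<and> matrix_inv M ** M = mat 1"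
    unfolding matrix_inv_def by (intro someI_ex[of "\<lambda>A'. M ** A' = mat 1 \<and> A' ** M = mat 1"]) blast
  then have "(matrix_inv M ** M) ** ?N = ?N" by simp
  then show ?thesis using MN(1) by (simp only: matrix_mul_assoc[symmetric] matrix_mul_rid)
qed

locale riemannian_chart =
  fixes S :: "(real^2) set" and G :: "real^2 \<Rightarrow> real^2^2"
  assumes open_S: "open S" and smooth_G: "smooth_on S G"
    and sym_G: "\<And>x. x \<in> S \<Longrightarrow> transpose (G x) = G x"
    and pos_G: "\<And>x u. x \<in> S \<Longrightarrow> u \<noteq> 0 \<Longrightarrow> ip (G x) u u > 0"
begin

lemma G_21: "x \<in> S \<Longrightarrow> G x $ 2 $ 1 = G x $ 1 $ 2"
  using arg_cong[OF sym_G[of x], of "\<lambda>M. M $ 1 $ 2"] by (simp add: transpose_def)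

lemma G_sym: "x \<in> S \<Longrightarrow> G x $ i $ j = G x $ j $ i"
  using arg_cong[OF sym_G[of x], of "\<lambda>M. M $ j $ i"] by (simp add: transpose_def)

lemma G_11_pos: "x \<in> S \<Longrightarrow> G x $ 1 $ 1 > 0"
  using pos_G[of x "vector [1,0]"] by (simp add: ip_2 vec_eq_iff forall_2)

lemma det_G: "x \<in> S \<Longrightarrow> det (G x) = G x $ 1 $ 1 * G x $ 2 $ 2 - (G x $ 1 $ 2)\<^sup>2"
  by (simp add: det_2 G_21 power2_eq_square)

lemma det_G_pos: assumes "x \<in> S" shows "det (G x) > 0"
proof -
  \<comment> \<open>The test vector is orthogonal to the first axis, and its squared length is
    \<open>g11\<close> times the determinant.\<close>
  have "ip (G x) (vector [- (G x $ 1 $ 2), G x $ 1 $ 1]) (vector [- (G x $ 1 $ 2), G x $ 1 $ 1])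
     = G x $ 1 $ 1 * det (G x)"
    using assms by (simp add: ip_2 det_G G_21 power2_eq_square algebra_simps)
  moreover have "ip (G x) (vector [- (G x $ 1 $ 2), G x $ 1 $ 1]) (vector [- (G x $ 1 $ 2), G x $ 1 $ 1]) > 0"
    using G_11_pos[OF assms] by (intro pos_G[OF assms]) (auto simp: vec_eq_iff forall_2)
  ultimately show ?thesis using G_11_pos[OF assms] by (simp add: zero_less_mult_iff)
qed

lemma smooth_G_nth: "smooth_on S (\<lambda>x. G x $ i $ j)"
  by (intro smooth_on_vec_nth open_S smooth_G)

lemma smooth_det_G: "smooth_on S (\<lambda>x. det (G x))"
  unfolding det_2 by (intro smooth_on_diff smooth_on_mult smooth_G_nth open_S)

lemma matrix_inv_G:
  assumes "x \<in> S"
  shows "matrix_inv (G x) $ 1 $ 1 = G x $ 2 $ 2 / det (G x)"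
    "matrix_inv (G x) $ 1 $ 2 = - G x $ 1 $ 2 / det (G x)"
    "matrix_inv (G x) $ 2 $ 1 = - G x $ 1 $ 2 / det (G x)"
    "matrix_inv (G x) $ 2 $ 2 = G x $ 1 $ 1 / det (G x)"
  using matrix_inv_2[of "G x"] det_G_pos[OF assms] G_21[OF assms] by simp_all

lemma smooth_matrix_inv_G: "smooth_on S (\<lambda>x. matrix_inv (G x) $ i $ j)"
proof (rule smooth_on_cong[OF open_S])
  show "smooth_on S (\<lambda>x. vector [vector [G x$2$2 / det (G x), - G x$1$2 / det (G x)],
      vector [- G x$2$1 / det (G x), G x$1$1 / det (G x)]] $ i $ j :: real)"
    using exhaust_2[of i] exhaust_2[of j] det_G_pos
    by (auto intro!: smooth_on_divide smooth_on_minus smooth_G_nth smooth_det_G open_S) fastforce+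
qed (use matrix_inv_2 det_G_pos in fastforce)

lemma smooth_pd_G: "smooth_on S (\<lambda>x. pd l (\<lambda>y. G y $ i $ j) x)"
  by (intro smooth_on_pd smooth_G_nth)

lemma smooth_christoffel: "smooth_on S (christoffel G k i j)"
  unfolding christoffel_def[abs_def]
  by (intro smooth_on_divide smooth_on_sum smooth_on_mult smooth_on_add smooth_on_diff
      smooth_matrix_inv_G smooth_pd_G open_S smooth_on_const) auto

lemma pd_G_sym: "x \<in> S \<Longrightarrow> pd l (\<lambda>y. G y $ i $ j) x = pd l (\<lambda>y. G y $ j $ i) x"
  by (rule pd_cong[OF open_S]) (auto intro: G_sym)

lemma christoffel_sym: "x \<in> S \<Longrightarrow> christoffel G k i j x = christoffel G k j i x"
  unfolding christoffel_def
  by (intro arg_cong[where f = "\<lambda>t. t / 2"] sum.cong refl) (simp add: pd_G_sym[of x _ i j])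

lemma christoffel_lower:
  assumes "x \<in> S"
  shows "(\<Sum>k\<in>UNIV. G x $ m $ k * christoffel G k i j x) =
    (pd i (\<lambda>y. G y $ j $ m) x + pd j (\<lambda>y. G y $ i $ m) x - pd m (\<lambda>y. G y $ i $ j) x) / 2"
  using det_G_pos[OF assms] exhaust_2[of m]
  by (auto simp: christoffel_def sum_2 matrix_inv_G[OF assms] G_21[OF assms] field_simps)
    (simp_all add: det_G[OF assms] power2_eq_square algebra_simps)

lemma metric_compatible:
  assumes "x \<in> S"
  shows "pd i (\<lambda>y. G y $ j $ k) x =
    (\<Sum>l\<in>UNIV. G x $ l $ k * christoffel G l i j x + G x $ j $ l * christoffel G l i k x)"
  using christoffel_lower[OF assms, of k i j] christoffel_lower[OF assms, of j i k]
    pd_G_sym[OF assms, of k i j] pd_G_sym[OF assms, of i j k] pd_G_sym[OF assms, of j i k]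
    G_sym[OF assms, of k]
  by (simp add: sum.distrib)

text \<open>The mixed second derivatives of the metric coefficients commute. Expanding both orders
  by metric compatibility cancels everything except the curvature terms.\<close>

lemma curvature_skew:
  assumes x: "x \<in> S"
  shows "(\<Sum>l\<in>UNIV. G x $ l $ k * riemann_curvature G l j 1 2 x) +
    (\<Sum>l\<in>UNIV. G x $ j $ l * riemann_curvature G l k 1 2 x) = 0"
proof -
  have dG: "(\<lambda>y. G y $ a $ b) differentiable (at x)" for a b
    by (rule smooth_on_differentiable[OF smooth_G_nth x])
  have dC: "christoffel G a b c differentiable (at x)" for a b c
    by (rule smooth_on_differentiable[OF smooth_christoffel x])
  have *: "pd m (pd i (\<lambda>y. G y $ j $ k)) x =
    G x $ 1 $ k * pd m (christoffel G 1 i j) x + pd m (\<lambda>y. G y $ 1 $ k) x * christoffel G 1 i j x +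
    (G x $ j $ 1 * pd m (christoffel G 1 i k) x + pd m (\<lambda>y. G y $ j $ 1) x * christoffel G 1 i k x) +
    (G x $ 2 $ k * pd m (christoffel G 2 i j) x + pd m (\<lambda>y. G y $ 2 $ k) x * christoffel G 2 i j x +
    (G x $ j $ 2 * pd m (christoffel G 2 i k) x + pd m (\<lambda>y. G y $ j $ 2) x * christoffel G 2 i k x))"
    for m i
  proof -
    have "pd m (pd i (\<lambda>y. G y $ j $ k)) x =
      pd m (\<lambda>y. G y $ 1 $ k * christoffel G 1 i j y + G y $ j $ 1 * christoffel G 1 i k y +
        (G y $ 2 $ k * christoffel G 2 i j y + G y $ j $ 2 * christoffel G 2 i k y)) x"
      by (rule pd_cong[OF open_S x]) (simp add: metric_compatible sum_2)
    then show ?thesis by (simp add: pd_add pd_mult dG dC differentiable_add differentiable_mult)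
  qed
  have "pd 1 (pd 2 (\<lambda>y. G y $ j $ k)) x = pd 2 (pd 1 (\<lambda>y. G y $ j $ k)) x"
    by (rule pd_commute[OF open_S x smooth_G_nth])
  then show ?thesis
    unfolding * metric_compatible[OF x] riemann_curvature_def sum_2
    by (simp add: algebra_simps)
qed

text \<open>In dimension two skewness leaves a single unknown. Three skewness equations and the
  definition of the Gauss curvature form a linear system for the four components, solvable because
  the determinant of the metric is positive.\<close>

lemma curvature_components:
  assumes x: "x \<in> S"
  shows "riemann_curvature G 1 1 1 2 x = gauss_formula G x * G x $ 1 $ 2"
    "riemann_curvature G 1 2 1 2 x = gauss_formula G x * G x $ 2 $ 2"
    "riemann_curvature G 2 1 1 2 x = - gauss_formula G x * G x $ 1 $ 1"
    "riemann_curvature G 2 2 1 2 x = - gauss_formula G x * G x $ 1 $ 2"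
proof -
  define r where "r l k = riemann_curvature G l k 1 2 x" for l k
  define a b c K where "a = G x $ 1 $ 1" "b = G x $ 1 $ 2" "c = G x $ 2 $ 2" "K = gauss_formula G x"
  note d = this
  have D: "a * c - b\<^sup>2 > 0" using det_G_pos[OF x] by (simp add: det_G[OF x] d)
  have 1: "a * r 1 1 + b * r 2 1 = 0" and 2: "b * r 1 2 + c * r 2 2 = 0"
    and 3: "b * r 1 1 + c * r 2 1 + (a * r 1 2 + b * r 2 2) = 0"
    using curvature_skew[OF x, of 1 1] curvature_skew[OF x, of 2 2] curvature_skew[OF x, of 2 1]
    by (simp_all add: sum_2 r_def d G_21[OF x])
  have 4: "a * r 1 2 + b * r 2 2 = K * (a * c - b\<^sup>2)"
    using D det_G[OF x] by (simp add: d gauss_formula_def sum_2 r_def)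
  have "(a * c - b\<^sup>2) * r 1 1 = (a * c - b\<^sup>2) * (K * b)"
    "(a * c - b\<^sup>2) * r 1 2 = (a * c - b\<^sup>2) * (K * c)"
    "(a * c - b\<^sup>2) * r 2 1 = (a * c - b\<^sup>2) * (- K * a)"
    "(a * c - b\<^sup>2) * r 2 2 = (a * c - b\<^sup>2) * (- K * b)"
    using 1 2 3 4 by algebra+
  then have "r 1 1 = K * b" "r 1 2 = K * c" "r 2 1 = - K * a" "r 2 2 = - K * b"
    using D by (simp_all only: mult_cancel_left) auto
  then show "riemann_curvature G 1 1 1 2 x = gauss_formula G x * G x $ 1 $ 2"
    "riemann_curvature G 1 2 1 2 x = gauss_formula G x * G x $ 2 $ 2"
    "riemann_curvature G 2 1 1 2 x = - gauss_formula G x * G x $ 1 $ 1"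
    "riemann_curvature G 2 2 1 2 x = - gauss_formula G x * G x $ 1 $ 2"
    by (simp_all add: r_def d)
qed

section \<open>Orthonormal frames of the metric\<close>

definition frames_on :: "((real^2) \<times> (real^2^2)) set" where
  "frames_on = {(x, v). x \<in> S \<and> (\<forall>i j. ip (G x) (v $ i) (v $ j) = (if i = j then 1 else 0)) \<and> det v > 0}"

lemma frame_exists: assumes "x \<in> S" shows "\<exists>v. (x, v) \<in> frames_on"
proof -
  define a b D where "a = G x $ 1 $ 1" "b = G x $ 1 $ 2" "D = det (G x)"
  note d = this
  have pos: "a > 0" "D > 0" using G_11_pos det_G_pos assms by (auto simp: d)
  have c: "G x $ 2 $ 2 = (D + b\<^sup>2) / a" using pos det_G[OF assms] by (simp add: d field_simps)
  \<comment> \<open>Gram-Schmidt on the coordinate axes: \<open>(-b, a)\<close> is orthogonal to the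
    first axis and has squared length \<open>a * D\<close>.\<close>
  define v :: "real^2^2" where "v = vector [vector [1 / sqrt a, 0], vector [- b / sqrt (a * D), a / sqrt (a * D)]]"
  have sq: "sqrt a * sqrt a = a" "sqrt D * sqrt D = D" using pos by auto
  have sq2: "sqrt (a * D) = sqrt a * sqrt D" by (simp add: real_sqrt_mult)
  have nz: "sqrt a > 0" "sqrt D > 0" using pos by auto
  have 11: "ip (G x) (v $ 1) (v $ 1) = 1"
    using nz sq by (simp add: ip_2 v_def d[symmetric] field_simps)
  have 12: "ip (G x) (v $ 1) (v $ 2) = 0" "ip (G x) (v $ 2) (v $ 1) = 0"
    using nz sq by (simp_all add: ip_2 v_def d(1,2)[symmetric] G_21[OF assms] field_simps)
  have "ip (G x) (v $ 2) (v $ 2) = (a * D) / (sqrt (a * D) * sqrt (a * D))"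
    using pos by (simp add: ip_2 v_def d(1,2)[symmetric] G_21[OF assms] c field_simps power2_eq_square)
  then have 22: "ip (G x) (v $ 2) (v $ 2) = 1" using pos by simp
  have "det v > 0" using nz pos by (simp add: det_2 v_def)
  then show ?thesis using 11 12 22 assms by (auto simp: frames_on_def forall_2)
qed

text \<open>Orthonormality says that the metric times the transposed frame matrix is the inverse
  frame matrix; these are its entries by Cramer's rule, with the determinant cleared.\<close>

lemma frame_dual:
  assumes "(x, v) \<in> frames_on"
  shows "det v * (G x $ 1 $ 1 * v$1$1 + G x $ 1 $ 2 * v$1$2) = v$2$2"
    "det v * (G x $ 1 $ 2 * v$1$1 + G x $ 2 $ 2 * v$1$2) = - v$2$1"
    "det v * (G x $ 1 $ 1 * v$2$1 + G x $ 1 $ 2 * v$2$2) = - v$1$2"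
    "det v * (G x $ 1 $ 2 * v$2$1 + G x $ 2 $ 2 * v$2$2) = v$1$1"
proof -
  have x: "x \<in> S" using assms by (simp add: frames_on_def)
  have "ip (G x) (v $ 1) (v $ 1) = 1" "ip (G x) (v $ 1) (v $ 2) = 0" "ip (G x) (v $ 2) (v $ 2) = 1"
    using assms by (auto simp: frames_on_def)
  then show "det v * (G x $ 1 $ 1 * v$1$1 + G x $ 1 $ 2 * v$1$2) = v$2$2"
    "det v * (G x $ 1 $ 2 * v$1$1 + G x $ 2 $ 2 * v$1$2) = - v$2$1"
    "det v * (G x $ 1 $ 1 * v$2$1 + G x $ 1 $ 2 * v$2$2) = - v$1$2"
    "det v * (G x $ 1 $ 2 * v$2$1 + G x $ 2 $ 2 * v$2$2) = v$1$1"
    unfolding ip_2 G_21[OF x] det_2 by algebra+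
qed

text \<open>By skewness \<open>det v\<close> turns the curvature operator of the coordinate fields
  into that of \<open>v $ 1\<close>, \<open>v $ 2\<close>, which in an orthonormal frame is
  \<open>K\<close> times a quarter turn.\<close>

lemma curvature_frame:
  assumes "(x, v) \<in> frames_on"
  shows "det v * (\<Sum>k\<in>UNIV. riemann_curvature G l k 1 2 x * v$1$k) = - gauss_formula G x * v$2$l"
    "det v * (\<Sum>k\<in>UNIV. riemann_curvature G l k 1 2 x * v$2$k) = gauss_formula G x * v$1$l"
proof -
  have x: "x \<in> S" using assms by (simp add: frames_on_def)
  note fd = frame_dual[OF assms]
  show "det v * (\<Sum>k\<in>UNIV. riemann_curvature G l k 1 2 x * v$1$k) = - gauss_formula G x * v$2$l"
    using exhaust_2[of l]
  proof
    assume l: "l = 1"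
    show ?thesis unfolding sum_2 l curvature_components[OF x] using arg_cong[OF fd(2), of "(*) (gauss_formula G x)"] by (simp add: algebra_simps)
  next
    assume l: "l = 2"
    show ?thesis unfolding sum_2 l curvature_components[OF x] using arg_cong[OF fd(1), of "(*) (gauss_formula G x)"] by (simp add: algebra_simps)
  qed
  show "det v * (\<Sum>k\<in>UNIV. riemann_curvature G l k 1 2 x * v$2$k) = gauss_formula G x * v$1$l"
    using exhaust_2[of l]
  proof
    assume l: "l = 1"
    show ?thesis unfolding sum_2 l curvature_components[OF x] using arg_cong[OF fd(4), of "(*) (gauss_formula G x)"] by (simp add: algebra_simps)
  next
    assume l: "l = 2"
    show ?thesis unfolding sum_2 l curvature_components[OF x] using arg_cong[OF fd(3), of "(*) (gauss_formula G x)"] by (simp add: algebra_simps)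
  qed
qed

lemma frame_tensor_zero:
  assumes f: "(x, v) \<in> frames_on"
    and z: "\<And>i j. (\<Sum>l\<in>UNIV. \<Sum>m\<in>UNIV. T l m * v$i$l * v$j$m) = (0::real)"
  shows "T l m = 0"
proof -
  have d: "v$1$1 * v$2$2 - v$1$2 * v$2$1 > 0" using f by (simp add: frames_on_def det_2)
  have "T 1 1 * v$1$1 * v$1$1 + T 1 2 * v$1$1 * v$1$2 + (T 2 1 * v$1$2 * v$1$1 + T 2 2 * v$1$2 * v$1$2) = 0"
    "T 1 1 * v$1$1 * v$2$1 + T 1 2 * v$1$1 * v$2$2 + (T 2 1 * v$1$2 * v$2$1 + T 2 2 * v$1$2 * v$2$2) = 0"
    "T 1 1 * v$2$1 * v$1$1 + T 1 2 * v$2$1 * v$1$2 + (T 2 1 * v$2$2 * v$1$1 + T 2 2 * v$2$2 * v$1$2) = 0"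
    "T 1 1 * v$2$1 * v$2$1 + T 1 2 * v$2$1 * v$2$2 + (T 2 1 * v$2$2 * v$2$1 + T 2 2 * v$2$2 * v$2$2) = 0"
    using z[of 1 1] z[of 1 2] z[of 2 1] z[of 2 2] by (simp_all add: sum_2)
  then have "(v$1$1 * v$2$2 - v$1$2 * v$2$1)\<^sup>2 * T 1 1 = 0" "(v$1$1 * v$2$2 - v$1$2 * v$2$1)\<^sup>2 * T 1 2 = 0"
    "(v$1$1 * v$2$2 - v$1$2 * v$2$1)\<^sup>2 * T 2 1 = 0" "(v$1$1 * v$2$2 - v$1$2 * v$2$1)\<^sup>2 * T 2 2 = 0"
    by algebra+
  then show ?thesis using d exhaust_2[of l] exhaust_2[of m] by auto
qed

text \<open>The Gram--Schmidt process turns a line that is orthonormal to first order into a curve of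
  orthonormal frames with the same velocity.\<close>

lemma frames_on_curve:
  assumes f: "(x, v) \<in> frames_on"
    and d0: "\<And>i j. ((\<lambda>t. ip (G (x + t *\<^sub>R dx)) (v$i + t *\<^sub>R dv$i) (v$j + t *\<^sub>R dv$j)) has_real_derivative 0) (at 0)"
  shows "\<exists>\<gamma>. \<gamma> 0 = (x, v) \<and> (\<forall>t::real. \<gamma> t \<in> frames_on) \<and> (\<gamma> has_vector_derivative (dx, dv)) (at 0)"
proof -
  have x: "x \<in> S" and dv: "det v > 0" and on: "\<And>i j. ip (G x) (v $ i) (v $ j) = (if i = j then 1 else 0)"
    using f by (auto simp: frames_on_def)
  define X where "X t = x + t *\<^sub>R dx" for t :: real
  define w where "w i t = v$i + t *\<^sub>R dv$i" for i and t :: real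
  define M where "M i j t = ip (G (X t)) (w i t) (w j t)" for i j t
  have M0: "M 1 1 0 = 1" "M 1 2 0 = 0" "M 2 2 0 = 1" using on by (auto simp: M_def X_def w_def)
  have dM: "(M i j has_real_derivative 0) (at 0)" for i j
    using d0[of i j] unfolding M_def[abs_def] X_def w_def .
  \<comment> \<open>Squared length of the part of \<open>w 2 t\<close> orthogonal to
    \<open>w 1 t\<close>. Its derivative at 0 vanishes, which is why the normalisation leaves the
    velocity \<open>dv\<close> unchanged.\<close>
  define N where "N t = M 2 2 t - (M 1 2 t)\<^sup>2 / M 1 1 t" for t
  define e1 where "e1 t = (1 / sqrt (M 1 1 t)) *\<^sub>R w 1 t" for t
  define e2 where "e2 t = (1 / sqrt (N t)) *\<^sub>R (w 2 t - (M 1 2 t / M 1 1 t) *\<^sub>R w 1 t)" for t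
  define e :: "real \<Rightarrow> real^2^2" where "e t = vector [e1 t, e2 t]" for t
  have N0: "N 0 = 1" by (simp add: N_def M0)
  have dw: "(w i has_vector_derivative dv$i) (at 0)" for i
    unfolding w_def[abs_def] by (auto intro!: derivative_eq_intros)
  have dN: "(N has_real_derivative 0) (at 0)"
    unfolding N_def[abs_def] using M0 by (auto intro!: derivative_eq_intros dM)
  have "((\<lambda>t. 1 / sqrt (M 1 1 t)) has_real_derivative 0) (at 0)"
    using M0 by (auto intro!: derivative_eq_intros dM)
  from has_vector_derivative_scaleR[OF this dw[of 1]]
  have de1: "(e1 has_vector_derivative dv$1) (at 0)"
    unfolding e1_def[abs_def] by (simp add: M0)
  have a: "((\<lambda>t. 1 / sqrt (N t)) has_real_derivative 0) (at 0)"
    using N0 by (auto intro!: derivative_eq_intros dN)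
  have b: "((\<lambda>t. M 1 2 t / M 1 1 t) has_real_derivative 0) (at 0)"
    using M0 by (auto intro!: derivative_eq_intros dM)
  from has_vector_derivative_scaleR[OF a has_vector_derivative_diff[OF dw[of 2] has_vector_derivative_scaleR[OF b dw[of 1]]]]
  have de2: "(e2 has_vector_derivative dv$2) (at 0)"
    unfolding e2_def[abs_def] by (simp add: M0 N0)
  have de: "(e has_vector_derivative dv) (at 0)"
    unfolding has_vector_derivative_def
  proof (rule has_derivative_vec)
    fix i :: 2
    show "((\<lambda>t. e t $ i) has_derivative (\<lambda>h. (h *\<^sub>R dv) $ i)) (at 0)"
      using de1 de2 exhaust_2[of i] by (auto simp: e_def has_vector_derivative_def)
  qed
  have dX: "(X has_vector_derivative dx) (at 0)"
    unfolding X_def[abs_def] by (auto intro!: derivative_eq_intros)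
  have "((\<lambda>t. w 1 t $ 1 * w 2 t $ 2 - w 1 t $ 2 * w 2 t $ 1) \<longlongrightarrow> v$1$1 * v$2$2 - v$1$2 * v$2$1) (at 0)"
    unfolding w_def by (auto intro!: tendsto_eq_intros)
  moreover have "v$1$1 * v$2$2 - v$1$2 * v$2$1 > 0" using dv by (simp add: det_2)
  ultimately have ev4: "\<forall>\<^sub>F t in at 0. w 1 t $ 1 * w 2 t $ 2 - w 1 t $ 2 * w 2 t $ 1 > 0"
    by (rule order_tendstoD)
  have ev1: "\<forall>\<^sub>F t in at 0. X t \<in> S"
    using topological_tendstoD[OF has_vector_derivative_continuous[OF dX, unfolded continuous_at] open_S] x
    by (simp add: X_def)
  have ev2: "\<forall>\<^sub>F t in at 0. M 1 1 t > 0"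
    using DERIV_isCont[OF dM[of 1 1]] M0(1) by (auto simp: isCont_def intro: order_tendstoD)
  have ev3: "\<forall>\<^sub>F t in at 0. N t > 0"
    using DERIV_isCont[OF dN] N0 by (auto simp: isCont_def intro: order_tendstoD)
  have "\<forall>\<^sub>F t in at 0. (X t, e t) \<in> frames_on"
    using ev1 ev2 ev3 ev4
  proof eventually_elim
    case (elim t)
    have MN: "M 1 1 t * N t = M 1 1 t * M 2 2 t - (M 1 2 t)\<^sup>2"
      using elim by (simp add: N_def field_simps)
    have s: "sqrt (M 1 1 t) * sqrt (M 1 1 t) = M 1 1 t" "sqrt (N t) * sqrt (N t) = N t"
      using elim by auto
    have 21: "ip (G (X t)) (w 2 t) (w 1 t) = M 1 2 t"
      by (simp add: M_def ip_2 G_21[OF elim(1)] algebra_simps)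
    have add: "ip Q (u - p *\<^sub>R y) z = ip Q u z - p * ip Q y z" "ip Q z (u - p *\<^sub>R y) = ip Q z u - p * ip Q z y"
      "ip Q (p *\<^sub>R y) z = p * ip Q y z" "ip Q z (p *\<^sub>R y) = p * ip Q z y" for Q u p y z
      by (simp_all add: ip_2 algebra_simps)
    have "ip (G (X t)) (e1 t) (e1 t) = M 1 1 t / (sqrt (M 1 1 t) * sqrt (M 1 1 t))"
      by (simp add: e1_def add M_def)
    then have 1: "ip (G (X t)) (e1 t) (e1 t) = 1" using elim by simp
    have 2: "ip (G (X t)) (e1 t) (e2 t) = 0" "ip (G (X t)) (e2 t) (e1 t) = 0"
      using elim 21 by (simp_all add: e1_def e2_def add M_def[symmetric])
    have "ip (G (X t)) (e2 t) (e2 t) = (M 2 2 t - (M 1 2 t)\<^sup>2 / M 1 1 t) / (sqrt (N t) * sqrt (N t))"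
      using elim 21 by (simp add: e2_def add M_def[symmetric] power2_eq_square field_simps)
    then have 3: "ip (G (X t)) (e2 t) (e2 t) = 1" using elim by (simp add: N_def[symmetric])
    have "det (e t) = (w 1 t $ 1 * w 2 t $ 2 - w 1 t $ 2 * w 2 t $ 1) / (sqrt (M 1 1 t) * sqrt (N t))"
      using elim by (simp add: det_2 e_def e1_def e2_def field_simps)
    then have "det (e t) > 0" using elim by simp
    then show ?case using 1 2 3 elim by (auto simp: frames_on_def forall_2 e_def)
  qed
  then obtain \<delta> where \<delta>: "\<delta> > 0" "\<And>t. t \<noteq> 0 \<Longrightarrow> \<bar>t\<bar> < \<delta> \<Longrightarrow> (X t, e t) \<in> frames_on"
    unfolding eventually_at by (auto simp: dist_real_def)
  have e0: "(X 0, e 0) = (x, v)"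
    using M0 N0 by (auto simp: X_def e_def e1_def e2_def w_def vec_eq_iff forall_2)
  \<comment> \<open>\<open>tangent_space\<close> asks for a curve that stays in the set for all
    times, so beyond \<open>\<delta>\<close> the curve is replaced by the base point.\<close>
  define \<gamma> where "\<gamma> t = (if \<bar>t\<bar> < \<delta> then (X t, e t) else (x, v))" for t
  have "((\<lambda>t. (X t, e t)) has_vector_derivative (dx, dv)) (at 0)"
    by (rule has_vector_derivative_Pair[OF dX de])
  then have "(\<gamma> has_vector_derivative (dx, dv)) (at 0)"
    by (rule has_vector_derivative_transform_within_open[where S = "ball 0 \<delta>"])
      (use \<delta>(1) in \<open>auto simp: \<gamma>_def dist_real_def\<close>)
  moreover have "\<gamma> 0 = (x, v)" "\<forall>t. \<gamma> t \<in> frames_on"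
    using e0 \<delta> f unfolding \<gamma>_def by (auto, metis)
  ultimately show ?thesis by blast
qed

end

subsection \<open>Forms along submanifolds\<close>

text \<open>A derivative in a tangent direction is computed along a curve inside \<open>N\<close>,
  so it sees only values on \<open>N\<close>. This permits differentiating identities that fail off
  the bundle.\<close>

lemma tangent_derivative_unique:
  assumes "open U" "z \<in> N" "z \<in> U" "w \<in> tangent_space N z"
    and f: "(f has_derivative f') (at z)" and g: "(g has_derivative g') (at z)"
    and eq: "\<And>y. y \<in> N \<Longrightarrow> y \<in> U \<Longrightarrow> f y = g y"
  shows "f' w = g' w"
proof -
  obtain \<gamma> where \<gamma>: "\<gamma> 0 = z" "\<forall>t::real. \<gamma> t \<in> N" "(\<gamma> has_vector_derivative w) (at 0)"
    using assms(4) by (auto simp: tangent_space_def)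
  have vd: "((\<lambda>t. f (\<gamma> t)) has_vector_derivative f' w) (at 0)" if "(f has_derivative f') (at z)" for f f'
  proof -
    have "((\<lambda>t. f (\<gamma> t)) has_derivative (\<lambda>t. f' (t *\<^sub>R w))) (at 0)"
      using has_derivative_compose[OF \<gamma>(3)[unfolded has_vector_derivative_def], of f f'] that \<gamma>(1) by simp
    then show ?thesis
      by (simp add: has_vector_derivative_def linear_cmul[OF has_derivative_linear[OF that]])
  qed
  have "(\<gamma> \<longlongrightarrow> \<gamma> 0) (at 0)"
    using has_vector_derivative_continuous[OF \<gamma>(3)] by (simp add: continuous_at)
  then have "\<forall>\<^sub>F t in at 0. \<gamma> t \<in> U"
    by (rule topological_tendstoD) (use assms \<gamma>(1) in auto)
  then have ev: "\<forall>\<^sub>F t in nhds 0. \<gamma> t \<in> U"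
    using assms(3) \<gamma>(1) by (simp add: eventually_at_filter) (erule eventually_mono, metis)
  then have "\<forall>\<^sub>F t in nhds 0. f (\<gamma> t) = g (\<gamma> t)"
    by (rule eventually_mono) (use \<gamma>(2) eq in blast)
  then obtain T where T: "open T" "0 \<in> T" "\<And>t. t \<in> T \<Longrightarrow> f (\<gamma> t) = g (\<gamma> t)"
    unfolding eventually_nhds by blast
  have "((\<lambda>t. g (\<gamma> t)) has_vector_derivative f' w) (at 0)"
    using has_vector_derivative_transform_within_open[OF vd[OF f] T] .
  then show ?thesis using vector_derivative_unique_at vd[OF g] by blast
qed

text \<open>A product rule for the pairing of a form with a field. Differentiability of the form is
  assumed only on each fixed vector, so the field is expanded over \<open>Basis\<close>.\<close>

lemma form_field_has_derivative:
  fixes \<alpha> :: "('b::euclidean_space, 'k::real_normed_field) one_form"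
  assumes U: "open U" "z \<in> U" and lin: "\<And>y. y \<in> U \<Longrightarrow> linear (\<alpha> y)"
    and diff: "\<And>w. (\<lambda>y. \<alpha> y w) differentiable (at z)"
    and Y: "(Y has_derivative Y') (at z)"
  shows "((\<lambda>y. \<alpha> y (Y y)) has_derivative
    (\<lambda>h. frechet_derivative (\<lambda>y. \<alpha> y (Y z)) (at z) h + \<alpha> z (Y' h))) (at z)"
proof -
  have rep: "\<alpha> y w = (\<Sum>b\<in>Basis. (w \<bullet> b) *\<^sub>R \<alpha> y b)" if "y \<in> U" for y w
  proof -
    have "\<alpha> y w = \<alpha> y (\<Sum>b\<in>Basis. (w \<bullet> b) *\<^sub>R b)" by (simp only: euclidean_representation)
    then show ?thesis by (simp only: linear_sum[OF lin[OF that]] linear_cmul[OF lin[OF that]])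
  qed
  define D where "D b = frechet_derivative (\<lambda>y. \<alpha> y b) (at z)" for b
  have D: "((\<lambda>y. \<alpha> y b) has_derivative D b) (at z)" for b
    using diff unfolding D_def by (simp add: frechet_derivative_works[symmetric])
  have "((\<lambda>y. \<Sum>b\<in>Basis. (Y y \<bullet> b) *\<^sub>R \<alpha> y b) has_derivative
     (\<lambda>h. \<Sum>b\<in>Basis. (Y z \<bullet> b) *\<^sub>R D b h + (Y' h \<bullet> b) *\<^sub>R \<alpha> z b)) (at z)"
    by (intro has_derivative_sum has_derivative_scaleR D has_derivative_inner_left Y)
  then have 1: "((\<lambda>y. \<alpha> y (Y y)) has_derivative
     (\<lambda>h. \<Sum>b\<in>Basis. (Y z \<bullet> b) *\<^sub>R D b h + (Y' h \<bullet> b) *\<^sub>R \<alpha> z b)) (at z)"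
    by (rule has_derivative_transform_within_open[OF _ U]) (rule rep[symmetric])
  have "((\<lambda>y. \<Sum>b\<in>Basis. (Y z \<bullet> b) *\<^sub>R \<alpha> y b) has_derivative
     (\<lambda>h. \<Sum>b\<in>Basis. (Y z \<bullet> b) *\<^sub>R D b h)) (at z)"
    by (intro has_derivative_sum has_derivative_scaleR_right D)
  then have "((\<lambda>y. \<alpha> y (Y z)) has_derivative (\<lambda>h. \<Sum>b\<in>Basis. (Y z \<bullet> b) *\<^sub>R D b h)) (at z)"
    by (rule has_derivative_transform_within_open[OF _ U]) (rule rep[symmetric])
  then have "frechet_derivative (\<lambda>y. \<alpha> y (Y z)) (at z) = (\<lambda>h. \<Sum>b\<in>Basis. (Y z \<bullet> b) *\<^sub>R D b h)"
    by (rule frechet_derivative_at[symmetric])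
  then have "(\<lambda>h. frechet_derivative (\<lambda>y. \<alpha> y (Y z)) (at z) h + \<alpha> z (Y' h)) =
     (\<lambda>h. \<Sum>b\<in>Basis. (Y z \<bullet> b) *\<^sub>R D b h + (Y' h \<bullet> b) *\<^sub>R \<alpha> z b)"
    unfolding sum.distrib rep[OF U(2), symmetric] by simp
  then show ?thesis using 1 by (simp only:)
qed

text \<open>Only the values of the form on the vector fields along the submanifold enter.\<close>

lemma ext_deriv_fields:
  fixes \<alpha> :: "('b::euclidean_space, 'k::real_normed_field) one_form"
  assumes U: "open U" "z \<in> N" "z \<in> U" and lin: "\<And>y. y \<in> U \<Longrightarrow> linear (\<alpha> y)"
    and diff: "\<And>w. (\<lambda>y. \<alpha> y w) differentiable (at z)"
    and X: "(X has_derivative X') (at z)" "X z \<in> tangent_space N z"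
      "(f has_derivative f') (at z)" "\<And>y. y \<in> N \<Longrightarrow> y \<in> U \<Longrightarrow> \<alpha> y (X y) = f y"
    and Y: "(Y has_derivative Y') (at z)" "Y z \<in> tangent_space N z"
      "(g has_derivative g') (at z)" "\<And>y. y \<in> N \<Longrightarrow> y \<in> U \<Longrightarrow> \<alpha> y (Y y) = g y"
  shows "ext_deriv \<alpha> z (X z) (Y z) = g' (X z) - f' (Y z) - \<alpha> z (Y' (X z) - X' (Y z))"
proof -
  have "frechet_derivative (\<lambda>y. \<alpha> y (Y z)) (at z) (X z) + \<alpha> z (Y' (X z)) = g' (X z)"
    using tangent_derivative_unique[OF U X(2) form_field_has_derivative[OF U(1,3) lin diff Y(1)] Y(3,4)] .
  moreover have "frechet_derivative (\<lambda>y. \<alpha> y (X z)) (at z) (Y z) + \<alpha> z (X' (Y z)) = f' (Y z)"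
    using tangent_derivative_unique[OF U Y(2) form_field_has_derivative[OF U(1,3) lin diff X(1)] X(3,4)] .
  ultimately show ?thesis
    unfolding ext_deriv_def linear_diff[OF lin[OF U(3)]] by (simp add: algebra_simps)
qed

lemma tangent_space_Times:
  assumes "\<gamma> 0 = p" "\<forall>t::real. \<gamma> t \<in> A" "(\<gamma> has_vector_derivative v) (at 0)"
    "\<delta> 0 = q" "\<forall>t::real. \<delta> t \<in> B" "(\<delta> has_vector_derivative w) (at 0)"
  shows "(v, w) \<in> tangent_space (A \<times> B) (p, q)"
  unfolding tangent_space_def
  by (intro CollectI exI[of _ "\<lambda>t. (\<gamma> t, \<delta> t)"]) (use assms in \<open>auto intro: has_vector_derivative_Pair\<close>)

subsection \<open>The adapted frame field on the product of the frame bundles\<close>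

definition orthonormal_frames :: "((real^3) \<times> (real^3^3)) set" where
  "orthonormal_frames = {(\<rho>, e). \<forall>i j. e $ i \<bullet> e $ j = (if i = j then 1 else 0)}"

definition rotate_rows :: "3 \<Rightarrow> 3 \<Rightarrow> real^3^3 \<Rightarrow> real^3^3" where
  "rotate_rows i j e = (\<chi> a. if a = i then e $ j else if a = j then - (e $ i) else 0)"

lemma linear_rotate_rows: "linear (rotate_rows i j)"
  by (rule linearI) (auto simp: rotate_rows_def vec_eq_iff)

lemma orthonormal_frames_rotate:
  assumes "(\<rho>, e) \<in> orthonormal_frames" "i \<noteq> j"
  shows "\<exists>\<gamma>. \<gamma> 0 = (\<rho>, e) \<and> (\<forall>t::real. \<gamma> t \<in> orthonormal_frames) \<and>
    (\<gamma> has_vector_derivative (0, rotate_rows i j e)) (at 0)"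
proof (intro exI conjI allI)
  define e' where "e' t = (\<chi> a. if a = i then cos t *\<^sub>R e $ i + sin t *\<^sub>R e $ j
      else if a = j then cos t *\<^sub>R e $ j - sin t *\<^sub>R e $ i else e $ a)" for t
  let ?\<gamma> = "\<lambda>t. (\<rho>, e' t)"
  show "?\<gamma> 0 = (\<rho>, e)" by (simp add: e'_def vec_eq_iff)
  show "?\<gamma> t \<in> orthonormal_frames" for t
  proof -
    have on: "e $ a \<bullet> e $ b = (if a = b then 1 else 0)" for a b
      using assms by (auto simp: orthonormal_frames_def)
    have sc: "cos t * cos t + sin t * sin t = 1" "sin t * sin t + cos t * cos t = 1"
      using sin_cos_squared_add[of t] by (simp_all add: power2_eq_square)
    show ?thesis using assms(2)
      by (auto simp: orthonormal_frames_def e'_def inner_add_left inner_add_right inner_diff_left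
          inner_diff_right on sc)
  qed
  have "(e' has_vector_derivative rotate_rows i j e) (at 0)"
    unfolding has_vector_derivative_def
  proof (rule has_derivative_vec)
    fix a
    show "((\<lambda>t. e' t $ a) has_derivative (\<lambda>h. (h *\<^sub>R rotate_rows i j e) $ a)) (at 0)"
      by (auto simp: e'_def rotate_rows_def intro!: derivative_eq_intros)
  qed
  then show "(?\<gamma> has_vector_derivative (0, rotate_rows i j e)) (at 0)"
    by (intro has_vector_derivative_Pair has_vector_derivative_const)
qed

lemma orthonormal_frames_translate:
  assumes "(\<rho>, e) \<in> orthonormal_frames"
  shows "\<exists>\<gamma>. \<gamma> 0 = (\<rho>, e) \<and> (\<forall>t::real. \<gamma> t \<in> orthonormal_frames) \<and> (\<gamma> has_vector_derivative (c, 0)) (at 0)"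
  using assms by (intro exI[of _ "\<lambda>t. (\<rho> + t *\<^sub>R c, e)"])
    (auto simp: orthonormal_frames_def intro!: derivative_eq_intros has_vector_derivative_Pair)

text \<open>The translations \<open>trans_field i\<close> are dual to \<open>\<omega>\<^sup>i\<close>, while \<open>rot_field 1 3\<close>, \<open>rot_field 2 3\<close> and
  \<open>rot_field 2 1\<close> are dual to \<open>\<omega>\<^sup>3\<^sub>1\<close>, \<open>\<omega>\<^sup>3\<^sub>2\<close> and \<open>\<omega>\<^sup>1\<^sub>2\<close>; below, \<open>horizontal_field i i\<close> is dual to \<open>\<eta>\<^sup>i\<close>
  and \<open>spin_field\<close> to \<open>\<eta>\<^sup>1\<^sub>2\<close> in the coframe \<open>\<eta>\<^sup>1, \<eta>\<^sup>2, \<eta>\<^sup>1\<^sub>2, \<theta>\<^sub>0, \<dots>, \<theta>\<^sub>3, \<omega>\<^sup>3\<^sub>1, \<omega>\<^sup>3\<^sub>2\<close>.\<close>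

definition trans_field :: "3 \<Rightarrow> frames \<Rightarrow> frames" where
  "trans_field i z = (0, (snd (snd z) $ i, 0))"

definition rot_field :: "3 \<Rightarrow> 3 \<Rightarrow> frames \<Rightarrow> frames" where
  "rot_field i j z = (0, (0, rotate_rows i j (snd (snd z))))"

lemma linear_trans_field: "linear (trans_field i)"
  by (rule linearI) (simp_all add: trans_field_def zero_prod_def)

lemma linear_rot_field: "linear (rot_field i j)"
  by (rule linearI) (simp_all add: rot_field_def zero_prod_def linear_add[OF linear_rotate_rows]
      linear_cmul[OF linear_rotate_rows])

lemma has_derivative_trans_field: "(trans_field i has_derivative trans_field i) (at z)"
  using linear_trans_field by (simp add: bounded_linear_imp_has_derivative linear_conv_bounded_linear)

lemma has_derivative_rot_field: "(rot_field i j has_derivative rot_field i j) (at z)"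
  using linear_rot_field by (simp add: bounded_linear_imp_has_derivative linear_conv_bounded_linear)

context riemannian_chart
begin

definition frame_bundle :: "frames set" where
  "frame_bundle = frames_on \<times> orthonormal_frames"

text \<open>Horizontal lift of the frame vector \<open>v $ i\<close>: the velocity of the frame
  under Levi-Civita parallel transport in that direction.\<close>

definition horizontal :: "2 \<Rightarrow> (real^2) \<times> (real^2^2) \<Rightarrow> (real^2) \<times> (real^2^2)" where
  "horizontal i p = (snd p $ i, \<chi> j k. - (\<Sum>l\<in>UNIV. \<Sum>m\<in>UNIV. christoffel G k l m (fst p) * snd p $ i $ l * snd p $ j $ m))"

definition horizontal' :: "2 \<Rightarrow> (real^2) \<times> (real^2^2) \<Rightarrow> (real^2) \<times> (real^2^2) \<Rightarrow> (real^2) \<times> (real^2^2)" where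
  "horizontal' i p h = (snd h $ i, \<chi> j k. - (\<Sum>l\<in>UNIV. \<Sum>m\<in>UNIV.
      (pd 1 (christoffel G k l m) (fst p) * fst h $ 1 + pd 2 (christoffel G k l m) (fst p) * fst h $ 2) * snd p $ i $ l * snd p $ j $ m
      + christoffel G k l m (fst p) * snd h $ i $ l * snd p $ j $ m
      + christoffel G k l m (fst p) * snd p $ i $ l * snd h $ j $ m))"

text \<open>The Euclidean base point moves along \<open>e $ k\<close> at the same time. The index
  types \<open>2\<close> and \<open>3\<close> differ, hence two indices; the pairs
  \<open>1 1\<close> and \<open>2 2\<close> are the ones on which all thetas vanish.\<close>

definition horizontal_field :: "2 \<Rightarrow> 3 \<Rightarrow> frames \<Rightarrow> frames" where
  "horizontal_field i k z = (horizontal i (fst z), (snd (snd z) $ k, 0))"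

definition horizontal_field' :: "2 \<Rightarrow> 3 \<Rightarrow> frames \<Rightarrow> frames \<Rightarrow> frames" where
  "horizontal_field' i k z h = (horizontal' i (fst z) (fst h), (snd (snd h) $ k, 0))"

definition spin_field :: "frames \<Rightarrow> frames" where
  "spin_field z = ((0, vector [- (snd (fst z) $ 2), snd (fst z) $ 1]), (0, rotate_rows 2 1 (snd (snd z))))"

lemma has_derivative_horizontal:
  assumes "fst p \<in> S"
  shows "(horizontal i has_derivative horizontal' i p) (at p)"
proof -
  note nth = bounded_linear.has_derivative[OF bounded_linear_vec_nth]
  have n: "((\<lambda>q::(real^2) \<times> (real^2^2). snd q $ a $ b) has_derivative (\<lambda>h. snd h $ a $ b)) (at p)" for a b
    by (intro nth has_derivative_snd has_derivative_ident)
  have c: "((\<lambda>q. christoffel G k l m (fst q)) has_derivative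
     (\<lambda>h. pd 1 (christoffel G k l m) (fst p) * fst h $ 1 + pd 2 (christoffel G k l m) (fst p) * fst h $ 2)) (at p)"
    for k l m
    using has_derivative_compose[OF has_derivative_fst[OF has_derivative_ident] smooth_has_derivative_pd[OF smooth_christoffel assms]] .
  have "((\<lambda>q. \<chi> j k. - (\<Sum>l\<in>UNIV. \<Sum>m\<in>UNIV. christoffel G k l m (fst q) * snd q $ i $ l * snd q $ j $ m))
    has_derivative (\<lambda>h. \<chi> j k. - (\<Sum>l\<in>UNIV. \<Sum>m\<in>UNIV.
      (pd 1 (christoffel G k l m) (fst p) * fst h $ 1 + pd 2 (christoffel G k l m) (fst p) * fst h $ 2) * snd p $ i $ l * snd p $ j $ m
      + christoffel G k l m (fst p) * snd h $ i $ l * snd p $ j $ m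
      + christoffel G k l m (fst p) * snd p $ i $ l * snd h $ j $ m))) (at p)"
    by (intro has_derivative_vec) (auto intro!: derivative_eq_intros n c simp: algebra_simps)
  then show ?thesis
    unfolding horizontal_def[abs_def] horizontal'_def[abs_def]
    by (intro has_derivative_Pair nth has_derivative_snd has_derivative_ident)
qed

lemma has_derivative_horizontal_field:
  assumes "fst (fst z) \<in> S"
  shows "(horizontal_field i k has_derivative horizontal_field' i k z) (at z)"
proof -
  have "((\<lambda>y::frames. horizontal i (fst y)) has_derivative (\<lambda>h. horizontal' i (fst z) (fst h))) (at z)"
    using has_derivative_compose[OF has_derivative_fst[OF has_derivative_ident] has_derivative_horizontal[OF assms]] .
  then show ?thesis
    unfolding horizontal_field_def[abs_def] horizontal_field'_def[abs_def]
    by (intro has_derivative_Pair has_derivative_const has_derivative_snd has_derivative_ident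
        bounded_linear.has_derivative[OF bounded_linear_vec_nth])
qed

lemma ip_line_derivative:
  assumes x: "x \<in> S"
  shows "((\<lambda>t. ip (G (x + t *\<^sub>R dx)) (u + t *\<^sub>R du) (w + t *\<^sub>R dw)) has_real_derivative
    (\<Sum>a\<in>UNIV. \<Sum>b\<in>UNIV. (pd 1 (\<lambda>y. G y $ a $ b) x * dx $ 1 + pd 2 (\<lambda>y. G y $ a $ b) x * dx $ 2) * u $ a * w $ b
      + G x $ a $ b * du $ a * w $ b + G x $ a $ b * u $ a * dw $ b)) (at 0)"
proof -
  have l: "((\<lambda>t. x + t *\<^sub>R dx) has_derivative (\<lambda>d. d *\<^sub>R dx)) (at 0)"
    by (auto intro!: derivative_eq_intros)
  have g: "((\<lambda>t. G (x + t *\<^sub>R dx) $ a $ b) has_real_derivative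
     (pd 1 (\<lambda>y. G y $ a $ b) x * dx $ 1 + pd 2 (\<lambda>y. G y $ a $ b) x * dx $ 2)) (at 0)" for a b
    using has_real_derivative_line[OF l, of "\<lambda>y. G y $ a $ b"] smooth_has_derivative_pd[OF smooth_G_nth x, of a b]
    by fastforce
  have n: "((\<lambda>t. (u + t *\<^sub>R du) $ a) has_real_derivative du $ a) (at 0)" for u du :: "real^2" and a
    by (auto intro!: derivative_eq_intros)
  have ip: "ip M p q = (\<Sum>a\<in>UNIV. \<Sum>b\<in>UNIV. M $ a $ b * p $ a * q $ b)" for M p q
    by (simp add: ip_2 sum_2)
  show ?thesis unfolding ip
  proof (intro DERIV_sum)
    fix a b
    show "((\<lambda>t. G (x + t *\<^sub>R dx) $ a $ b * (u + t *\<^sub>R du) $ a * (w + t *\<^sub>R dw) $ b) has_real_derivative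
      (pd 1 (\<lambda>y. G y $ a $ b) x * dx $ 1 + pd 2 (\<lambda>y. G y $ a $ b) x * dx $ 2) * u $ a * w $ b
      + G x $ a $ b * du $ a * w $ b + G x $ a $ b * u $ a * dw $ b) (at 0)"
      using DERIV_mult[OF DERIV_mult[OF g[of a b] n[of u du a]] n[of w dw b]] by (simp add: algebra_simps)
  qed
qed

text \<open>Parallel transport preserves scalar products: metric compatibility makes their
  first-order change zero, so \<open>frames_on_curve\<close> applies.\<close>

lemma horizontal_curve:
  assumes "p \<in> frames_on"
  shows "\<exists>\<gamma>. \<gamma> 0 = p \<and> (\<forall>t::real. \<gamma> t \<in> frames_on) \<and> (\<gamma> has_vector_derivative horizontal i p) (at 0)"
proof -
  obtain x v where p: "p = (x, v)" by force
  have x: "x \<in> S" using assms by (auto simp: p frames_on_def)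
  define dv where "dv = snd (horizontal i p)"
  have h: "horizontal i p = (v $ i, dv)" by (simp add: dv_def horizontal_def p)
  have "(\<Sum>a\<in>UNIV. \<Sum>b\<in>UNIV. (pd 1 (\<lambda>y. G y $ a $ b) x * v $ i $ 1 + pd 2 (\<lambda>y. G y $ a $ b) x * v $ i $ 2) * v $ r $ a * v $ s $ b
      + G x $ a $ b * dv $ r $ a * v $ s $ b + G x $ a $ b * v $ r $ a * dv $ s $ b) = 0" for r s
    by (simp add: sum_2 metric_compatible[OF x] dv_def p horizontal_def algebra_simps)
  then have "((\<lambda>t. ip (G (x + t *\<^sub>R v $ i)) (v$r + t *\<^sub>R dv$r) (v$s + t *\<^sub>R dv$s)) has_real_derivative 0) (at 0)" for r s
    using ip_line_derivative[OF x, of "v $ i" "v $ r" "dv $ r" "v $ s" "dv $ s"] by (simp only:)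
  from frames_on_curve[OF assms[unfolded p] this] show ?thesis unfolding h unfolding p .
qed

lemma spin_curve:
  assumes "(x, v) \<in> frames_on"
  shows "\<exists>\<gamma>. \<gamma> 0 = (x, v) \<and> (\<forall>t::real. \<gamma> t \<in> frames_on) \<and>
    (\<gamma> has_vector_derivative (0, vector [- (v $ 2), v $ 1])) (at 0)"
proof -
  have x: "x \<in> S" and on: "\<And>i j. ip (G x) (v $ i) (v $ j) = (if i = j then 1 else 0)"
    using assms by (auto simp: frames_on_def)
  define dv :: "real^2^2" where "dv = vector [- (v $ 2), v $ 1]"
  have "(\<Sum>a\<in>UNIV. \<Sum>b\<in>UNIV. (pd 1 (\<lambda>y. G y $ a $ b) x * (0::real^2) $ 1 + pd 2 (\<lambda>y. G y $ a $ b) x * (0::real^2) $ 2) * v $ r $ a * v $ s $ b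
      + G x $ a $ b * dv $ r $ a * v $ s $ b + G x $ a $ b * v $ r $ a * dv $ s $ b) =
      ip (G x) (dv $ r) (v $ s) + ip (G x) (v $ r) (dv $ s)" for r s
    by (simp add: sum_2 ip_2)
  also have "ip (G x) (dv $ r) (v $ s) + ip (G x) (v $ r) (dv $ s) = 0" for r s
  proof -
    have "ip (G x) (- u) w = - ip (G x) u w" "ip (G x) u (- w) = - ip (G x) u w" for u w
      by (simp_all add: ip_2)
    then show ?thesis using exhaust_2[of r] exhaust_2[of s] on by (auto simp: dv_def)
  qed
  finally have "((\<lambda>t. ip (G (x + t *\<^sub>R 0)) (v$r + t *\<^sub>R dv$r) (v$s + t *\<^sub>R dv$s)) has_real_derivative 0) (at 0)" for r s
    using ip_line_derivative[OF x, of 0 "v $ r" "dv $ r" "v $ s" "dv $ s"] by (simp only:)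
  from frames_on_curve[OF assms this] show ?thesis unfolding dv_def .
qed

lemma frame_bundle_cases:
  assumes "z \<in> frame_bundle"
  obtains x v \<rho> e where "z = ((x, v), (\<rho>, e))" "(x, v) \<in> frames_on" "(\<rho>, e) \<in> orthonormal_frames" "x \<in> S"
  using assms by (auto simp: frame_bundle_def frames_on_def)

lemma tangent_trans_field: "z \<in> frame_bundle \<Longrightarrow> trans_field i z \<in> tangent_space frame_bundle z"
proof (erule frame_bundle_cases)
  fix x v \<rho> e assume z: "z = ((x, v), (\<rho>, e))" "(x, v) \<in> frames_on" "(\<rho>, e) \<in> orthonormal_frames"
  obtain \<gamma> where "\<gamma> 0 = (\<rho>, e)" "\<forall>t::real. \<gamma> t \<in> orthonormal_frames" "(\<gamma> has_vector_derivative (e $ i, 0)) (at 0)"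
    using orthonormal_frames_translate[OF z(3)] by blast
  then show "trans_field i z \<in> tangent_space frame_bundle z"
    unfolding frame_bundle_def trans_field_def z(1) snd_conv
    using z(2) by (intro tangent_space_Times[of "\<lambda>t. (x, v)"]) auto
qed

lemma tangent_rot_field: "z \<in> frame_bundle \<Longrightarrow> i \<noteq> j \<Longrightarrow> rot_field i j z \<in> tangent_space frame_bundle z"
proof (erule frame_bundle_cases)
  fix x v \<rho> e assume z: "z = ((x, v), (\<rho>, e))" "(x, v) \<in> frames_on" "(\<rho>, e) \<in> orthonormal_frames" and "i \<noteq> j"
  then obtain \<gamma> where "\<gamma> 0 = (\<rho>, e)" "\<forall>t::real. \<gamma> t \<in> orthonormal_frames" "(\<gamma> has_vector_derivative (0, rotate_rows i j e)) (at 0)"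
    using orthonormal_frames_rotate[OF z(3)] by blast
  then show "rot_field i j z \<in> tangent_space frame_bundle z"
    unfolding frame_bundle_def rot_field_def z(1) snd_conv
    using z(2) by (intro tangent_space_Times[of "\<lambda>t. (x, v)"]) auto
qed

lemma tangent_horizontal_field: "z \<in> frame_bundle \<Longrightarrow> horizontal_field i k z \<in> tangent_space frame_bundle z"
proof (erule frame_bundle_cases)
  fix x v \<rho> e assume z: "z = ((x, v), (\<rho>, e))" "(x, v) \<in> frames_on" "(\<rho>, e) \<in> orthonormal_frames"
  obtain \<gamma> where "\<gamma> 0 = (\<rho>, e)" "\<forall>t::real. \<gamma> t \<in> orthonormal_frames" "(\<gamma> has_vector_derivative (e $ k, 0)) (at 0)"
    using orthonormal_frames_translate[OF z(3)] by blast
  moreover obtain \<delta> where "\<delta> 0 = (x, v)" "\<forall>t::real. \<delta> t \<in> frames_on" "(\<delta> has_vector_derivative horizontal i (x, v)) (at 0)"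
    using horizontal_curve[OF z(2)] by blast
  ultimately show "horizontal_field i k z \<in> tangent_space frame_bundle z"
    unfolding frame_bundle_def horizontal_field_def z(1) snd_conv fst_conv
    by (intro tangent_space_Times) auto
qed

lemma tangent_spin_field: "z \<in> frame_bundle \<Longrightarrow> spin_field z \<in> tangent_space frame_bundle z"
proof (erule frame_bundle_cases)
  fix x v \<rho> e assume z: "z = ((x, v), (\<rho>, e))" "(x, v) \<in> frames_on" "(\<rho>, e) \<in> orthonormal_frames"
  have "2 \<noteq> (1::3)" by simp
  then obtain \<gamma> where "\<gamma> 0 = (\<rho>, e)" "\<forall>t::real. \<gamma> t \<in> orthonormal_frames" "(\<gamma> has_vector_derivative (0, rotate_rows 2 1 e)) (at 0)"
    using orthonormal_frames_rotate[OF z(3)] by metis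
  moreover obtain \<delta> where "\<delta> 0 = (x, v)" "\<forall>t::real. \<delta> t \<in> frames_on" "(\<delta> has_vector_derivative (0, vector [- (v $ 2), v $ 1])) (at 0)"
    using spin_curve[OF z(2)] by blast
  ultimately show "spin_field z \<in> tangent_space frame_bundle z"
    unfolding frame_bundle_def spin_field_def z(1) snd_conv fst_conv
    by (intro tangent_space_Times) auto
qed

lemma linear_horizontal': "horizontal' i p 0 = 0"
  by (simp add: horizontal'_def zero_prod_def vec_eq_iff)

text \<open>The structure equation for the connection form, in dual form: the lifts bracket to
  \<open>- K\<close> times the rotation of the surface frame. Since \<open>spin_field\<close>
  rotates both frames, \<open>rot_field 2 1\<close> removes the Euclidean rotation again.\<close>

lemma bracket_horizontal:
  assumes "z \<in> frame_bundle"
  shows "horizontal_field' 2 2 z (horizontal_field 1 1 z) - horizontal_field' 1 1 z (horizontal_field 2 2 z)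
    = gauss_formula G (fst (fst z)) *\<^sub>R rot_field 2 1 z - gauss_formula G (fst (fst z)) *\<^sub>R spin_field z"
proof (rule frame_bundle_cases[OF assms])
  fix x v \<rho> e assume z: "z = ((x, v), (\<rho>, e))" "(x, v) \<in> frames_on" "x \<in> S"
  have 1: "snd (horizontal' 2 (x, v) (horizontal 1 (x, v)) - horizontal' 1 (x, v) (horizontal 2 (x, v))) $ j $ k =
    - (det v * (\<Sum>m\<in>UNIV. riemann_curvature G k m 1 2 x * v$j$m))" for j k
    unfolding horizontal'_def horizontal_def riemann_curvature_def
    by (simp add: sum_2 det_2 christoffel_sym[OF z(3), of _ 2 1] algebra_simps)
  \<comment> \<open>No component along the base: the Levi-Civita connection is torsion free.\<close>
  have 2: "fst (horizontal' 2 (x, v) (horizontal 1 (x, v)) - horizontal' 1 (x, v) (horizontal 2 (x, v))) = 0"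
    by (simp add: horizontal'_def horizontal_def sum_2 vec_eq_iff forall_2 christoffel_sym[OF z(3), of _ 2 1] algebra_simps)
  have 3: "horizontal' 2 (x, v) (horizontal 1 (x, v)) - horizontal' 1 (x, v) (horizontal 2 (x, v)) =
     - gauss_formula G x *\<^sub>R (0, vector [- (v $ 2), v $ 1])"
  proof (rule prod_eqI)
    show "snd (horizontal' 2 (x, v) (horizontal 1 (x, v)) - horizontal' 1 (x, v) (horizontal 2 (x, v))) =
      snd (- gauss_formula G x *\<^sub>R (0, vector [- (v $ 2), v $ 1] :: real^2^2))"
      by (simp only: vec_eq_iff 1 forall_2) (simp add: curvature_frame[OF z(2)])
  qed (use 2 in simp)
  show ?thesis
    unfolding horizontal_field_def horizontal_field'_def z(1) rot_field_def spin_field_def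
    using 3 by (simp add: zero_prod_def)
qed

end

subsection \<open>Consequences of the Frobenius condition\<close>

text \<open>Derivation along the vector \<open>w\<^sub>1 + s w\<^sub>2\<close> with a possibly complex scalar \<open>s\<close>.\<close>

definition der :: "frames \<Rightarrow> 'k \<Rightarrow> frames \<Rightarrow> (frames \<Rightarrow> 'k::real_normed_field) \<Rightarrow> frames \<Rightarrow> 'k \<Rightarrow> bool" where
  "der w\<^sub>1 s w\<^sub>2 f z d \<longleftrightarrow> (\<exists>f'. (f has_derivative f') (at z) \<and> d = f' w\<^sub>1 + s * f' w\<^sub>2)"

lemma der_add: "der p s q f z d \<Longrightarrow> der p s q g z e \<Longrightarrow> der p s q (\<lambda>y. f y + g y) z (d + e)"
  unfolding der_def
  by (elim exE conjE, intro exI conjI, rule has_derivative_add, assumption+, simp add: algebra_simps)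

lemma der_diff: "der p s q f z d \<Longrightarrow> der p s q g z e \<Longrightarrow> der p s q (\<lambda>y. f y - g y) z (d - e)"
  unfolding der_def
  by (elim exE conjE, intro exI conjI, rule has_derivative_diff, assumption+, simp add: algebra_simps)

lemma der_mult: "der p s q f z d \<Longrightarrow> der p s q g z e \<Longrightarrow> der p s q (\<lambda>y. f y * g y) z (f z * e + d * g z)"
  unfolding der_def
  by (elim exE conjE, intro exI conjI, rule has_derivative_mult, assumption+, simp add: algebra_simps)

lemma der_eq: "der p s q f z d \<Longrightarrow> d = e \<Longrightarrow> der p s q f z e"
  by simp

lemma der_unique:
  assumes "open U" "z \<in> N" "z \<in> U" "p \<in> tangent_space N z" "q \<in> tangent_space N z"
    and "der p s q f z d" "der p s q g z e" "\<And>y. y \<in> N \<Longrightarrow> y \<in> U \<Longrightarrow> f y = g y"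
  shows "d = e"
proof -
  obtain f' g' where D: "(f has_derivative f') (at z)" "(g has_derivative g') (at z)"
    "d = f' p + s * f' q" "e = g' p + s * g' q"
    using assms(6,7) unfolding der_def by blast
  show ?thesis
    using tangent_derivative_unique[OF assms(1-4) D(1,2) assms(8)]
      tangent_derivative_unique[OF assms(1-3,5) D(1,2) assms(8)] D(3,4) by simp
qed

text \<open>The last step is purely algebraic: \<open>a\<close>, \<open>b\<close>, \<open>c\<close> are the components of the symmetric tensor
  \<open>(\<nabla>\<^sup>2 l - dl \<otimes> dl + k\<^sup>2 g) / 2k\<close>, and the equations say that it is \<open>k g + dl \<otimes> dl / k\<close>.\<close>

lemma algebraic_conclusion:
  fixes k u w p r a b c :: "'k::field_char_0"
  assumes k: "k \<noteq> 0" and r1: "a * r - b * p = w" and r2: "c * p - b * r = u"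
    and f11: "(2*k*u + 2*b*w + 2*k*r*b) * p + c * a - (2*k*b*p + u*b + w*a) * r - b * (b - r*u + p*w) = u\<^sup>2 - k\<^sup>2 + 2*k*a"
    and f12: "(2*c*w + 2*k*c*r) * p + c * (b - p*w + r*u) - (b*w + c*u + 2*k*r*b) * r - b * c = u*w + 2*k*b"
    and f21: "2*a*(u + k*p) * r + a * (b - r*u + p*w) - (2*k*b*p + u*b + w*a) * p - b * a = u*w + 2*k*b"
    and f22: "(2*k*w + 2*b*u + 2*k*p*b) * r + a * c - (b*w + c*u + 2*k*r*b) * p - b * (b - p*w + r*u) = w\<^sup>2 - k\<^sup>2 + 2*k*c"
  shows "k * a = k\<^sup>2 + u\<^sup>2" "k * b = u * w" "k * c = k\<^sup>2 + w\<^sup>2"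
proof -
  have "2 * k * b = 2 * k * (r * u)" using f12 r2 by algebra
  then have b1: "b = r * u" using k by simp
  have "2 * k * b = 2 * k * (p * w)" using f21 r1 by algebra
  then have b2: "b = p * w" using k by simp
  \<comment> \<open>With \<open>b = r * u = p * w\<close> the tensor is \<open>m\<close> times the
    metric plus \<open>(u, w) \<otimes> (p, r)\<close>, and the relations \<open>r1\<close>,
    \<open>r2\<close> become \<open>(u, w) = m (p, r)\<close>.\<close>
  define m where "m = a - u * p"
  have "2 * k * (a - u * p) = 2 * k * (c - w * r)" using f11 f22 r1 r2 b1 b2 by algebra
  then have m': "m = c - w * r" using k by (simp add: m_def)
  have "m * p = c * p - (p * w) * r" by (simp add: m' algebra_simps)
  then have mp: "m * p = u" using r2 b2 by simp
  have "m * r = a * r - (r * u) * p" by (simp add: m_def algebra_simps)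
  then have mr: "m * r = w" using r1 b1 by simp
  \<comment> \<open>Here \<open>f11\<close> reads \<open>a * m = u^2 - k^2 + 2 * k * m\<close>, and
    \<open>a * m = m^2 + u^2\<close>. The quadratic has a double root, so \<open>m\<close> is
    determined without a choice of sign.\<close>
  have "(m - k)\<^sup>2 = 0" using f11 b1 b2 mp mr m_def m' by algebra
  then have mk: "m = k" by simp
  have e: "a = k + u * p" "c = k + w * r" "k * p = u" "k * r = w"
    using mk mp mr m_def m' by (simp_all add: algebra_simps)
  have "k * a = k * k + u * (k * p)" "k * b = u * (k * r)" "k * c = k * k + w * (k * r)"
    by (simp_all add: e(1,2) b1 algebra_simps)
  then show "k * a = k\<^sup>2 + u\<^sup>2" "k * b = u * w" "k * c = k\<^sup>2 + w\<^sup>2"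
    by (simp_all only: e(3,4) power2_eq_square)
qed

text \<open>The frame of the Frobenius subbundle, normalised to be dual to
  \<open>rot_field 1 3\<close> and \<open>rot_field 2 3\<close>. The normalisation divides by a
  determinant known to be nonzero only on the bundle; therefore differentiability is required only
  at points of the bundle, and linearity on all of \<open>U\<close>.\<close>

locale frobenius_pair = riemannian_chart +
  fixes \<kappa> :: "real^2 \<Rightarrow> 'k::real_normed_field" and l :: "real^2 \<Rightarrow> real"
    and U :: "frames set" and \<alpha> :: "2 \<Rightarrow> (frames, 'k) one_form"
  assumes smooth_l: "smooth_on S l"
    and kappa_nonzero: "\<And>x. x \<in> S \<Longrightarrow> \<kappa> x \<noteq> 0"
    and kappa_square: "\<And>x. x \<in> S \<Longrightarrow> \<kappa> x * \<kappa> x = - of_real (gauss_formula G x)"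
    and kappa_derivative: "\<And>x. x \<in> S \<Longrightarrow>
      (\<kappa> has_derivative (\<lambda>h. 2 * \<kappa> x * of_real (pd 1 l x * h $ 1 + pd 2 l x * h $ 2))) (at x)"
    and open_U: "open U"
    and linear_alpha: "\<And>i y. y \<in> U \<Longrightarrow> linear (\<alpha> i y)"
    and diff_alpha: "\<And>i z w. z \<in> frame_bundle \<Longrightarrow> z \<in> U \<Longrightarrow> (\<lambda>y. \<alpha> i y w) differentiable (at z)"
    and alpha_P1: "\<And>i z. z \<in> frame_bundle \<Longrightarrow> z \<in> U \<Longrightarrow> \<alpha> i z (rot_field 1 3 z) = (if i = 1 then 1 else 0)"
    and alpha_P2: "\<And>i z. z \<in> frame_bundle \<Longrightarrow> z \<in> U \<Longrightarrow> \<alpha> i z (rot_field 2 3 z) = (if i = 2 then 1 else 0)"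
    and alpha_H1: "\<And>i z. z \<in> frame_bundle \<Longrightarrow> z \<in> U \<Longrightarrow>
      \<alpha> i z (horizontal_field 1 1 z) = (if i = 2 then 1 else 0) * \<kappa> (fst (fst z))"
    and alpha_H2: "\<And>i z. z \<in> frame_bundle \<Longrightarrow> z \<in> U \<Longrightarrow>
      \<alpha> i z (horizontal_field 2 2 z) = (if i = 1 then - 1 else 0) * \<kappa> (fst (fst z))"
    and alpha_spin: "\<And>i z. z \<in> frame_bundle \<Longrightarrow> z \<in> U \<Longrightarrow> \<alpha> i z (spin_field z) = 0"
    and frobenius: "\<And>i z. z \<in> frame_bundle \<Longrightarrow> z \<in> U \<Longrightarrow>
      \<exists>g h. \<forall>v\<in>tangent_space frame_bundle z. \<forall>w\<in>tangent_space frame_bundle z.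
        ext_deriv (\<alpha> i) z v w = (g v * \<alpha> 1 z w - g w * \<alpha> 1 z v) + (h v * \<alpha> 2 z w - h w * \<alpha> 2 z v)"
begin

definition dl :: "2 \<Rightarrow> frames \<Rightarrow> real" where
  "dl i z = pd 1 l (fst (fst z)) * snd (fst z) $ i $ 1 + pd 2 l (fst (fst z)) * snd (fst z) $ i $ 2"

definition hess :: "2 \<Rightarrow> 2 \<Rightarrow> frames \<Rightarrow> real" where
  "hess i j z = (\<Sum>a\<in>UNIV. \<Sum>b\<in>UNIV. (pd a (pd b l) (fst (fst z)) -
      (\<Sum>m\<in>UNIV. christoffel G m a b (fst (fst z)) * pd m l (fst (fst z)))) * snd (fst z) $ i $ a * snd (fst z) $ j $ b)"

abbreviation "kp z \<equiv> \<kappa> (fst (fst z))"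
text \<open>On the frame bundle, \<open>\<alpha> i\<close> is the generator \<open>\<omega>\<^sup>3\<^sub>1 - \<kappa> \<eta>\<^sup>2\<close>, respectively \<open>\<omega>\<^sup>3\<^sub>2 + \<kappa> \<eta>\<^sup>1\<close>, plus
  \<open>c0 i \<theta>\<^sub>0 + c1 i \<theta>\<^sub>1 + c2 i \<theta>\<^sub>2 + c3 i \<theta>\<^sub>3\<close>.\<close>

abbreviation "c0 i z \<equiv> \<alpha> i z (trans_field 3 z)"
abbreviation "c1 i z \<equiv> \<alpha> i z (trans_field 1 z)"
abbreviation "c2 i z \<equiv> \<alpha> i z (trans_field 2 z)"
abbreviation "c3 i z \<equiv> \<alpha> i z (rot_field 2 1 z)"

lemma in_S: "z \<in> frame_bundle \<Longrightarrow> fst (fst z) \<in> S"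
  by (auto simp: frame_bundle_def frames_on_def)

lemma has_derivative_kp:
  assumes "z \<in> frame_bundle"
  shows "((\<lambda>y::frames. kp y) has_derivative
    (\<lambda>h. 2 * kp z * of_real (pd 1 l (fst (fst z)) * fst (fst h) $ 1 + pd 2 l (fst (fst z)) * fst (fst h) $ 2))) (at z)"
  using has_derivative_compose[OF has_derivative_fst[OF has_derivative_fst[OF has_derivative_ident]]
      kappa_derivative[OF in_S[OF assms]]] .

lemma field_derivative_exists:
  assumes "z \<in> frame_bundle" "z \<in> U" "(Y has_derivative Y') (at z)"
  shows "\<exists>D. ((\<lambda>y. \<alpha> i y (Y y)) has_derivative D) (at z)"
  by (intro exI, rule form_field_has_derivative[OF open_U assms(2) _ _ assms(3)])
    (auto intro: linear_alpha diff_alpha assms)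

text \<open>The ingredients \<open>Y'(X)\<close> of the brackets
  \<open>[X, Y] = Y'(X) - X'(Y)\<close>. They are the relations of the Lie algebra of Euclidean
  motions: rotations turn translations into one another and close up among themselves.\<close>

lemma brackets:
  "rot_field i j (horizontal_field a k z) = 0"
  "trans_field i (horizontal_field a k z) = 0"
  "rot_field i j (trans_field k z) = 0"
  "horizontal_field' a k z (trans_field i z) = 0"
  "horizontal_field' a 1 z (rot_field 1 3 z) = trans_field 3 z"
  "horizontal_field' a 1 z (rot_field 2 3 z) = 0"
  "horizontal_field' a 1 z (rot_field 2 1 z) = - trans_field 2 z"
  "horizontal_field' a 2 z (rot_field 1 3 z) = 0"
  "horizontal_field' a 2 z (rot_field 2 3 z) = trans_field 3 z"
  "horizontal_field' a 2 z (rot_field 2 1 z) = trans_field 1 z"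
  "trans_field 3 (rot_field 1 3 z) = - trans_field 1 z"
  "trans_field 3 (rot_field 2 3 z) = - trans_field 2 z"
  "trans_field 1 (rot_field 1 3 z) = trans_field 3 z"
  "trans_field 1 (rot_field 2 3 z) = 0"
  "trans_field 2 (rot_field 1 3 z) = 0"
  "trans_field 2 (rot_field 2 3 z) = trans_field 3 z"
  "rot_field 2 3 (rot_field 1 3 z) - rot_field 1 3 (rot_field 2 3 z) = - rot_field 2 1 z"
  "rot_field 2 1 (rot_field 1 3 z) - rot_field 1 3 (rot_field 2 1 z) = rot_field 2 3 z"
  "rot_field 2 1 (rot_field 2 3 z) - rot_field 2 3 (rot_field 2 1 z) = - rot_field 1 3 z"
  by (simp_all add: rot_field_def horizontal_field_def trans_field_def rotate_rows_def zero_prod_def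
      horizontal_field'_def linear_horizontal'[unfolded zero_prod_def] vec_eq_iff forall_3)

text \<open>In the names of the following facts, \<open>H\<close>, \<open>P\<close>, \<open>T\<close>, \<open>R\<close> stand for the horizontal fields, for
  the rotations \<open>rot_field i 3\<close>, for the translations and for \<open>rot_field 2 1\<close>.\<close>

context
  fixes z :: frames
  assumes z: "z \<in> frame_bundle" "z \<in> U"
begin

lemma alpha_lin: "\<alpha> i z (v - w) = \<alpha> i z v - \<alpha> i z w" "\<alpha> i z (- v) = - \<alpha> i z v" "\<alpha> i z 0 = 0"
   "\<alpha> i z (t *\<^sub>R v) = of_real t * \<alpha> i z v"
  using linear_alpha[OF z(2), of i]
  by (simp_all add: linear_diff linear_neg linear_0 linear_cmul scaleR_conv_of_real)

lemma ext_fields: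
  assumes X: "(X has_derivative X') (at z)" "X z \<in> tangent_space frame_bundle z"
      "(f has_derivative f') (at z)" "\<forall>y\<in>frame_bundle \<inter> U. \<alpha> i y (X y) = f y"
    and Y: "(Y has_derivative Y') (at z)" "Y z \<in> tangent_space frame_bundle z"
      "(g has_derivative g') (at z)" "\<forall>y\<in>frame_bundle \<inter> U. \<alpha> i y (Y y) = g y"
  shows "ext_deriv (\<alpha> i) z (X z) (Y z) = g' (X z) - f' (Y z) - \<alpha> i z (Y' (X z) - X' (Y z))"
  by (rule ext_deriv_fields[OF open_U z _ _ X(1-3) _ Y(1-3)])
    (use X(4) Y(4) in \<open>auto intro: linear_alpha diff_alpha z\<close>)

lemma tangent_fields:
  "rot_field 1 3 z \<in> tangent_space frame_bundle z" "rot_field 2 3 z \<in> tangent_space frame_bundle z"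
  "rot_field 2 1 z \<in> tangent_space frame_bundle z" "trans_field i z \<in> tangent_space frame_bundle z"
  "horizontal_field a k z \<in> tangent_space frame_bundle z"
  by (auto intro!: tangent_rot_field tangent_trans_field tangent_horizontal_field z)

text \<open>The last, reflexive item lets \<open>ext_fields\<close> be applied to a field on which
  the value of the form is not prescribed.\<close>

lemma alpha_values:
  "\<forall>y\<in>frame_bundle \<inter> U. \<alpha> i y (horizontal_field 1 1 y) = (if i = 2 then 1 else 0) * kp y"
  "\<forall>y\<in>frame_bundle \<inter> U. \<alpha> i y (horizontal_field 2 2 y) = (if i = 1 then - 1 else 0) * kp y"
  "\<forall>y\<in>frame_bundle \<inter> U. \<alpha> i y (rot_field 1 3 y) = (if i = 1 then 1 else 0)"
  "\<forall>y\<in>frame_bundle \<inter> U. \<alpha> i y (rot_field 2 3 y) = (if i = 2 then 1 else 0)"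
  "\<forall>y\<in>frame_bundle \<inter> U. \<alpha> i y (Y y) = \<alpha> i y (Y y)"
  using alpha_H1 alpha_H2 alpha_P1 alpha_P2 by blast+

lemmas kp_mult = has_derivative_mult_right[OF has_derivative_kp[OF z(1)]]
lemmas fields_H1 = has_derivative_horizontal_field[OF in_S[OF z(1)], of 1 1] tangent_fields(5) kp_mult alpha_values(1)
lemmas fields_H2 = has_derivative_horizontal_field[OF in_S[OF z(1)], of 2 2] tangent_fields(5) kp_mult alpha_values(2)
lemmas fields_P1 = has_derivative_rot_field[of 1 3] tangent_fields(1) has_derivative_const alpha_values(3)
lemmas fields_P2 = has_derivative_rot_field[of 2 3] tangent_fields(2) has_derivative_const alpha_values(4)

lemma fst_fields: "fst (rot_field i j z) = 0" "fst (trans_field k z) = 0"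
  "fst (fst (horizontal_field a m z)) = snd (fst z) $ a"
  by (simp_all add: rot_field_def trans_field_def horizontal_field_def horizontal_def)

text \<open>The bracket contributes \<open>- K\<close> times \<open>c3\<close>, rewritten by
  \<open>\<kappa> * \<kappa> = - K\<close>; the terms with \<open>dl\<close> come from
  differentiating \<open>\<kappa>\<close>.\<close>

lemma ext_H1_H2: "ext_deriv (\<alpha> i) z (horizontal_field 1 1 z) (horizontal_field 2 2 z) =
    - 2 * kp z * ((if i = 1 then of_real (dl 1 z) else 0) + (if i = 2 then of_real (dl 2 z) else 0)) + kp z * kp z * c3 i z"
  unfolding ext_fields[OF fields_H1 fields_H2] bracket_horizontal[OF z(1)] alpha_lin alpha_spin[OF z]
    kappa_square[OF in_S[OF z(1)]] dl_def fst_fields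
  by (simp add: algebra_simps)

lemma ext_H_P:
  "ext_deriv (\<alpha> i) z (horizontal_field 1 1 z) (rot_field 1 3 z) = c0 i z"
  "ext_deriv (\<alpha> i) z (horizontal_field 1 1 z) (rot_field 2 3 z) = 0"
  "ext_deriv (\<alpha> i) z (horizontal_field 2 2 z) (rot_field 1 3 z) = 0"
  "ext_deriv (\<alpha> i) z (horizontal_field 2 2 z) (rot_field 2 3 z) = c0 i z"
  unfolding ext_fields[OF fields_H1 fields_P1] ext_fields[OF fields_H2 fields_P1]
    ext_fields[OF fields_H1 fields_P2] ext_fields[OF fields_H2 fields_P2]
  by (simp_all add: brackets alpha_lin fst_fields)

lemma ext_P1_P2: "ext_deriv (\<alpha> i) z (rot_field 1 3 z) (rot_field 2 3 z) = c3 i z"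
  unfolding ext_fields[OF fields_P1 fields_P2] brackets alpha_lin by simp

lemma ext_H_T:
  assumes D: "((\<lambda>y. \<alpha> i y (trans_field m y)) has_derivative D) (at z)"
  shows "ext_deriv (\<alpha> i) z (horizontal_field 1 1 z) (trans_field m z) = D (horizontal_field 1 1 z)"
   "ext_deriv (\<alpha> i) z (horizontal_field 2 2 z) (trans_field m z) = D (horizontal_field 2 2 z)"
  unfolding ext_fields[OF fields_H1 has_derivative_trans_field tangent_fields(4) D alpha_values(5)]
    ext_fields[OF fields_H2 has_derivative_trans_field tangent_fields(4) D alpha_values(5)]
  by (simp_all add: brackets alpha_lin fst_fields)

lemma ext_H_R:
  assumes D: "((\<lambda>y. \<alpha> i y (rot_field 2 1 y)) has_derivative D) (at z)"
  shows "ext_deriv (\<alpha> i) z (horizontal_field 1 1 z) (rot_field 2 1 z) = D (horizontal_field 1 1 z) - c2 i z"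
   "ext_deriv (\<alpha> i) z (horizontal_field 2 2 z) (rot_field 2 1 z) = D (horizontal_field 2 2 z) + c1 i z"
  unfolding ext_fields[OF fields_H1 has_derivative_rot_field tangent_fields(3) D alpha_values(5)]
    ext_fields[OF fields_H2 has_derivative_rot_field tangent_fields(3) D alpha_values(5)]
  by (simp_all add: brackets alpha_lin fst_fields)

lemma ext_P_T:
  assumes D: "((\<lambda>y. \<alpha> i y (trans_field m y)) has_derivative D) (at z)"
  shows "ext_deriv (\<alpha> i) z (rot_field 1 3 z) (trans_field m z) = D (rot_field 1 3 z) - \<alpha> i z (trans_field m (rot_field 1 3 z))"
    "ext_deriv (\<alpha> i) z (rot_field 2 3 z) (trans_field m z) = D (rot_field 2 3 z) - \<alpha> i z (trans_field m (rot_field 2 3 z))"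
  unfolding ext_fields[OF fields_P1 has_derivative_trans_field tangent_fields(4) D alpha_values(5)]
    ext_fields[OF fields_P2 has_derivative_trans_field tangent_fields(4) D alpha_values(5)]
  by (simp_all add: brackets(3))

lemma ext_P_R:
  assumes D: "((\<lambda>y. \<alpha> i y (rot_field 2 1 y)) has_derivative D) (at z)"
  shows "ext_deriv (\<alpha> i) z (rot_field 1 3 z) (rot_field 2 1 z) = D (rot_field 1 3 z) - (if i = 2 then 1 else 0)"
    "ext_deriv (\<alpha> i) z (rot_field 2 3 z) (rot_field 2 1 z) = D (rot_field 2 3 z) + (if i = 1 then 1 else 0)"
  unfolding ext_fields[OF fields_P1 has_derivative_rot_field tangent_fields(3) D alpha_values(5)]
    ext_fields[OF fields_P2 has_derivative_rot_field tangent_fields(3) D alpha_values(5)] brackets alpha_lin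
    alpha_P1[OF z] alpha_P2[OF z] by simp_all

lemma ext_alt: "ext_deriv (\<alpha> i) z v w = - ext_deriv (\<alpha> i) z w v"
  by (simp add: ext_deriv_def)

abbreviation "D1 f d \<equiv> der (horizontal_field 1 1 z) (- kp z) (rot_field 2 3 z) f z d"
abbreviation "D2 f d \<equiv> der (horizontal_field 2 2 z) (kp z) (rot_field 1 3 z) f z d"

text \<open>Both forms annihilate \<open>H\<^sub>1 - \<kappa> P\<^sub>2\<close> and
  \<open>H\<^sub>2 + \<kappa> P\<^sub>1\<close>, so by the Frobenius condition their exterior
  derivatives vanish on this pair. Bilinear expansion avoids complex tangent vectors, and the common
  factor \<open>2 * \<kappa>\<close> cancels.\<close>

lemma dl_eq: "of_real (dl 1 z) = c0 1 z + kp z * c3 1 z" "of_real (dl 2 z) = c0 2 z + kp z * c3 2 z"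
proof -
  have *: "ext_deriv (\<alpha> i) z (horizontal_field 1 1 z) (horizontal_field 2 2 z)
    + kp z * ext_deriv (\<alpha> i) z (horizontal_field 1 1 z) (rot_field 1 3 z)
    - kp z * ext_deriv (\<alpha> i) z (rot_field 2 3 z) (horizontal_field 2 2 z)
    - kp z * kp z * ext_deriv (\<alpha> i) z (rot_field 2 3 z) (rot_field 1 3 z) = 0" for i
  proof -
    obtain g h where gh: "\<forall>v\<in>tangent_space frame_bundle z. \<forall>w\<in>tangent_space frame_bundle z.
        ext_deriv (\<alpha> i) z v w = (g v * \<alpha> 1 z w - g w * \<alpha> 1 z v) + (h v * \<alpha> 2 z w - h w * \<alpha> 2 z v)"
      using frobenius[OF z, of i] by blast
    show ?thesis
      by (simp add: gh[rule_format] tangent_fields alpha_H1[OF z] alpha_H2[OF z] alpha_P1[OF z] alpha_P2[OF z] algebra_simps)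
  qed
  have "2 * kp z * (c0 i z + kp z * c3 i z) =
     2 * kp z * ((if i = 1 then of_real (dl 1 z) else 0) + (if i = 2 then of_real (dl 2 z) else 0))" for i
    using *[of i] unfolding ext_H1_H2 ext_H_P ext_alt[of i "rot_field 2 3 z"] ext_P1_P2 by (simp add: algebra_simps)
  from this[of 1] this[of 2] show "of_real (dl 1 z) = c0 1 z + kp z * c3 1 z" "of_real (dl 2 z) = c0 2 z + kp z * c3 2 z"
    using kappa_nonzero[OF in_S[OF z(1)]] by simp_all
qed

text \<open>The Frobenius condition on the pairs of \<open>H\<^sub>1 - \<kappa> P\<^sub>2\<close>, respectively \<open>H\<^sub>2 + \<kappa> P\<^sub>1\<close>, and
  \<open>Y - \<alpha>\<^sub>1(Y) P\<^sub>1 - \<alpha>\<^sub>2(Y) P\<^sub>2\<close>, which are annihilated by the forms.\<close>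

lemma frobenius_X:
  assumes "Y \<in> tangent_space frame_bundle z"
  shows "ext_deriv (\<alpha> i) z (horizontal_field 1 1 z) Y - kp z * ext_deriv (\<alpha> i) z (rot_field 2 3 z) Y =
      \<alpha> 1 z Y * (c0 i z + kp z * c3 i z)" (is ?t1)
    and "ext_deriv (\<alpha> i) z (horizontal_field 2 2 z) Y + kp z * ext_deriv (\<alpha> i) z (rot_field 1 3 z) Y =
      \<alpha> 2 z Y * (c0 i z + kp z * c3 i z)" (is ?t2)
proof -
  obtain g h where gh: "\<forall>v\<in>tangent_space frame_bundle z. \<forall>w\<in>tangent_space frame_bundle z.
        ext_deriv (\<alpha> i) z v w = (g v * \<alpha> 1 z w - g w * \<alpha> 1 z v) + (h v * \<alpha> 2 z w - h w * \<alpha> 2 z v)"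
    using frobenius[OF z, of i] by blast
  note vals = tangent_fields alpha_H1[OF z] alpha_H2[OF z] alpha_P1[OF z] alpha_P2[OF z] assms
  let ?E = "ext_deriv (\<alpha> i) z"
  have "?E (horizontal_field 1 1 z) Y - kp z * ?E (rot_field 2 3 z) Y =
     \<alpha> 1 z Y * (?E (horizontal_field 1 1 z) (rot_field 1 3 z) - kp z * ?E (rot_field 2 3 z) (rot_field 1 3 z)) +
     \<alpha> 2 z Y * (?E (horizontal_field 1 1 z) (rot_field 2 3 z) - kp z * ?E (rot_field 2 3 z) (rot_field 2 3 z))"
    by (simp add: gh[rule_format] vals algebra_simps)
  moreover have "?E (horizontal_field 2 2 z) Y + kp z * ?E (rot_field 1 3 z) Y =
     \<alpha> 1 z Y * (?E (horizontal_field 2 2 z) (rot_field 1 3 z) + kp z * ?E (rot_field 1 3 z) (rot_field 1 3 z)) +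
     \<alpha> 2 z Y * (?E (horizontal_field 2 2 z) (rot_field 2 3 z) + kp z * ?E (rot_field 1 3 z) (rot_field 2 3 z))"
    by (simp add: gh[rule_format] vals algebra_simps)
  moreover have "?E v v = 0" for v by (simp add: ext_deriv_def)
  ultimately show ?t1 ?t2
    unfolding ext_H_P ext_P1_P2 ext_alt[of i "rot_field 2 3 z" "rot_field 1 3 z"] by simp_all
qed

text \<open>In \<open>frobenius_X\<close> with a translation for \<open>Y\<close>, the only unknown
  is the derivative of the coefficient. The extra terms with \<open>kp z\<close> are brackets of
  that translation with \<open>rot_field 2 3\<close> or \<open>rot_field 1 3\<close>.\<close>

lemma D_c012:
  "D1 (c0 i) (kp z * c2 i z + c0 1 z * (c0 i z + kp z * c3 i z))"
  "D1 (c1 i) (c1 1 z * (c0 i z + kp z * c3 i z))"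
  "D1 (c2 i) (- kp z * c0 i z + c2 1 z * (c0 i z + kp z * c3 i z))"
  "D2 (c0 i) (- kp z * c1 i z + c0 2 z * (c0 i z + kp z * c3 i z))"
  "D2 (c1 i) (kp z * c0 i z + c1 2 z * (c0 i z + kp z * c3 i z))"
  "D2 (c2 i) (c2 2 z * (c0 i z + kp z * c3 i z))"
proof -
  have *: "D1 (\<lambda>y. \<alpha> i y (trans_field m y))
       (- kp z * \<alpha> i z (trans_field m (rot_field 2 3 z)) + \<alpha> 1 z (trans_field m z) * (c0 i z + kp z * c3 i z))"
     "D2 (\<lambda>y. \<alpha> i y (trans_field m y))
       (kp z * \<alpha> i z (trans_field m (rot_field 1 3 z)) + \<alpha> 2 z (trans_field m z) * (c0 i z + kp z * c3 i z))" for m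
  proof -
    obtain D where D: "((\<lambda>y. \<alpha> i y (trans_field m y)) has_derivative D) (at z)"
      using field_derivative_exists[OF z has_derivative_trans_field] by blast
    show "D1 (\<lambda>y. \<alpha> i y (trans_field m y))
       (- kp z * \<alpha> i z (trans_field m (rot_field 2 3 z)) + \<alpha> 1 z (trans_field m z) * (c0 i z + kp z * c3 i z))"
      unfolding der_def using D frobenius_X(1)[OF tangent_fields(4), of i m]
      unfolding ext_H_T[OF D] ext_P_T[OF D] by (auto simp: algebra_simps)
    show "D2 (\<lambda>y. \<alpha> i y (trans_field m y))
       (kp z * \<alpha> i z (trans_field m (rot_field 1 3 z)) + \<alpha> 2 z (trans_field m z) * (c0 i z + kp z * c3 i z))"
      unfolding der_def using D frobenius_X(2)[OF tangent_fields(4), of i m]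
      unfolding ext_H_T[OF D] ext_P_T[OF D] by (auto simp: algebra_simps)
  qed
  show "D1 (c0 i) (kp z * c2 i z + c0 1 z * (c0 i z + kp z * c3 i z))"
    "D1 (c1 i) (c1 1 z * (c0 i z + kp z * c3 i z))"
    "D1 (c2 i) (- kp z * c0 i z + c2 1 z * (c0 i z + kp z * c3 i z))"
    "D2 (c0 i) (- kp z * c1 i z + c0 2 z * (c0 i z + kp z * c3 i z))"
    "D2 (c1 i) (kp z * c0 i z + c1 2 z * (c0 i z + kp z * c3 i z))"
    "D2 (c2 i) (c2 2 z * (c0 i z + kp z * c3 i z))"
    using *[of 1] *[of 2] *[of 3] by (simp_all add: brackets alpha_lin)
qed

text \<open>The same with \<open>rot_field 2 1\<close>. Its brackets with
  \<open>rot_field 1 3\<close> and \<open>rot_field 2 3\<close> stay in the span of these two, where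
  the forms take the values 0 and 1; hence the inhomogeneous terms \<open>kp z\<close>.\<close>

lemma D_c3:
  "D1 (c3 i) (c2 i z + kp z * (if i = 1 then 1 else 0) + c3 1 z * (c0 i z + kp z * c3 i z))"
  "D2 (c3 i) (- c1 i z + kp z * (if i = 2 then 1 else 0) + c3 2 z * (c0 i z + kp z * c3 i z))"
proof -
  obtain D where D: "((\<lambda>y. \<alpha> i y (rot_field 2 1 y)) has_derivative D) (at z)"
    using field_derivative_exists[OF z has_derivative_rot_field] by blast
  show "D1 (c3 i) (c2 i z + kp z * (if i = 1 then 1 else 0) + c3 1 z * (c0 i z + kp z * c3 i z))"
    unfolding der_def using D frobenius_X(1)[OF tangent_fields(3), of i]
    unfolding ext_H_R[OF D] ext_P_R[OF D] by (auto simp: algebra_simps)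
  show "D2 (c3 i) (- c1 i z + kp z * (if i = 2 then 1 else 0) + c3 2 z * (c0 i z + kp z * c3 i z))"
    unfolding der_def using D frobenius_X(2)[OF tangent_fields(3), of i]
    unfolding ext_H_R[OF D] ext_P_R[OF D] by (auto simp: algebra_simps)
qed

lemma D_kp:
  "D1 (\<lambda>y. kp y) (2 * kp z * (c0 1 z + kp z * c3 1 z))"
  "D2 (\<lambda>y. kp y) (2 * kp z * (c0 2 z + kp z * c3 2 z))"
  unfolding der_def dl_eq[symmetric] dl_def using has_derivative_kp[OF z(1)]
  by (auto intro!: exI simp: fst_fields)

lemma has_derivative_dl:
  "(dl j has_derivative (\<lambda>h. (pd 1 (pd 1 l) (fst (fst z)) * fst (fst h) $ 1 + pd 2 (pd 1 l) (fst (fst z)) * fst (fst h) $ 2) * snd (fst z) $ j $ 1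
      + (pd 1 (pd 2 l) (fst (fst z)) * fst (fst h) $ 1 + pd 2 (pd 2 l) (fst (fst z)) * fst (fst h) $ 2) * snd (fst z) $ j $ 2
      + pd 1 l (fst (fst z)) * snd (fst h) $ j $ 1 + pd 2 l (fst (fst z)) * snd (fst h) $ j $ 2)) (at z)"
proof -
  have p: "((\<lambda>y::frames. pd i l (fst (fst y))) has_derivative
     (\<lambda>h. pd 1 (pd i l) (fst (fst z)) * fst (fst h) $ 1 + pd 2 (pd i l) (fst (fst z)) * fst (fst h) $ 2)) (at z)" for i
    using has_derivative_compose[OF has_derivative_fst[OF has_derivative_fst[OF has_derivative_ident]]
       smooth_has_derivative_pd[OF smooth_on_pd[OF smooth_l] in_S[OF z(1)]]] .
  have n: "((\<lambda>y::frames. snd (fst y) $ j $ b) has_derivative (\<lambda>h. snd (fst h) $ j $ b)) (at z)" for b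
    by (intro bounded_linear.has_derivative[OF bounded_linear_vec_nth] has_derivative_snd has_derivative_fst has_derivative_ident)
  show ?thesis unfolding dl_def[abs_def]
    by (rule has_derivative_eq_rhs[OF has_derivative_add[OF has_derivative_mult[OF p n] has_derivative_mult[OF p n]]])
      (simp add: fun_eq_iff algebra_simps)
qed

text \<open>\<open>dl j\<close> depends on the surface frame alone, so the Euclidean rotations do
  not act on it, and differentiating along a horizontal lift is covariant differentiation.\<close>

lemma D_dl:
  "D1 (\<lambda>y. of_real (dl j y)) (of_real (hess 1 j z))"
  "D2 (\<lambda>y. of_real (dl j y)) (of_real (hess 2 j z))"
  unfolding der_def
  by (intro exI conjI, rule has_derivative_of_real[OF has_derivative_dl],
      simp add: fst_fields horizontal_field_def horizontal_def hess_def sum_2 algebra_simps)+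

lemma hess_sym: "hess i j z = hess j i z"
proof -
  note s = in_S[OF z(1)]
  show ?thesis
    unfolding hess_def sum_2 christoffel_sym[OF s, of _ 2 1] pd_commute[OF open_S s smooth_l, of 2 1]
    by (simp add: algebra_simps)
qed

end

end

section \<open>Relations from repeated differentiation along the annihilated fields\<close>

context frobenius_pair
begin

text \<open>By \<open>dl_eq\<close>, \<open>uu\<close> and \<open>ww\<close> are the components of \<open>dl\<close>; the components of the tensor in
  \<open>algebraic_conclusion\<close> are \<open>aa\<close>, \<open>bb = bb'\<close> and \<open>cc\<close>.\<close>

definition "uu z = c0 1 z + kp z * c3 1 z"
definition "ww z = c0 2 z + kp z * c3 2 z"
definition "aa z = kp z + c2 1 z + c3 1 z * uu z"
definition "bb z = c3 1 z * ww z - c1 1 z"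
definition "bb' z = c2 2 z + c3 2 z * uu z"
definition "cc z = kp z + c3 2 z * ww z - c1 2 z"

lemmas tensor_defs = uu_def ww_def aa_def bb_def bb'_def cc_def

context
  fixes z :: frames
  assumes z: "z \<in> frame_bundle" "z \<in> U"
begin


lemmas D_base = D_c012[OF z] D_c3[OF z] D_kp[OF z]

lemma D_unique:
  "D1 z f d \<Longrightarrow> D1 z g e \<Longrightarrow> \<forall>y\<in>frame_bundle \<inter> U. f y = g y \<Longrightarrow> d = e"
  "D2 z f d \<Longrightarrow> D2 z g e \<Longrightarrow> \<forall>y\<in>frame_bundle \<inter> U. f y = g y \<Longrightarrow> d = e"
  using der_unique[OF open_U z tangent_fields(5)[OF z] tangent_fields(2)[OF z]]
    der_unique[OF open_U z tangent_fields(5)[OF z] tangent_fields(1)[OF z]] by blast+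

lemma D_uu:
  "D1 z uu ((uu z)\<^sup>2 - (kp z)\<^sup>2 + 2 * kp z * aa z)"
  "D2 z uu (uu z * ww z + 2 * kp z * bb z)"
  "D1 z ww (uu z * ww z + 2 * kp z * bb' z)"
  "D2 z ww ((ww z)\<^sup>2 - (kp z)\<^sup>2 + 2 * kp z * cc z)"
  unfolding uu_def[abs_def] ww_def[abs_def]
  by (rule der_eq, (rule D_base der_add der_mult)+, simp add: tensor_defs power2_eq_square algebra_simps)+

lemma D_c3':
  "D1 z (c3 1) (aa z)"
  "D2 z (c3 1) (bb z - c3 1 z * ww z + c3 2 z * uu z)"
  "D1 z (c3 2) (bb' z - c3 2 z * uu z + c3 1 z * ww z)"
  "D2 z (c3 2) (cc z)"
  by (rule der_eq, rule D_base, simp add: tensor_defs algebra_simps)+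

text \<open>The derivative of \<open>dl\<close> is computed twice, geometrically by
  \<open>D_dl\<close> and from the Frobenius condition by \<open>D_uu\<close>. The two functions
  agree only on the bundle, which is enough since the fields are tangent to it.\<close>

lemma hess_tensor:
  "of_real (hess 1 1 z) = (uu z)\<^sup>2 - (kp z)\<^sup>2 + 2 * kp z * aa z"
  "of_real (hess 1 2 z) = uu z * ww z + 2 * kp z * bb' z"
  "of_real (hess 2 1 z) = uu z * ww z + 2 * kp z * bb z"
  "of_real (hess 2 2 z) = (ww z)\<^sup>2 - (kp z)\<^sup>2 + 2 * kp z * cc z"
  using D_unique(1)[OF D_dl(1)[OF z] D_uu(1), of 1] D_unique(1)[OF D_dl(1)[OF z] D_uu(3), of 2]
    D_unique(2)[OF D_dl(2)[OF z] D_uu(2), of 1] D_unique(2)[OF D_dl(2)[OF z] D_uu(4), of 2]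
  by (simp_all add: dl_eq uu_def ww_def)

lemma kp_nonzero: "kp z \<noteq> 0"
  using kappa_nonzero[OF in_S[OF z(1)]] .

text \<open>The first algebraic relation among the coefficients: symmetry of the Hessian of
  \<open>l\<close>.\<close>

lemma bb_eq: "bb z = bb' z"
  using hess_tensor(2,3) hess_sym[OF z, of 1 2] kp_nonzero by simp

end

lemma bb_eq_all: "\<forall>y\<in>frame_bundle \<inter> U. bb y = bb' y"
  using bb_eq by blast

context
  fixes z :: frames
  assumes z: "z \<in> frame_bundle" "z \<in> U"
begin

lemma c_eqs:
  "c0 1 z = uu z - kp z * c3 1 z" "c0 2 z = ww z - kp z * c3 2 z"
  "c1 1 z = c3 1 z * ww z - bb z" "c1 2 z = kp z + c3 2 z * ww z - cc z"
  "c2 1 z = aa z - kp z - c3 1 z * uu z" "c2 2 z = bb z - c3 2 z * uu z"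
  using bb_eq[OF z] by (simp_all add: tensor_defs algebra_simps)

text \<open>\<open>bb\<close> and \<open>bb'\<close> agree on the bundle but are different
  polynomials in the coefficients. Their derivatives are therefore kept as different expressions,
  whose comparison yields \<open>aa_cc_relations\<close>.\<close>

lemma D_bb:
  "D1 z bb (2 * kp z * bb z * c3 1 z + uu z * bb z + ww z * aa z)"
  "D2 z bb (bb z * ww z + 2 * kp z * c3 1 z * cc z - 2 * kp z * uu z + cc z * uu z)"
  "D1 z bb' (- 2 * kp z * ww z + aa z * ww z + bb z * uu z + 2 * kp z * aa z * c3 2 z)"
  "D2 z bb' (bb z * ww z + cc z * uu z + 2 * kp z * c3 2 z * bb z)"
  unfolding bb_def[abs_def] bb'_def[abs_def]
  by (rule der_eq, (rule D_uu[OF z] D_c3'[OF z] D_base[OF z] der_add der_diff der_mult)+,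
      simp add: bb_eq[OF z, symmetric] c_eqs power2_eq_square algebra_simps)+

lemma aa_cc_relations:
  "aa z * c3 2 z - bb z * c3 1 z = ww z" "cc z * c3 1 z - bb z * c3 2 z = uu z"
proof -
  have "2 * kp z * (aa z * c3 2 z - bb z * c3 1 z) = 2 * kp z * ww z"
    using D_unique(1)[OF z D_bb(1,3) bb_eq_all] by (simp add: algebra_simps)
  then show "aa z * c3 2 z - bb z * c3 1 z = ww z" using kp_nonzero[OF z] by simp
  have "2 * kp z * (cc z * c3 1 z - bb z * c3 2 z) = 2 * kp z * uu z"
    using D_unique(2)[OF z D_bb(2,4) bb_eq_all] by (simp add: algebra_simps)
  then show "cc z * c3 1 z - bb z * c3 2 z = uu z" using kp_nonzero[OF z] by simp
qed

lemma D_aa_cc: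
  "D1 z aa (2 * aa z * (uu z + kp z * c3 1 z))"
  "D2 z aa (2 * kp z * ww z + 2 * bb z * uu z + 2 * kp z * c3 1 z * bb z)"
  "D1 z cc (2 * kp z * uu z + 2 * bb z * ww z + 2 * kp z * c3 2 z * bb z)"
  "D2 z cc (2 * cc z * ww z + 2 * kp z * c3 2 z * cc z)"
  unfolding aa_def[abs_def] cc_def[abs_def]
  by (rule der_eq, (rule D_uu[OF z] D_c3'[OF z] D_base[OF z] der_add der_diff der_mult)+,
      simp add: bb_eq[OF z, symmetric] c_eqs power2_eq_square algebra_simps)+

end

text \<open>Differentiating the two relations between \<open>aa\<close>, \<open>bb\<close>, \<open>cc\<close> once more.\<close>

lemma hess_eq_on_frames:
  assumes z: "z \<in> frame_bundle" "z \<in> U"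
  shows "hess i j z = 3 * dl i z * dl j z - gauss_formula G (fst (fst z)) * (if i = j then 1 else 0)"
proof -
  note r = aa_cc_relations
  have rs: "\<forall>y\<in>frame_bundle \<inter> U. aa y * c3 2 y - bb y * c3 1 y = ww y"
    "\<forall>y\<in>frame_bundle \<inter> U. cc y * c3 1 y - bb y * c3 2 y = uu y"
    using r by blast+
  note f1 = D_unique(1)[OF z _ D_uu(1)[OF z] rs(2)] D_unique(1)[OF z _ D_uu(3)[OF z] rs(1), folded bb_eq[OF z]]
  note f2 = D_unique(2)[OF z _ D_uu(2)[OF z] rs(2)] D_unique(2)[OF z _ D_uu(4)[OF z] rs(1)]
  note d1 = D_aa_cc[OF z] D_c3'[OF z] D_bb(1)[OF z]
  \<comment> \<open>The second relation replaces \<open>uu z\<close> in the term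
    \<open>- 2 * kp z * uu z\<close>, giving the shape that the hypotheses of
    \<open>algebraic_conclusion\<close> have.\<close>
  have d2: "D2 z bb (bb z * ww z + cc z * uu z + 2 * kp z * c3 2 z * bb z)"
    by (rule der_eq[OF D_bb(2)[OF z]]) (simp add: r(2)[OF z, symmetric] algebra_simps)
  note f = f1(1)[OF der_diff[OF der_mult[OF d1(3) d1(5)] der_mult[OF d1(9) d1(7)]]]
    f2(1)[OF der_diff[OF der_mult[OF d1(4) d1(6)] der_mult[OF d2 d1(8)]]]
    f1(2)[OF der_diff[OF der_mult[OF d1(1) d1(7)] der_mult[OF d1(9) d1(5)]]]
    f2(2)[OF der_diff[OF der_mult[OF d1(2) d1(8)] der_mult[OF d2 d1(6)]]]
  have con: "kp z * aa z = (kp z)\<^sup>2 + (uu z)\<^sup>2" "kp z * bb z = uu z * ww z" "kp z * cc z = (kp z)\<^sup>2 + (ww z)\<^sup>2"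
    by (rule algebraic_conclusion[OF kp_nonzero[OF z] r(1)[OF z] r(2)[OF z]]; (use f in \<open>simp add: bb_eq[OF z, symmetric] algebra_simps\<close>))+
  have k2: "(kp z)\<^sup>2 = of_real (- gauss_formula G (fst (fst z)))"
    using kappa_square[OF in_S[OF z(1)]] by (simp add: power2_eq_square)
  have u: "uu z = of_real (dl 1 z)" "ww z = of_real (dl 2 z)"
    using dl_eq[OF z] by (simp_all add: uu_def ww_def)
  \<comment> \<open>The factor 3 appears here: \<open>u^2 - \<kappa>^2 + 2 * (\<kappa>^2 + u^2) = 3
    * u^2 + \<kappa>^2\<close>, with \<open>\<kappa>^2 = - K\<close>.\<close>
  have "of_real (hess 1 1 z) = (of_real (3 * dl 1 z * dl 1 z - gauss_formula G (fst (fst z))) :: 'k)"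
    "of_real (hess 1 2 z) = (of_real (3 * dl 1 z * dl 2 z) :: 'k)"
    "of_real (hess 2 2 z) = (of_real (3 * dl 2 z * dl 2 z - gauss_formula G (fst (fst z))) :: 'k)"
    unfolding hess_tensor[OF z] bb_eq[OF z, symmetric] mult.assoc con k2 unfolding u
    by (simp_all add: power2_eq_square algebra_simps)
  \<comment> \<open>All terms are real, and \<open>of_real\<close> is injective, so the possibly
    complex identities descend to the reals.\<close>
  then have "hess 1 1 z = 3 * dl 1 z * dl 1 z - gauss_formula G (fst (fst z))"
    "hess 1 2 z = 3 * dl 1 z * dl 2 z"
    "hess 2 2 z = 3 * dl 2 z * dl 2 z - gauss_formula G (fst (fst z))"
    unfolding of_real_eq_iff by auto
  then show ?thesis
    using exhaust_2[of i] exhaust_2[of j] hess_sym[OF z, of 2 1] by (auto simp: mult.commute)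
qed

end

section \<open>From a Frobenius subbundle to a normalised pair of forms\<close>

lemma sum_lessThan_6: "(\<Sum>i<6. f i) = f 0 + f (Suc 0) + f 2 + f 3 + f 4 + (f 5 :: 'a::comm_monoid_add)"
  by (simp add: eval_nat_numeral ac_simps)

lemma form_span_cmul_add:
  assumes "\<beta> \<in> form_span N vs z" "\<gamma> \<in> form_span N vs z"
  shows "(\<lambda>w. a * \<beta> w + b * \<gamma> w) \<in> form_span N vs z"
proof -
  obtain p q where "\<forall>w\<in>tangent_space N z. \<beta> w = (\<Sum>i<length vs. p i * (vs ! i) z w)"
    "\<forall>w\<in>tangent_space N z. \<gamma> w = (\<Sum>i<length vs. q i * (vs ! i) z w)"
    using assms by (auto simp: form_span_def)
  then have "\<forall>w\<in>tangent_space N z. a * \<beta> w + b * \<gamma> w = (\<Sum>i<length vs. (a * p i + b * q i) * (vs ! i) z w)"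
    by (simp add: sum_distrib_left sum.distrib[symmetric] algebra_simps)
  then show ?thesis unfolding form_span_def by (intro CollectI exI)
qed

lemma sum_two_terms:
  fixes f :: "nat \<Rightarrow> 'k::comm_ring_1"
  assumes "2 \<le> (n::nat)" shows "(\<Sum>i<n. (if i = 0 then a else if i = 1 then b else 0) * f i) = a * f 0 + b * f 1"
proof -
  have "(\<Sum>i<n. (if i = 0 then a else if i = 1 then b else 0) * f i) = (\<Sum>i\<in>{0,1}. (if i = 0 then a else if i = 1 then b else 0) * f i)"
    by (rule sum.mono_neutral_right) (use assms in auto)
  then show ?thesis by simp
qed

lemma sum_three_terms:
  fixes f :: "nat \<Rightarrow> 'k::comm_ring_1"
  assumes "3 \<le> (n::nat)" shows "(\<Sum>i<n. (if i = 0 then a else if i = 1 then b else if i = 2 then c else 0) * f i) = a * f 0 + b * f 1 + c * f 2"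
proof -
  have "(\<Sum>i<n. (if i = 0 then a else if i = 1 then b else if i = 2 then c else 0) * f i) =
    (\<Sum>i\<in>{0,1,2}. (if i = 0 then a else if i = 1 then b else if i = 2 then c else 0) * f i)"
    by (rule sum.mono_neutral_right) (use assms in auto)
  then show ?thesis by (simp add: add.assoc)
qed

context riemannian_chart
begin

lemma singular_system_values:
  fixes \<kappa> :: "real^2 \<Rightarrow> 'k::real_normed_field"
  assumes z: "z \<in> frame_bundle" and i: "i < 6"
  shows "(singular_system G \<kappa> ! i) z (horizontal_field 1 1 z) = (if i = 5 then \<kappa> (fst (fst z)) else 0)"
    "(singular_system G \<kappa> ! i) z (horizontal_field 2 2 z) = (if i = 4 then - \<kappa> (fst (fst z)) else 0)"
    "(singular_system G \<kappa> ! i) z (rot_field 1 3 z) = (if i = 4 then 1 else 0)"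
    "(singular_system G \<kappa> ! i) z (rot_field 2 3 z) = (if i = 5 then 1 else 0)"
    "(singular_system G \<kappa> ! i) z (spin_field z) = 0"
proof -
  obtain x v \<rho> e where zz: "z = ((x, v), (\<rho>, e))" "(x, v) \<in> frames_on" "(\<rho>, e) \<in> orthonormal_frames"
    using z by (elim frame_bundle_cases) (rule that)
  have on: "ip (G x) (v $ a) (v $ b) = (if a = b then 1 else 0)" for a b
    using zz(2) by (auto simp: frames_on_def)
  have oe: "e $ a \<bullet> e $ b = (if a = b then 1 else 0)" for a b
    using zz(3) by (auto simp: orthonormal_frames_def)
  have ip0: "ip (G x) u 0 = 0" for u by (simp add: ip_2)
  have h: "snd (horizontal a (x, v)) $ b + (\<chi> k. \<Sum>l\<in>UNIV. \<Sum>m\<in>UNIV. christoffel G k l m x * fst (horizontal a (x, v)) $ l * v $ b $ m) = 0" for a b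
    by (simp add: horizontal_def vec_eq_iff)
  have hf: "horizontal_field a k z = ((v $ a, snd (horizontal a (x, v))), (e $ k, 0))" for a k
    by (simp add: horizontal_field_def zz(1) horizontal_def)
  have rf: "rot_field a b z = ((0, 0), (0, rotate_rows a b e))" for a b
    by (simp add: rot_field_def zz(1) zero_prod_def)
  have sf: "spin_field z = ((0, vector [- v $ 2, v $ 1]), (0, rotate_rows 2 1 e))"
    by (simp add: spin_field_def zz(1))
  have fh: "fst (horizontal a (x, v)) = v $ a" for a by (simp add: horizontal_def)
  note hh = h[unfolded fh]
  have chi0: "(\<chi> k. 0) = (0 :: real^2)" by (simp add: vec_eq_iff)
  have "i = 0 \<or> i = 1 \<or> i = 2 \<or> i = 3 \<or> i = 4 \<or> i = 5" using i by arith
  then show "(singular_system G \<kappa> ! i) z (horizontal_field 1 1 z) = (if i = 5 then \<kappa> (fst (fst z)) else 0)"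
    "(singular_system G \<kappa> ! i) z (horizontal_field 2 2 z) = (if i = 4 then - \<kappa> (fst (fst z)) else 0)"
    "(singular_system G \<kappa> ! i) z (rot_field 1 3 z) = (if i = 4 then 1 else 0)"
    "(singular_system G \<kappa> ! i) z (rot_field 2 3 z) = (if i = 5 then 1 else 0)"
    "(singular_system G \<kappa> ! i) z (spin_field z) = 0"
    unfolding hf rf sf unfolding zz(1)
    by (elim disjE; simp add: singular_system_def thetas_def on oe ip0 hh rotate_rows_def chi0)+
qed

lemma length_singular_system: "length (singular_system G \<kappa>) = 6"
  by (simp add: singular_system_def thetas_def)

text \<open>The values on \<open>rot_field 1 3\<close> and \<open>rot_field 2 3\<close> are exactly
  the coefficients of the two generators beyond the thetas, so they determine an element of the span
  modulo the thetas.\<close>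

lemma singular_span_values:
  fixes \<kappa> :: "real^2 \<Rightarrow> 'k::real_normed_field"
  assumes z: "z \<in> frame_bundle" and b: "\<beta> \<in> form_span frame_bundle (singular_system G \<kappa>) z"
  shows "\<beta> (horizontal_field 1 1 z) = \<kappa> (fst (fst z)) * \<beta> (rot_field 2 3 z)"
    "\<beta> (horizontal_field 2 2 z) = - \<kappa> (fst (fst z)) * \<beta> (rot_field 1 3 z)"
    "\<beta> (spin_field z) = 0"
    "\<beta> (rot_field 1 3 z) = 0 \<Longrightarrow> \<beta> (rot_field 2 3 z) = 0 \<Longrightarrow> \<beta> \<in> form_span frame_bundle (thetas G) z"
proof -
  obtain a where a: "\<And>w. w \<in> tangent_space frame_bundle z \<Longrightarrow> \<beta> w = (\<Sum>i<6. a i * (singular_system G \<kappa> ! i) z w)"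
    using b by (auto simp: form_span_def length_singular_system)
  have t: "rot_field 1 3 z \<in> tangent_space frame_bundle z" "rot_field 2 3 z \<in> tangent_space frame_bundle z"
    by (auto intro!: tangent_rot_field z)
  have v: "\<beta> (horizontal_field 1 1 z) = a 5 * \<kappa> (fst (fst z))" "\<beta> (horizontal_field 2 2 z) = - a 4 * \<kappa> (fst (fst z))"
    "\<beta> (rot_field 1 3 z) = a 4" "\<beta> (rot_field 2 3 z) = a 5" "\<beta> (spin_field z) = 0"
    using a[OF tangent_horizontal_field[OF z, of 1 1]] a[OF tangent_horizontal_field[OF z, of 2 2]]
      a[OF t(1)] a[OF t(2)] a[OF tangent_spin_field[OF z]]
    by (simp_all add: sum_lessThan_6 singular_system_values[OF z])
  then show "\<beta> (horizontal_field 1 1 z) = \<kappa> (fst (fst z)) * \<beta> (rot_field 2 3 z)"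
    "\<beta> (horizontal_field 2 2 z) = - \<kappa> (fst (fst z)) * \<beta> (rot_field 1 3 z)"
    "\<beta> (spin_field z) = 0"
    by simp_all
  assume "\<beta> (rot_field 1 3 z) = 0" "\<beta> (rot_field 2 3 z) = 0"
  then have "a 4 = 0" "a 5 = 0" using v by auto
  then have "\<beta> w = (\<Sum>i<length (thetas G :: (frames, 'k) one_form list). a i * (thetas G ! i) z w)"
    if "w \<in> tangent_space frame_bundle z" for w
    using a[OF that] unfolding sum_lessThan_6 by (simp add: singular_system_def thetas_def eval_nat_numeral ac_simps)
  then show "\<beta> \<in> form_span frame_bundle (thetas G) z"
    unfolding form_span_def by blast
qed

text \<open>Since the frame meets the span of the thetas only in 0, its coefficients with respect to
  the two remaining generators of the singular system are linearly independent.\<close>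

lemma frame_coefficients:
  fixes \<kappa> :: "real^2 \<Rightarrow> 'k::real_normed_field"
  assumes z: "z \<in> frame_bundle" and len: "length \<alpha>s \<ge> 2"
    and ind: "form_independent frame_bundle \<alpha>s z"
    and span: "\<forall>\<alpha>\<in>set \<alpha>s. \<alpha> z \<in> form_span frame_bundle (singular_system G \<kappa>) z"
    and meet: "\<forall>\<beta>\<in>form_span frame_bundle \<alpha>s z \<inter> form_span frame_bundle (thetas G) z.
      \<forall>w\<in>tangent_space frame_bundle z. \<beta> w = 0"
  shows "length \<alpha>s = 2"
    "(\<alpha>s ! 0) z (rot_field 1 3 z) * (\<alpha>s ! 1) z (rot_field 2 3 z) - (\<alpha>s ! 0) z (rot_field 2 3 z) * (\<alpha>s ! 1) z (rot_field 1 3 z) \<noteq> 0"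
proof -
  define n where "n = length \<alpha>s"
  define p q where "p i = (\<alpha>s ! i) z (rot_field 1 3 z)" "q i = (\<alpha>s ! i) z (rot_field 2 3 z)" for i
  have key: "\<forall>i<n. c i = 0" if c: "(\<Sum>i<n. c i * p i) = 0" "(\<Sum>i<n. c i * q i) = 0" for c
  proof -
    define \<beta> where "\<beta> w = (\<Sum>i<n. c i * (\<alpha>s ! i) z w)" for w
    have 1: "\<beta> \<in> form_span frame_bundle \<alpha>s z" unfolding form_span_def \<beta>_def n_def by auto
    have "(\<lambda>w. \<Sum>i<m. c i * (\<alpha>s ! i) z w) \<in> form_span frame_bundle (singular_system G \<kappa>) z" if "m \<le> n" for m
      using that
    proof (induction m)
      case 0
      then show ?case unfolding form_span_def by (intro CollectI exI[of _ "\<lambda>i. 0"]) simp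
    next
      case (Suc m)
      then have "(\<alpha>s ! m) z \<in> form_span frame_bundle (singular_system G \<kappa>) z"
        using span by (simp add: n_def)
      from form_span_cmul_add[OF Suc.IH this, of 1 "c m"] Suc.prems show ?case by simp
    qed
    then have 2: "\<beta> \<in> form_span frame_bundle (singular_system G \<kappa>) z" unfolding \<beta>_def by blast
    have "\<beta> \<in> form_span frame_bundle (thetas G) z"
      by (rule singular_span_values(4)[OF z 2]) (use c in \<open>simp_all add: \<beta>_def p_q_def\<close>)
    then have "\<forall>w\<in>tangent_space frame_bundle z. \<beta> w = 0" using 1 meet by blast
    then show ?thesis using ind unfolding form_independent_def \<beta>_def n_def by blast
  qed
  have n2: "n \<ge> 2" using len n_def by simp
  have key2: "a = 0 \<and> b = 0" if "a * p 0 + b * p 1 = 0" "a * q 0 + b * q 1 = 0" for a b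
    using key[of "\<lambda>i. if i = 0 then a else if i = 1 then b else 0"] that n2
    unfolding sum_two_terms[OF n2] by (metis less_le_trans one_less_numeral_iff pos2 semiring_norm(76) zero_neq_one)
  have det: "p 0 * q 1 - q 0 * p 1 \<noteq> 0"
  proof
    assume d: "p 0 * q 1 - q 0 * p 1 = 0"
    \<comment> \<open>If the determinant vanished, \<open>(p 1, - p 0)\<close> and
      \<open>(q 1, - q 0)\<close> would be relations, hence trivial; then all four values vanish and
      \<open>(1, 0)\<close> is a nontrivial relation.\<close>
    have "p 1 = 0 \<and> - p 0 = 0" by (rule key2) (use d in \<open>simp_all add: algebra_simps\<close>)
    moreover have "q 1 = 0 \<and> - q 0 = 0" by (rule key2) (use d in \<open>simp_all add: algebra_simps\<close>)
    ultimately show False using key2[of 1 0] by simp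
  qed
  then show "(\<alpha>s ! 0) z (rot_field 1 3 z) * (\<alpha>s ! 1) z (rot_field 2 3 z) - (\<alpha>s ! 0) z (rot_field 2 3 z) * (\<alpha>s ! 1) z (rot_field 1 3 z) \<noteq> 0"
    by (simp add: p_q_def)
  show "length \<alpha>s = 2"
  proof (rule ccontr)
    assume "length \<alpha>s \<noteq> 2"
    then have n3: "n \<ge> 3" using n2 n_def by simp
    \<comment> \<open>A third form would be dependent on the others: the cross product of the
      vectors of the \<open>p i\<close> and of the \<open>q i\<close> annihilates both, and its last
      entry is the nonzero determinant.\<close>
    define c where "c i = (if i = 0 then p 1 * q 2 - q 1 * p 2 else if i = 1 then p 2 * q 0 - q 2 * p 0
      else if i = 2 then p 0 * q 1 - q 0 * p 1 else 0)" for i :: nat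
    have "\<forall>i<n. c i = 0"
      by (rule key; unfold c_def sum_three_terms[OF n3]; simp add: algebra_simps)
    then have "c 2 = 0" using n3 by auto
    then show False using det by (simp add: c_def)
  qed
qed

text \<open>The equation is an identity of tensors at \<open>x\<close>, so it suffices to check it
  on one orthonormal frame there, near which the given subbundle has a frame that can be normalised
  to a \<open>frobenius_pair\<close>.\<close>

lemma hessian_equation:
  fixes \<kappa> :: "real^2 \<Rightarrow> 'k::real_normed_field"
  assumes cf: "contains_frobenius frame_bundle (thetas G) (singular_system G \<kappa>)"
    and l: "smooth_on S l"
    and k: "\<And>x. x \<in> S \<Longrightarrow> \<kappa> x \<noteq> 0"
      "\<And>x. x \<in> S \<Longrightarrow> \<kappa> x * \<kappa> x = - of_real (gauss_formula G x)"
      "\<And>x. x \<in> S \<Longrightarrow> (\<kappa> has_derivative (\<lambda>h. 2 * \<kappa> x * of_real (pd 1 l x * h $ 1 + pd 2 l x * h $ 2))) (at x)"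
    and x: "x \<in> S"
  shows "pd i (pd j l) x = (\<Sum>m\<in>UNIV. christoffel G m i j x * pd m l x) + 3 * pd i l x * pd j l x
    - gauss_formula G x * G x $ i $ j"
proof -
  obtain v where v: "(x, v) \<in> frames_on" using frame_exists[OF x] by blast
  \<comment> \<open>Any Euclidean frame would serve; this is the standard one at the origin.\<close>
  define z0 :: frames where "z0 = ((x, v), (0, \<chi> i. axis i 1))"
  have z0: "z0 \<in> frame_bundle"
    using v by (simp add: z0_def frame_bundle_def orthonormal_frames_def inner_axis_axis)
  obtain U \<alpha>s where U: "open U" "z0 \<in> U" "length \<alpha>s \<ge> 2" "\<forall>\<alpha>\<in>set \<alpha>s. smooth_one_form U \<alpha>"
    and **: "\<forall>z\<in>frame_bundle \<inter> U. form_independent frame_bundle \<alpha>s z \<and> frobenius_at frame_bundle \<alpha>s z \<and>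
          (\<forall>\<alpha>\<in>set \<alpha>s. \<alpha> z \<in> form_span frame_bundle (singular_system G \<kappa>) z) \<and>
          (\<forall>\<beta>\<in>form_span frame_bundle \<alpha>s z \<inter> form_span frame_bundle (thetas G) z. \<forall>w\<in>tangent_space frame_bundle z. \<beta> w = 0)"
    using bspec[OF cf[unfolded contains_frobenius_def] z0] by (elim exE conjE) (rule that)
  have F: "form_independent frame_bundle \<alpha>s z \<and> frobenius_at frame_bundle \<alpha>s z \<and>
          (\<forall>\<alpha>\<in>set \<alpha>s. \<alpha> z \<in> form_span frame_bundle (singular_system G \<kappa>) z) \<and>
          (\<forall>\<beta>\<in>form_span frame_bundle \<alpha>s z \<inter> form_span frame_bundle (thetas G) z. \<forall>w\<in>tangent_space frame_bundle z. \<beta> w = 0)"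
    if "z \<in> frame_bundle" "z \<in> U" for z
    by (rule bspec[OF ** IntI[OF that]])
  have "length \<alpha>s = 2"
    by (rule frame_coefficients[OF z0 U(3)]) (use F[OF z0 U(2)] in auto)
  then obtain \<beta>\<^sub>1 \<beta>\<^sub>2 where as: "\<alpha>s = [\<beta>\<^sub>1, \<beta>\<^sub>2]"
    by (metis (no_types, opaque_lifting) One_nat_def Suc_1 length_0_conv length_Suc_conv)
  define a b c d where "a y = \<beta>\<^sub>1 y (rot_field 1 3 y)" "b y = \<beta>\<^sub>1 y (rot_field 2 3 y)"
    "c y = \<beta>\<^sub>2 y (rot_field 1 3 y)" "d y = \<beta>\<^sub>2 y (rot_field 2 3 y)" for y
  note abcd = this
  have det: "a z * d z - b z * c z \<noteq> 0" if "z \<in> frame_bundle" "z \<in> U" for z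
    using frame_coefficients(2)[OF that(1) U(3), where \<kappa> = \<kappa>] F[OF that] by (simp add: as abcd)
  have lin: "linear (\<beta>\<^sub>1 y)" "linear (\<beta>\<^sub>2 y)" if "y \<in> U" for y
    using U(4) that by (auto simp: as smooth_one_form_def)
  have dif: "(\<lambda>y. \<beta>\<^sub>1 y w) differentiable (at z)" "(\<lambda>y. \<beta>\<^sub>2 y w) differentiable (at z)" if "z \<in> U" for z w
    using U(4) that unfolding as smooth_one_form_def list.set by (blast intro: smooth_on_differentiable)+
  have dfield: "(\<lambda>y. \<beta> y (rot_field m n y)) differentiable (at z)"
    if "z \<in> U" "\<forall>y\<in>U. linear (\<beta> y)" "\<forall>w. (\<lambda>y. \<beta> y w) differentiable (at z)"
    for \<beta> :: "(frames, 'k) one_form" and z m n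
    by (rule differentiableI, rule form_field_has_derivative[OF U(1) that(1) _ _ has_derivative_rot_field])
      (use that in blast)+
  have dabcd: "a differentiable (at z)" "b differentiable (at z)" "c differentiable (at z)" "d differentiable (at z)"
    if "z \<in> U" for z
  proof -
    have "\<forall>y\<in>U. linear (\<beta>\<^sub>1 y)" "\<forall>w. (\<lambda>y. \<beta>\<^sub>1 y w) differentiable (at z)"
      "\<forall>y\<in>U. linear (\<beta>\<^sub>2 y)" "\<forall>w. (\<lambda>y. \<beta>\<^sub>2 y w) differentiable (at z)"
      using lin dif[OF that] by blast+
    note * = dfield[where \<beta> = \<beta>\<^sub>1, OF that this(1,2)] dfield[where \<beta> = \<beta>\<^sub>2, OF that this(3,4)]
    show "a differentiable (at z)" "b differentiable (at z)" "c differentiable (at z)" "d differentiable (at z)"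
      unfolding abcd[abs_def] by (rule *)+
  qed
  define \<delta> where "\<delta> y = a y * d y - b y * c y" for y
  \<comment> \<open>The rows of the inverse of the matrix with rows \<open>(a, b)\<close> and
    \<open>(c, d)\<close>, so that the new forms are dual to the two rotation fields.\<close>
  define p q where "p i y = (if i = 1 then d y else - c y) / \<delta> y"
    "q i y = (if i = 1 then - b y else a y) / \<delta> y" for i :: 2 and y
  define \<alpha> where "\<alpha> i y w = p i y * \<beta>\<^sub>1 y w + q i y * \<beta>\<^sub>2 y w" for i y w
  have dpq: "p i differentiable (at z)" "q i differentiable (at z)" if "z \<in> frame_bundle" "z \<in> U" for i z
    unfolding p_q_def[abs_def] \<delta>_def
    by (cases "i = 1"; use dabcd[OF that(2)] det[OF that] in
      \<open>auto intro!: differentiable_divide differentiable_diff differentiable_mult differentiable_minus\<close>)+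
  have vals: "\<alpha> i z (rot_field 1 3 z) = (if i = 1 then 1 else 0)" "\<alpha> i z (rot_field 2 3 z) = (if i = 2 then 1 else 0)"
    if "z \<in> frame_bundle" "z \<in> U" for i z
  proof -
    have d0: "\<delta> z \<noteq> 0" using det[OF that] by (simp add: \<delta>_def)
    show "\<alpha> i z (rot_field 1 3 z) = (if i = 1 then 1 else 0)" "\<alpha> i z (rot_field 2 3 z) = (if i = 2 then 1 else 0)"
      using exhaust_2[of i] d0
      by (auto simp: \<alpha>_def p_q_def abcd[symmetric] divide_simps) (simp_all add: \<delta>_def algebra_simps)
  qed
  have span: "\<alpha> i z \<in> form_span frame_bundle (singular_system G \<kappa>) z" if "z \<in> frame_bundle" "z \<in> U" for i z
    using form_span_cmul_add[of "\<beta>\<^sub>1 z" _ _ _ "\<beta>\<^sub>2 z"] F[OF that] unfolding \<alpha>_def[abs_def] as by simp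
  have frob: "\<exists>g h. \<forall>v\<in>tangent_space frame_bundle z. \<forall>w\<in>tangent_space frame_bundle z.
        ext_deriv (\<alpha> i) z v w = (g v * \<alpha> 1 z w - g w * \<alpha> 1 z v) + (h v * \<alpha> 2 z w - h w * \<alpha> 2 z v)"
    if z: "z \<in> frame_bundle" "z \<in> U" for i z
  proof -
    have fz: "frobenius_at frame_bundle [\<beta>\<^sub>1, \<beta>\<^sub>2] z" using F[OF z] as by simp
    obtain B1 where B1: "\<And>v w. v \<in> tangent_space frame_bundle z \<Longrightarrow> w \<in> tangent_space frame_bundle z \<Longrightarrow>
       ext_deriv \<beta>\<^sub>1 z v w = (B1 0 v * \<beta>\<^sub>1 z w - B1 0 w * \<beta>\<^sub>1 z v) + (B1 (Suc 0) v * \<beta>\<^sub>2 z w - B1 (Suc 0) w * \<beta>\<^sub>2 z v)"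
      using fz unfolding frobenius_at_def by (auto simp: eval_nat_numeral)
    obtain B2 where B2: "\<And>v w. v \<in> tangent_space frame_bundle z \<Longrightarrow> w \<in> tangent_space frame_bundle z \<Longrightarrow>
       ext_deriv \<beta>\<^sub>2 z v w = (B2 0 v * \<beta>\<^sub>1 z w - B2 0 w * \<beta>\<^sub>1 z v) + (B2 (Suc 0) v * \<beta>\<^sub>2 z w - B2 (Suc 0) w * \<beta>\<^sub>2 z v)"
      using fz unfolding frobenius_at_def by (auto simp: eval_nat_numeral)
    define P Q where "P = frechet_derivative (p i) (at z)" "Q = frechet_derivative (q i) (at z)"
    have PQ: "(p i has_derivative P) (at z)" "(q i has_derivative Q) (at z)"
      using dpq[OF z] by (simp_all add: P_Q_def frechet_derivative_works[symmetric])
    have fd: "frechet_derivative (\<lambda>y. \<alpha> i y w) (at z) v =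
      (p i z * frechet_derivative (\<lambda>y. \<beta>\<^sub>1 y w) (at z) v + P v * \<beta>\<^sub>1 z w) +
      (q i z * frechet_derivative (\<lambda>y. \<beta>\<^sub>2 y w) (at z) v + Q v * \<beta>\<^sub>2 z w)" for v w
    proof -
      have "((\<lambda>y. \<alpha> i y w) has_derivative (\<lambda>v. (p i z * frechet_derivative (\<lambda>y. \<beta>\<^sub>1 y w) (at z) v + P v * \<beta>\<^sub>1 z w) +
        (q i z * frechet_derivative (\<lambda>y. \<beta>\<^sub>2 y w) (at z) v + Q v * \<beta>\<^sub>2 z w))) (at z)"
        unfolding \<alpha>_def using dif[OF z(2), of w] unfolding frechet_derivative_works
        by (intro has_derivative_add has_derivative_mult PQ) auto
      from fun_cong[OF frechet_derivative_at[OF this], of v] show ?thesis by (rule sym)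
    qed
    \<comment> \<open>The Frobenius condition does not depend on the frame: differentiating the
      coefficients \<open>p i\<close>, \<open>q i\<close> only adds multiples of the forms
      themselves.\<close>
    define A B where "A v = P v + p i z * B1 0 v + q i z * B2 0 v"
      "B v = Q v + p i z * B1 (Suc 0) v + q i z * B2 (Suc 0) v" for v
    have ext: "ext_deriv (\<alpha> i) z v w = (A v * \<beta>\<^sub>1 z w - A w * \<beta>\<^sub>1 z v) + (B v * \<beta>\<^sub>2 z w - B w * \<beta>\<^sub>2 z v)"
      if "v \<in> tangent_space frame_bundle z" "w \<in> tangent_space frame_bundle z" for v w
    proof -
      have "ext_deriv (\<alpha> i) z v w = p i z * ext_deriv \<beta>\<^sub>1 z v w + q i z * ext_deriv \<beta>\<^sub>2 z v w
        + (P v * \<beta>\<^sub>1 z w - P w * \<beta>\<^sub>1 z v) + (Q v * \<beta>\<^sub>2 z w - Q w * \<beta>\<^sub>2 z v)"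
        unfolding ext_deriv_def fd by (simp add: algebra_simps)
      then show ?thesis unfolding B1[OF that] B2[OF that] A_B_def by (simp add: algebra_simps)
    qed
    have inv: "\<beta>\<^sub>1 z w = a z * \<alpha> 1 z w + b z * \<alpha> 2 z w" "\<beta>\<^sub>2 z w = c z * \<alpha> 1 z w + d z * \<alpha> 2 z w" for w
    proof -
      have d0: "\<delta> z \<noteq> 0" using det[OF z] by (simp add: \<delta>_def)
      show "\<beta>\<^sub>1 z w = a z * \<alpha> 1 z w + b z * \<alpha> 2 z w" "\<beta>\<^sub>2 z w = c z * \<alpha> 1 z w + d z * \<alpha> 2 z w"
        using d0 by (simp_all add: \<alpha>_def p_q_def divide_simps) (simp_all add: \<delta>_def algebra_simps)
    qed
    show ?thesis
      by (intro exI[of _ "\<lambda>v. A v * a z + B v * c z"] exI[of _ "\<lambda>v. A v * b z + B v * d z"] ballI)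
        (simp add: ext inv algebra_simps)
  qed
  interpret fp: frobenius_pair S G \<kappa> l U \<alpha>
  proof (intro frobenius_pair.intro frobenius_pair_axioms.intro riemannian_chart_axioms)
    fix i y assume y: "y \<in> U"
    show "linear (\<alpha> i y)"
      unfolding \<alpha>_def[abs_def]
      by (rule linearI) (simp_all only: linear_add[OF lin(1)[OF y]] linear_add[OF lin(2)[OF y]]
          linear_cmul[OF lin(1)[OF y]] linear_cmul[OF lin(2)[OF y]], simp_all add: algebra_simps)
  next
    fix i :: 2 and z w assume "z \<in> frame_bundle" "z \<in> U"
    then show "(\<lambda>y. \<alpha> i y w) differentiable (at z)"
      unfolding \<alpha>_def by (intro differentiable_add differentiable_mult dpq dif)
  next
    fix i :: 2 and z assume z: "z \<in> frame_bundle" "z \<in> U"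
    show "\<alpha> i z (horizontal_field 1 1 z) = (if i = 2 then 1 else 0) * \<kappa> (fst (fst z))"
      "\<alpha> i z (horizontal_field 2 2 z) = (if i = 1 then - 1 else 0) * \<kappa> (fst (fst z))"
      "\<alpha> i z (spin_field z) = 0"
      using singular_span_values(1-3)[OF z(1) span[OF z]] vals[OF z, of i] by auto
  qed (use l k U(1) vals frob in auto)
  define T where "T a b = pd a (pd b l) x - (\<Sum>m\<in>UNIV. christoffel G m a b x * pd m l x)
    - 3 * pd a l x * pd b l x + gauss_formula G x * G x $ a $ b" for a b
  have "(\<Sum>l'\<in>UNIV. \<Sum>m\<in>UNIV. T l' m * v$i$l' * v$j$m) = 0" for i j
  proof -
    have "ip (G x) (v $ i) (v $ j) = (if i = j then 1 else 0)" using v by (auto simp: frames_on_def)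
    then have "fp.hess i j z0 = 3 * fp.dl i z0 * fp.dl j z0 - gauss_formula G x * ip (G x) (v $ i) (v $ j)"
      using fp.hess_eq_on_frames[OF z0 U(2), of i j] by (simp add: z0_def)
    then show ?thesis
      unfolding fp.hess_def fp.dl_def z0_def T_def ip_2 sum_2 fst_conv snd_conv
      by (simp add: algebra_simps)
  qed
  from frame_tensor_zero[OF v this, of i j] show ?thesis unfolding T_def by simp
qed

end

context riemannian_chart
begin

lemma smooth_riemann_curvature: "smooth_on S (riemann_curvature G l k i j)"
  unfolding riemann_curvature_def[abs_def]
  by (intro smooth_on_add smooth_on_diff smooth_on_sum smooth_on_mult smooth_on_pd smooth_christoffel open_S)

lemma smooth_gauss_formula: "smooth_on S (gauss_formula G)"
  unfolding gauss_formula_def[abs_def]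
  by (intro smooth_on_divide smooth_on_sum smooth_on_mult smooth_riemann_curvature smooth_G_nth smooth_det_G open_S)
    (use det_G_pos in fastforce)

end

subsection \<open>Metrics with a concircular function\<close>

locale concircular_chart = riemannian_chart +
  fixes q :: "real^2 \<Rightarrow> real" and \<epsilon> :: real
  assumes smooth_q: "smooth_on S q" and q_pos: "\<And>x. x \<in> S \<Longrightarrow> q x > 0"
    and hess_q: "\<And>x i j. x \<in> S \<Longrightarrow> pd i (pd j q) x =
      (\<Sum>m\<in>UNIV. christoffel G m i j x * pd m q x) + 3 * \<epsilon> * q x powr (-1/3) * G x $ i $ j"
begin

text \<open>\<open>rot_grad\<close> is \<open>J \<nabla>q\<close> and \<open>conj_form\<close> is the metric dual of it, so that \<open>conj_form / grad_sq\<close> becomes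
  the differential of the second coordinate.\<close>

definition rr :: "real^2 \<Rightarrow> real" where "rr x = 1 / sqrt (det (G x))"

definition conj_form :: "2 \<Rightarrow> real^2 \<Rightarrow> real" where
  "conj_form i x = rr x * (G x $ i $ 2 * pd 1 q x - G x $ i $ 1 * pd 2 q x)"

text \<open>The squared length of the gradient of \<open>q\<close>, the inverse metric being written
  out with \<open>rr x * rr x = 1 / det (G x)\<close>.\<close>

definition grad_sq :: "real^2 \<Rightarrow> real" where
  "grad_sq x = rr x * rr x * (G x $ 2 $ 2 * pd 1 q x * pd 1 q x - 2 * (G x $ 1 $ 2 * pd 1 q x * pd 2 q x) + G x $ 1 $ 1 * pd 2 q x * pd 2 q x)"

definition rot_grad :: "real^2 \<Rightarrow> real^2" where
  "rot_grad x = vector [- (rr x * pd 2 q x), rr x * pd 1 q x]"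

lemma rr_pos: "x \<in> S \<Longrightarrow> rr x > 0"
  using det_G_pos by (simp add: rr_def)

lemma rr_sq: "x \<in> S \<Longrightarrow> rr x * rr x * (G x $ 1 $ 1 * G x $ 2 $ 2 - G x $ 1 $ 2 * G x $ 1 $ 2) = 1"
  using det_G_pos[of x] det_G[of x] by (simp add: rr_def power2_eq_square)

lemma smooth_rr: "smooth_on S rr"
  unfolding rr_def[abs_def]
  by (intro smooth_on_divide smooth_on_sqrt smooth_det_G open_S smooth_on_const det_G_pos)
    (use det_G_pos in fastforce)+

lemma smooth_pd_q: "smooth_on S (pd i q)"
  by (rule smooth_on_pd[OF smooth_q])

lemma smooth_conj_form: "smooth_on S (conj_form i)"
  unfolding conj_form_def[abs_def]
  by (intro smooth_on_mult smooth_on_diff smooth_rr smooth_G_nth smooth_pd_q open_S)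

lemma smooth_grad_sq: "smooth_on S grad_sq"
  unfolding grad_sq_def[abs_def]
  by (intro smooth_on_mult smooth_on_add smooth_on_diff smooth_rr smooth_G_nth smooth_pd_q open_S smooth_on_const)

lemma smooth_rot_grad: "smooth_on S rot_grad"
proof (rule smooth_on_vec[OF open_S])
  fix i :: 2
  show "smooth_on S (\<lambda>x. rot_grad x $ i)"
    using exhaust_2[of i]
    by (auto simp: rot_grad_def intro!: smooth_on_mult smooth_on_minus smooth_rr smooth_pd_q open_S)
qed

context
  fixes x assumes x: "x \<in> S"
begin

lemma diffs: "(\<lambda>y. G y $ a $ b) differentiable (at x)" "pd a q differentiable (at x)"
  "rr differentiable (at x)" "q differentiable (at x)" "conj_form a differentiable (at x)"
  "grad_sq differentiable (at x)"
  using smooth_on_differentiable[OF _ x] smooth_G_nth smooth_pd_q smooth_rr smooth_q smooth_conj_form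
    smooth_grad_sq by blast+

lemmas pd_rules = pd_add pd_diff pd_mult pd_const pd_minus diffs differentiable_mult differentiable_add
  differentiable_diff differentiable_minus

text \<open>The contracted Christoffel symbol, which is the logarithmic derivative of the area
  density \<open>sqrt (det (G x))\<close>.\<close>

definition "div_symbol i = christoffel G 1 1 i x + christoffel G 2 2 i x"

lemma pd_det_G: "pd i (\<lambda>y. det (G y)) x = 2 * det (G x) * div_symbol i"
  unfolding det_2
  by (simp add: pd_rules metric_compatible[OF x] sum_2 G_21[OF x] christoffel_sym[OF x, of _ 2 1] div_symbol_def)
    (use exhaust_2[of i] in \<open>auto simp: algebra_simps christoffel_sym[OF x, of _ 2 1]\<close>)

lemma pd_rr: "pd i rr x = - rr x * div_symbol i"
proof -
  have D: "det (G x) > 0" by (rule det_G_pos[OF x])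
  have "((\<lambda>t. 1 / sqrt t) has_real_derivative - (inverse (sqrt (det (G x))) / 2 / (sqrt (det (G x)) * sqrt (det (G x))))) (at (det (G x)))"
    using D by (auto intro!: derivative_eq_intros simp: divide_simps)
  from pd_chain_real[OF smooth_on_differentiable[OF smooth_det_G x] this, of i]
  show ?thesis unfolding rr_def[abs_def] pd_det_G using D
    by (simp add: field_simps)
qed

text \<open>\<open>J\<close> is parallel, so the covariant derivative of \<open>J \<nabla>q\<close>
  is a multiple of \<open>J\<close>, which is skew for the metric. The Lie derivative of the metric
  is its symmetrisation.\<close>

lemma rot_grad_killing: "lie_metric G rot_grad i j x = 0"
proof -
  have p1: "pd a (\<lambda>y. rot_grad y $ 1) x = rr x * div_symbol a * pd 2 q x - rr x * pd a (pd 2 q) x"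
   and p2: "pd a (\<lambda>y. rot_grad y $ 2) x = rr x * pd a (pd 1 q) x - rr x * div_symbol a * pd 1 q x" for a
    by (simp_all add: rot_grad_def pd_rules pd_rr algebra_simps)
  show ?thesis
    unfolding lie_metric_def sum_2 p1 p2 metric_compatible[OF x] hess_q[OF x] div_symbol_def
    using exhaust_2[of i] exhaust_2[of j]
    by (auto simp: rot_grad_def sum_2 G_21[OF x] christoffel_sym[OF x, of _ 2 1] algebra_simps)
qed

text \<open>The differential of the squared gradient is twice the Hessian applied to the gradient,
  and the Hessian is \<open>h\<close> times the metric.\<close>

lemma pd_grad_sq: "pd i grad_sq x = 6 * \<epsilon> * q x powr (-1/3) * pd i q x"
proof -
  define h where "h = 3 * \<epsilon> * q x powr (-1/3)"
  note hq = hess_q[OF x, folded h_def]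
  have "pd i grad_sq x = 2 * h * (rr x * rr x * (G x $ 1 $ 1 * G x $ 2 $ 2 - G x $ 1 $ 2 * G x $ 1 $ 2)) * pd i q x"
    unfolding grad_sq_def[abs_def]
    using exhaust_2[of i]
    by (auto simp: pd_rules pd_rr hq metric_compatible[OF x] div_symbol_def
        sum_2 G_21[OF x] christoffel_sym[OF x, of _ 2 1] algebra_simps)
  then show ?thesis using rr_sq[OF x] by (simp add: h_def)
qed

text \<open>The exterior derivative of the form dual to \<open>J \<nabla>q\<close> is the Laplacian
  of \<open>q\<close> times the area form; the Laplacian is the trace \<open>2 * h\<close> of the
  Hessian.\<close>

lemma conj_form_curl:
  "rr x * (pd 1 (conj_form 2) x - pd 2 (conj_form 1) x) = 6 * \<epsilon> * q x powr (-1/3)"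
proof -
  define h where "h = 3 * \<epsilon> * q x powr (-1/3)"
  note hq = hess_q[OF x, folded h_def]
  have "rr x * (pd 1 (conj_form 2) x - pd 2 (conj_form 1) x) =
     2 * h * (rr x * rr x * (G x $ 1 $ 1 * G x $ 2 $ 2 - G x $ 1 $ 2 * G x $ 1 $ 2))"
    unfolding conj_form_def[abs_def]
    by (simp add: pd_rules pd_rr hq metric_compatible[OF x] div_symbol_def
        sum_2 G_21[OF x] christoffel_sym[OF x, of _ 2 1] algebra_simps)
  then show ?thesis using rr_sq[OF x] by (simp add: h_def)
qed

lemma grad_sq_conj_form: "grad_sq x = rr x * (pd 1 q x * conj_form 2 x - pd 2 q x * conj_form 1 x)"
  by (simp add: grad_sq_def conj_form_def G_21[OF x] algebra_simps)

text \<open>\<open>dq\<close> and \<open>conj_form\<close> are orthogonal and have the same length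
  as the gradient, so after division by it they form an orthonormal coframe.\<close>

lemma metric_eq_forms: "grad_sq x * G x $ i $ j = pd i q x * pd j q x + conj_form i x * conj_form j x"
proof -
  let ?D = "G x $ 1 $ 1 * G x $ 2 $ 2 - G x $ 1 $ 2 * G x $ 1 $ 2"
  have "grad_sq x * G x $ i $ j = (rr x * rr x * ?D) * pd i q x * pd j q x + conj_form i x * conj_form j x"
    using exhaust_2[of i] exhaust_2[of j]
    by (auto simp: grad_sq_def conj_form_def G_21[OF x] algebra_simps)
  then show ?thesis using rr_sq[OF x] by simp
qed

text \<open>By \<open>metric_eq_forms\<close>, \<open>g11\<close> times \<open>grad_sq\<close> is a
  sum of two squares, which vanishes only if both partial derivatives of \<open>q\<close>
  do.\<close>

lemma grad_sq_pos: assumes "rot_grad x \<noteq> 0" shows "grad_sq x > 0"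
proof -
  have g: "G x $ 1 $ 1 > 0" by (rule G_11_pos[OF x])
  have "pd 1 q x \<noteq> 0 \<or> pd 2 q x \<noteq> 0"
    using assms by (auto simp: rot_grad_def vec_eq_iff forall_2)
  then have "G x $ 1 $ 1 * grad_sq x \<noteq> 0"
  proof -
    have *: "grad_sq x * G x $ 1 $ 1 = pd 1 q x * pd 1 q x + conj_form 1 x * conj_form 1 x"
      by (rule metric_eq_forms)
    show ?thesis
    proof
      assume "G x $ 1 $ 1 * grad_sq x = 0"
      then have z: "pd 1 q x = 0" "conj_form 1 x = 0"
        using * by (auto simp: mult.commute sum_squares_eq_zero_iff)
      then have "pd 2 q x = 0" using g rr_pos[OF x] by (simp add: conj_form_def)
      then show False using z \<open>pd 1 q x \<noteq> 0 \<or> pd 2 q x \<noteq> 0\<close> by simp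
    qed
  qed
  moreover have "G x $ 1 $ 1 * grad_sq x \<ge> 0"
    using metric_eq_forms[of 1 1] by (simp add: mult.commute)
  ultimately have "0 < G x $ 1 $ 1 * grad_sq x" by (metis order_le_less)
  then show ?thesis by (rule zero_less_mult_pos) (rule g)
qed

end

end

subsection \<open>Closed forms in the plane\<close>

text \<open>The Poincare lemma with the radial homotopy: the potential at \<open>x\<close> is the
  integral of the form along the segment from \<open>p\<close> to \<open>x\<close>, differentiated
  under the integral sign.\<close>

lemma closed_form_exact:
  fixes a b :: "real^2 \<Rightarrow> real"
  assumes a: "smooth_on (ball p r) a" and b: "smooth_on (ball p r) b"
    and closed: "\<And>x. x \<in> ball p r \<Longrightarrow> pd 1 b x = pd 2 a x"
  obtains t where "\<And>x. x \<in> ball p r \<Longrightarrow> (t has_derivative (\<lambda>v. a x * v$1 + b x * v$2)) (at x)"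
proof -
  \<comment> \<open>The Leibniz rule needs the derivative of the integrand as a continuous function
    into the bounded linear maps.\<close>
  define \<pi> :: "2 \<Rightarrow> (real^2) \<Rightarrow>\<^sub>L real" where "\<pi> i = Blinfun (\<lambda>v. v $ i)" for i
  have pi: "blinfun_apply (\<pi> i) v = v $ i" for i v
    unfolding \<pi>_def by (subst bounded_linear_Blinfun_apply) (auto intro: bounded_linear_vec_nth)
  define \<gamma> where "\<gamma> x \<tau> = p + \<tau> *\<^sub>R (x - p)" for x \<tau>
  define da where "da x \<tau> = pd 1 a (\<gamma> x \<tau>) * (x - p)$1 + pd 2 a (\<gamma> x \<tau>) * (x - p)$2" for x \<tau>
  define db where "db x \<tau> = pd 1 b (\<gamma> x \<tau>) * (x - p)$1 + pd 2 b (\<gamma> x \<tau>) * (x - p)$2" for x \<tau>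
  define F where "F x \<tau> = a (\<gamma> x \<tau>) * (x - p)$1 + b (\<gamma> x \<tau>) * (x - p)$2" for x \<tau>
  \<comment> \<open>The derivative of \<open>F\<close> in \<open>x\<close>, already rearranged by
    closedness: \<open>da\<close> and \<open>db\<close> are derivatives along the segment, so
    \<open>F' x \<tau>\<close> is the derivative in \<open>\<tau>\<close> of \<open>\<tau>\<close>
    times the form at \<open>\<gamma> x \<tau>\<close>.\<close>
  define F' where "F' x \<tau> = (\<tau> * da x \<tau> + a (\<gamma> x \<tau>)) *\<^sub>R \<pi> 1 + (\<tau> * db x \<tau> + b (\<gamma> x \<tau>)) *\<^sub>R \<pi> 2" for x \<tau>
  have in_ball: "\<gamma> x \<tau> \<in> ball p r" if "x \<in> ball p r" "\<tau> \<in> {0..1}" for x \<tau>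
  proof -
    have "\<bar>\<tau>\<bar> * norm (x - p) \<le> 1 * norm (x - p)"
      using that by (intro mult_right_mono) auto
    then have "norm (\<tau> *\<^sub>R (x - p)) \<le> norm (x - p)" by simp
    also have "\<dots> < r" using that(1) by (simp add: dist_norm norm_minus_commute)
    finally show ?thesis by (simp add: \<gamma>_def dist_norm)
  qed
  have dx: "((\<lambda>x. \<gamma> x \<tau>) has_derivative (\<lambda>v. \<tau> *\<^sub>R v)) (at x)" for x \<tau>
    unfolding \<gamma>_def by (auto intro!: derivative_eq_intros)
  have dt: "((\<lambda>\<tau>. \<gamma> x \<tau>) has_derivative (\<lambda>d. d *\<^sub>R (x - p))) (at \<tau>)" for x \<tau>
    unfolding \<gamma>_def by (auto intro!: derivative_eq_intros)
  have n: "((\<lambda>x. (x - p) $ i) has_derivative (\<lambda>v. v $ i)) (at x)" for x and i :: 2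
    by (auto intro!: derivative_eq_intros bounded_linear.has_derivative[OF bounded_linear_vec_nth])
  have D: "(f has_derivative (\<lambda>v. pd 1 f y * v$1 + pd 2 f y * v$2)) (at y)"
    if "smooth_on (ball p r) f" "y \<in> ball p r" for f y
    by (rule smooth_has_derivative_pd[OF that])
  have c: "continuous_on (ball p r \<times> {0..1}) (\<lambda>z. f (\<gamma> (fst z) (snd z)))"
    if "continuous_on (ball p r) f" for f :: "real^2 \<Rightarrow> real"
    by (rule continuous_on_compose2[OF that]) (use in_ball in \<open>auto simp: \<gamma>_def intro!: continuous_intros\<close>)
  note sc = c[OF smooth_on_continuous[OF a]] c[OF smooth_on_continuous[OF b]]
    c[OF smooth_on_continuous[OF smooth_on_pd[OF a]]] c[OF smooth_on_continuous[OF smooth_on_pd[OF b]]]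
  have *: "((\<lambda>x. integral (cbox 0 1) (F x)) has_derivative integral (cbox 0 1) (F' x)) (at x within ball p r)"
    if x: "x \<in> ball p r" for x
  proof (rule leibniz_rule[where fx = F'])
    fix y \<tau> assume y: "y \<in> ball p r" "\<tau> \<in> cbox 0 (1::real)"
    then have g: "\<gamma> y \<tau> \<in> ball p r" by (intro in_ball) auto
    have "((\<lambda>x. F x \<tau>) has_derivative (\<lambda>v.
      (a (\<gamma> y \<tau>) * v$1 + (pd 1 a (\<gamma> y \<tau>) * (\<tau> *\<^sub>R v)$1 + pd 2 a (\<gamma> y \<tau>) * (\<tau> *\<^sub>R v)$2) * (y - p)$1) +
      (b (\<gamma> y \<tau>) * v$2 + (pd 1 b (\<gamma> y \<tau>) * (\<tau> *\<^sub>R v)$1 + pd 2 b (\<gamma> y \<tau>) * (\<tau> *\<^sub>R v)$2) * (y - p)$2))) (at y)"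
      unfolding F_def
      by (intro has_derivative_add has_derivative_mult n has_derivative_compose[OF dx D[OF a g]]
          has_derivative_compose[OF dx D[OF b g]])
    moreover have "(a (\<gamma> y \<tau>) * v$1 + (pd 1 a (\<gamma> y \<tau>) * (\<tau> *\<^sub>R v)$1 + pd 2 a (\<gamma> y \<tau>) * (\<tau> *\<^sub>R v)$2) * (y - p)$1) +
      (b (\<gamma> y \<tau>) * v$2 + (pd 1 b (\<gamma> y \<tau>) * (\<tau> *\<^sub>R v)$1 + pd 2 b (\<gamma> y \<tau>) * (\<tau> *\<^sub>R v)$2) * (y - p)$2)
      = blinfun_apply (F' y \<tau>) v" for v
      by (simp add: F'_def da_def db_def blinfun.add_left blinfun.diff_left blinfun.scaleR_left pi closed[OF g] algebra_simps)
    ultimately have "((\<lambda>x. F x \<tau>) has_derivative blinfun_apply (F' y \<tau>)) (at y)" by (simp only:)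
    then show "((\<lambda>x. F x \<tau>) has_derivative blinfun_apply (F' y \<tau>)) (at y within ball p r)"
      by (rule has_derivative_at_withinI)
  next
    fix y assume y: "y \<in> ball p r"
    have "continuous_on {0..1} (\<lambda>\<tau>. f (\<gamma> y \<tau>))" if "continuous_on (ball p r) f" for f :: "real^2 \<Rightarrow> real"
      by (rule continuous_on_compose2[OF that]) (use in_ball[OF y] in \<open>auto simp: \<gamma>_def intro!: continuous_intros\<close>)
    then have "continuous_on {0..1} (F y)"
      unfolding F_def using smooth_on_continuous[OF a] smooth_on_continuous[OF b] by (auto intro!: continuous_intros)
    then show "F y integrable_on cbox 0 1" using integrable_continuous by (metis box_real(2))
  next
    show "continuous_on (ball p r \<times> cbox 0 1) (\<lambda>(x, t). F' x t)"
      unfolding case_prod_beta F'_def da_def db_def cbox_interval by (intro continuous_intros sc)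
  qed (use x in auto)
  have **: "integral (cbox 0 1) (F' x) = a x *\<^sub>R \<pi> 1 + b x *\<^sub>R \<pi> 2" if x: "x \<in> ball p r" for x
  proof -
    have "((\<lambda>\<tau>. \<tau> *\<^sub>R (a (\<gamma> x \<tau>) *\<^sub>R \<pi> 1 + b (\<gamma> x \<tau>) *\<^sub>R \<pi> 2)) has_vector_derivative F' x \<tau>) (at \<tau>)"
      if t: "\<tau> \<in> {0..1}" for \<tau>
    proof -
      note g = in_ball[OF x t]
      have d: "((\<lambda>\<tau>. f (\<gamma> x \<tau>)) has_real_derivative pd 1 f (\<gamma> x \<tau>) * (x - p)$1 + pd 2 f (\<gamma> x \<tau>) * (x - p)$2) (at \<tau>)"
        if "smooth_on (ball p r) f" for f
        using has_real_derivative_line[OF dt D[OF that g]] .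
      have "((\<lambda>\<tau>. \<tau> *\<^sub>R (a (\<gamma> x \<tau>) *\<^sub>R \<pi> 1 + b (\<gamma> x \<tau>) *\<^sub>R \<pi> 2)) has_vector_derivative
        (\<tau> *\<^sub>R ((a (\<gamma> x \<tau>) *\<^sub>R 0 + da x \<tau> *\<^sub>R \<pi> 1) + (b (\<gamma> x \<tau>) *\<^sub>R 0 + db x \<tau> *\<^sub>R \<pi> 2)) + 1 *\<^sub>R (a (\<gamma> x \<tau>) *\<^sub>R \<pi> 1 + b (\<gamma> x \<tau>) *\<^sub>R \<pi> 2))) (at \<tau>)"
        unfolding da_def db_def
        by (intro has_vector_derivative_scaleR has_vector_derivative_add has_vector_derivative_const d a b DERIV_ident)
      then show ?thesis by (simp add: F'_def algebra_simps)
    qed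
    then have "(F' x has_integral (1 *\<^sub>R (a (\<gamma> x 1) *\<^sub>R \<pi> 1 + b (\<gamma> x 1) *\<^sub>R \<pi> 2) - 0 *\<^sub>R (a (\<gamma> x 0) *\<^sub>R \<pi> 1 + b (\<gamma> x 0) *\<^sub>R \<pi> 2))) {0..1}"
      by (intro fundamental_theorem_of_calculus) (auto intro: has_vector_derivative_at_within)
    then show ?thesis by (simp add: \<gamma>_def integral_unique cbox_interval)
  qed
  have "((\<lambda>x. integral (cbox 0 1) (F x)) has_derivative (\<lambda>v. a x * v$1 + b x * v$2)) (at x)"
    if "x \<in> ball p r" for x
  proof -
    have "blinfun_apply (a x *\<^sub>R \<pi> 1 + b x *\<^sub>R \<pi> 2) = (\<lambda>v. a x * v$1 + b x * v$2)"
      by (simp add: blinfun.add_left blinfun.scaleR_left pi fun_eq_iff)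
    then show ?thesis
      using * [OF that] ** [OF that] at_within_open[OF that open_ball] by simp
  qed
  then show ?thesis by (rule that)
qed

subsection \<open>Smooth local diffeomorphisms of the plane\<close>

text \<open>The derivative of the inverse is a smooth function of the inverse itself, which gives its
  smoothness by induction on the order.\<close>

lemma smooth_inverse_function_plane:
  fixes \<psi> :: "real^2 \<Rightarrow> real^2"
  assumes S: "open S" "x0 \<in> S" and sm: "smooth_on S \<psi>"
    and det: "\<And>x. x \<in> S \<Longrightarrow> pd 1 (\<lambda>y. \<psi> y $ 1) x * pd 2 (\<lambda>y. \<psi> y $ 2) x - pd 2 (\<lambda>y. \<psi> y $ 1) x * pd 1 (\<lambda>y. \<psi> y $ 2) x \<noteq> 0"
  obtains W r h where "open W" "x0 \<in> W" "W \<subseteq> S" "r > 0" "homeomorphism W (ball (\<psi> x0) r) \<psi> h"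
    "smooth_on (ball (\<psi> x0) r) h"
proof -
  define s1 s2 t1 t2 where "s1 = pd 1 (\<lambda>y. \<psi> y $ 1)" "s2 = pd 2 (\<lambda>y. \<psi> y $ 1)"
    "t1 = pd 1 (\<lambda>y. \<psi> y $ 2)" "t2 = pd 2 (\<lambda>y. \<psi> y $ 2)"
  note st = this
  define \<Delta> where "\<Delta> x = s1 x * t2 x - s2 x * t1 x" for x
  have D0: "\<Delta> x \<noteq> 0" if "x \<in> S" for x using det[OF that] by (simp add: \<Delta>_def st)
  define L :: "real^2 \<Rightarrow> real^2 \<Rightarrow> real^2" where "L x v = vector [s1 x * v$1 + s2 x * v$2, t1 x * v$1 + t2 x * v$2]" for x v
  \<comment> \<open>The inverse of \<open>L x\<close> by Cramer's rule; this explicit form shows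
    that it depends smoothly on \<open>x\<close>.\<close>
  define M :: "real^2 \<Rightarrow> real^2 \<Rightarrow> real^2" where "M x v = vector [(t2 x * v$1 - s2 x * v$2) / \<Delta> x, (s1 x * v$2 - t1 x * v$1) / \<Delta> x]" for x v
  have bl: "bounded_linear (L x)" "bounded_linear (M x)" for x
    unfolding linear_conv_bounded_linear[symmetric]
    by (auto intro!: linearI simp: L_def M_def vec_eq_iff forall_2 algebra_simps add_divide_distrib diff_divide_distrib)
  have inverses: "M x (L x v) = v" "L x (M x v) = v" if "x \<in> S" for x v
  proof -
    have "M x (L x v) $ 1 = v$1" "M x (L x v) $ 2 = v$2" "L x (M x v) $ 1 = v$1" "L x (M x v) $ 2 = v$2"
      using D0[OF that] by (simp_all add: M_def L_def divide_simps) (simp_all add: \<Delta>_def algebra_simps)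
    then show "M x (L x v) = v" "L x (M x v) = v"
      by (simp_all add: vec_eq_iff forall_2)
  qed
  have dL: "(\<psi> has_derivative L x) (at x)" if "x \<in> S" for x
  proof (rule has_derivative_vec)
    fix i :: 2
    have "((\<lambda>y. \<psi> y $ i) has_derivative (\<lambda>v. pd 1 (\<lambda>y. \<psi> y $ i) x * v$1 + pd 2 (\<lambda>y. \<psi> y $ i) x * v$2)) (at x)"
      by (rule smooth_has_derivative_pd[OF smooth_on_vec_nth[OF S(1) sm] that])
    then show "((\<lambda>y. \<psi> y $ i) has_derivative (\<lambda>v. L x v $ i)) (at x)"
      using exhaust_2[of i] by (auto simp: L_def st)
  qed
  have sst: "smooth_on S s1" "smooth_on S s2" "smooth_on S t1" "smooth_on S t2"
    unfolding st by (intro smooth_on_pd smooth_on_vec_nth S sm)+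
  have sM: "smooth_on S (\<lambda>x. M x v)" for v
  proof (rule smooth_on_vec[OF S(1)])
    fix i :: 2
    show "smooth_on S (\<lambda>x. M x v $ i)"
      using exhaust_2[of i] D0
      by (auto simp: M_def \<Delta>_def intro!: smooth_on_divide smooth_on_diff smooth_on_mult sst S smooth_on_const)
  qed
  define f' where "f' x = Blinfun (L x)" for x
  have f': "blinfun_apply (f' x) = L x" for x
    unfolding f'_def by (rule bounded_linear_Blinfun_apply[OF bl(1)])
  have cont: "continuous_on S f'"
  proof (rule continuous_on_blinfun_componentwise)
    fix i :: "real^2"
    have "continuous_on S (\<lambda>x. \<chi> j. if j = 1 then s1 x * i$1 + s2 x * i$2 else t1 x * i$1 + t2 x * i$2)"
      by (intro continuous_on_vec_lambda, case_tac "j = 1")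
        (auto intro!: smooth_on_continuous smooth_on_add smooth_on_mult smooth_on_const sst S(1))
    moreover have "blinfun_apply (f' x) i = (\<chi> j. if j = 1 then s1 x * i$1 + s2 x * i$2 else t1 x * i$1 + t2 x * i$2)" for x
      by (simp add: f' L_def vec_eq_iff forall_2)
    ultimately show "continuous_on S (\<lambda>x. blinfun_apply (f' x) i)" by simp
  qed
  have inv: "Blinfun (M x0) o\<^sub>L f' x0 = id_blinfun"
    by (rule blinfun_eqI) (simp add: f' bounded_linear_Blinfun_apply[OF bl(2)] inverses(1)[OF S(2)])
  obtain U' V g g' where U': "open U'" "U' \<subseteq> S" "x0 \<in> U'" "open V" "\<psi> x0 \<in> V" "homeomorphism U' V \<psi> g"
    and g': "\<And>y. y \<in> V \<Longrightarrow> (g has_derivative g' y) (at y)" "\<And>y. y \<in> V \<Longrightarrow> g' y = inv (blinfun_apply (f' (g y)))"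
    using inverse_function_theorem[OF S(1) _ cont S(2) inv] dL f' by (metis (no_types, lifting))
  obtain r where r: "r > 0" "ball (\<psi> x0) r \<subseteq> V" using U'(4,5) openE by blast
  define B where "B = ball (\<psi> x0) r"
  \<comment> \<open>Shrinking to the preimage of a ball makes the range of the first coordinate an
    interval centred at that of \<open>\<psi> x0\<close>.\<close>
  define W where "W = U' \<inter> \<psi> -` B"
  note hU = U'(6)[unfolded homeomorphism_def]
  have hom: "homeomorphism W B \<psi> g"
  proof (rule homeomorphismI)
    show "continuous_on W \<psi>" "continuous_on B g"
      using hU r(2) by (auto simp: W_def B_def intro: continuous_on_subset)
    show "\<psi> ` W \<subseteq> B" by (auto simp: W_def)
    have "g y \<in> U'" "\<psi> (g y) = y" if "y \<in> B" for y
      using hU r(2) that by (auto simp: B_def)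
    then show "g ` B \<subseteq> W" "\<And>y. y \<in> B \<Longrightarrow> \<psi> (g y) = y" by (auto simp: W_def)
    show "g (\<psi> x) = x" if "x \<in> W" for x
      using hU that by (simp add: W_def)
  qed
  have oW: "open W"
    unfolding W_def B_def
    by (rule continuous_open_preimage[OF _ U'(1) open_ball]) (use U'(6) in \<open>auto simp: homeomorphism_def\<close>)
  have gS: "g y \<in> S" if "y \<in> B" for y
    using hom that U'(2) unfolding homeomorphism_def W_def by blast
  have dg: "(g has_derivative M (g y)) (at y)" if "y \<in> B" for y
  proof -
    have "inv (L (g y)) = M (g y)"
      by (rule inv_unique_comp) (auto simp: fun_eq_iff inverses gS[OF that])
    moreover have "y \<in> V" using that r(2) by (auto simp: B_def)
    ultimately show ?thesis using g'(1,2)[of y] by (simp add: f')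
  qed
  have "times_diff_on n B g" for n
  proof (induction n)
    case 0
    then show ?case using hom by (simp add: homeomorphism_def)
  next
    case (Suc n)
    have oB: "open B" by (simp add: B_def)
    show ?case
      by (rule times_diff_on_SucI[OF oB dg]) (auto intro!: times_diff_on_compose[OF oB S(1) gS _ Suc] sM[unfolded smooth_on_def, rule_format])
  qed
  then have "smooth_on B g" by (simp add: smooth_on_def)
  then show ?thesis
    using that[of W r g] oW U'(2,3) r hom by (auto simp: W_def B_def)
qed

text \<open>Along the gradient flow \<open>q\<close> satisfies \<open>q' = \<surd>(C + 9\<epsilon> q\<^bsup>2/3\<^esup>)\<close>, where \<open>C\<close> is the constant value of
  \<open>|\<nabla>q|\<^sup>2 - 9\<epsilon> q\<^bsup>2/3\<^esup>\<close>; hence \<open>q\<close> is the inverse of an antiderivative of the reciprocal of the right hand side.\<close>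

lemma profile_function:
  fixes y0 C \<epsilon> :: real
  assumes y0: "y0 > 0" and C: "C + 9 * \<epsilon> * y0 powr (2/3) > 0"
  obtains l u \<Psi> Q where "l < y0" "y0 < u" "0 < l" "\<And>y. y \<in> {l<..<u} \<Longrightarrow> C + 9 * \<epsilon> * y powr (2/3) > 0"
    "\<And>y. y \<in> {l<..<u} \<Longrightarrow> (\<Psi> has_real_derivative 1 / sqrt (C + 9 * \<epsilon> * y powr (2/3))) (at y)"
    "\<And>y. y \<in> {l<..<u} \<Longrightarrow> Q (\<Psi> y) = y"
    "\<And>y. y \<in> {l<..<u} \<Longrightarrow> (Q has_real_derivative sqrt (C + 9 * \<epsilon> * y powr (2/3))) (at (\<Psi> y))"
    "\<And>y z. y \<in> {l<..<u} \<Longrightarrow> z \<in> {l<..<u} \<Longrightarrow> \<Psi> y < \<Psi> z \<longleftrightarrow> y < z"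
proof -
  define \<Phi> where "\<Phi> y = C + 9 * \<epsilon> * y powr (2/3)" for y
  have "isCont \<Phi> y0" unfolding \<Phi>_def using y0 by (auto intro!: continuous_intros)
  moreover have "\<Phi> y0 > 0" using C by (simp add: \<Phi>_def)
  ultimately have "\<forall>\<^sub>F y in nhds y0. \<Phi> y > 0"
    by (metis isCont_def order_tendstoD(1) tendsto_at_iff_tendsto_nhds)
  then obtain d where d: "d > 0" "\<And>y. \<bar>y - y0\<bar> < d \<Longrightarrow> \<Phi> y > 0"
    unfolding eventually_nhds_metric dist_real_def by auto
  \<comment> \<open>Halving keeps the closed interval \<open>{l..u}\<close> inside the region where
    \<open>\<Phi>\<close> is positive, and \<open>l\<close> above 0.\<close>
  define e where "e = min d y0 / 2"
  have e: "e > 0" "e < d" "e < y0" using d y0 by (auto simp: e_def)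
  define l u where "l = y0 - e" "u = y0 + e"
  have P: "\<Phi> y > 0" "y > 0" if "y \<in> {l..u}" for y
    using that e d(2)[of y] by (auto simp: l_u_def)
  have "continuous_on {l..u} (\<lambda>y. 1 / sqrt (\<Phi> y))"
    using P unfolding \<Phi>_def by (auto intro!: continuous_intros) (fastforce+)?
  then obtain \<Psi> where Psi: "\<And>y. y \<in> {l..u} \<Longrightarrow> (\<Psi> has_vector_derivative 1 / sqrt (\<Phi> y)) (at y within {l..u})"
    using antiderivative_continuous by blast
  have dPsi: "(\<Psi> has_real_derivative 1 / sqrt (\<Phi> y)) (at y)" if "y \<in> {l<..<u}" for y
  proof -
    have "(\<Psi> has_vector_derivative 1 / sqrt (\<Phi> y)) (at y within {l<..<u})"
      by (rule has_vector_derivative_within_subset[OF Psi]) (use that in \<open>auto intro!: subsetI\<close>)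
    then show ?thesis
      using at_within_open[OF that] by (simp add: has_real_derivative_iff_has_vector_derivative)
  qed
  have mono: "\<Psi> y < \<Psi> z" if "y \<in> {l<..<u}" "z \<in> {l<..<u}" "y < z" for y z
  proof (rule DERIV_pos_imp_increasing[OF that(3)])
    fix x assume "y \<le> x" "x \<le> z"
    then have x: "x \<in> {l<..<u}" using that by auto
    then show "\<exists>D. (\<Psi> has_real_derivative D) (at x) \<and> 0 < D"
      using dPsi[OF x] P(1)[of x] by auto
  qed
  have iff: "\<Psi> y < \<Psi> z \<longleftrightarrow> y < z" if "y \<in> {l<..<u}" "z \<in> {l<..<u}" for y z
    using mono[OF that] mono[OF that(2,1)] by (cases y z rule: linorder_cases) auto
  have inj: "inj_on \<Psi> {l<..<u}"
    by (rule linorder_inj_onI) (use mono in fastforce)+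
  define Q where "Q = inv_into {l<..<u} \<Psi>"
  have Q: "Q (\<Psi> y) = y" if "y \<in> {l<..<u}" for y
    unfolding Q_def using inv_into_f_f[OF inj that] .
  have dQ: "(Q has_real_derivative sqrt (\<Phi> y)) (at (\<Psi> y))" if y: "y \<in> {l<..<u}" for y
  proof -
    have "(Q has_derivative (*) (sqrt (\<Phi> y))) (at (\<Psi> y))"
    proof (rule has_derivative_inverse_strong[where S = "{l<..<u}" and f = \<Psi>])
      show "continuous_on {l<..<u} \<Psi>"
        by (intro continuous_at_imp_continuous_on ballI) (rule DERIV_isCont[OF dPsi])
      show "(\<Psi> has_derivative (*) (1 / sqrt (\<Phi> y))) (at y)"
        using dPsi[OF y] by (simp only: has_field_derivative_def)
      show "(*) (1 / sqrt (\<Phi> y)) \<circ> (*) (sqrt (\<Phi> y)) = id"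
        using P(1)[of y] y by (auto simp: fun_eq_iff)
    qed (use y Q in auto)
    then show ?thesis by (simp only: has_field_derivative_def)
  qed
  show ?thesis
    by (rule that[of l u \<Psi> Q]) (use e P dPsi Q dQ iff in \<open>auto simp: l_u_def \<Phi>_def\<close>)
qed

section \<open>Coordinates adapted to the gradient and the Killing field\<close>

context concircular_chart
begin

lemma local_coordinates:
  assumes x0: "x0 \<in> S" and nz: "rot_grad x0 \<noteq> 0"
  obtains \<psi> h :: "real^2 \<Rightarrow> real^2" and W r Q Q' where "open W" "x0 \<in> W" "W \<subseteq> S" "r > 0" "homeomorphism W (ball (\<psi> x0) r) \<psi> h"
    "smooth_on W \<psi>" "smooth_on (ball (\<psi> x0) r) h" "\<And>x. x \<in> W \<Longrightarrow> q x = Q (\<psi> x $ 1)"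
    "strict_mono_on {\<psi> x0 $ 1 - r<..<\<psi> x0 $ 1 + r} Q"
    "\<And>s. s \<in> {\<psi> x0 $ 1 - r<..<\<psi> x0 $ 1 + r} \<Longrightarrow> (Q has_real_derivative Q' s) (at s) \<and>
      (Q' has_real_derivative 3 * \<epsilon> * Q s powr (-1/3)) (at s)"
    "\<And>x u v. x \<in> W \<Longrightarrow> ip (G x) u v = frechet_derivative \<psi> (at x) u $ 1 * frechet_derivative \<psi> (at x) v $ 1
      + (Q' (\<psi> x $ 1))\<^sup>2 * frechet_derivative \<psi> (at x) u $ 2 * frechet_derivative \<psi> (at x) v $ 2"
    "\<And>x. x \<in> W \<Longrightarrow> frechet_derivative \<psi> (at x) (rot_grad x) = vector [0, 1]"
proof -
  have "open (S \<inter> rot_grad -` (- {0}))"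
    by (rule continuous_open_preimage[OF smooth_on_continuous[OF smooth_rot_grad] open_S]) auto
  moreover have "x0 \<in> S \<inter> rot_grad -` (- {0})" using x0 nz by simp
  ultimately obtain r1 where "r1 > 0" and sub: "ball x0 r1 \<subseteq> S \<inter> rot_grad -` (- {0})"
    by (rule openE)
  then have r1: "r1 > 0" "ball x0 r1 \<subseteq> S" "\<And>x. x \<in> ball x0 r1 \<Longrightarrow> rot_grad x \<noteq> 0"
    by blast+
  have f_pos: "grad_sq x > 0" if "x \<in> ball x0 r1" for x
    using grad_sq_pos r1 that by blast
  \<comment> \<open>The constant 9 makes the derivative
    \<open>6 * \<epsilon> * q powr (-1/3)\<close> of the second term match
    \<open>pd_grad_sq\<close>.\<close>
  define E where "E x = grad_sq x - 9 * \<epsilon> * q x powr (2/3)" for x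
  have dE: "(E has_derivative (\<lambda>v. 0)) (at x)" if "x \<in> S" for x
  proof -
    have p: "((\<lambda>y. 9 * \<epsilon> * y powr (2/3)) has_real_derivative 6 * \<epsilon> * q x powr (-1/3)) (at (q x))"
      using q_pos[OF that] by (auto intro!: derivative_eq_intros simp: powr_minus field_simps)
    have "((\<lambda>x. 9 * \<epsilon> * q x powr (2/3)) has_derivative (\<lambda>v. 6 * \<epsilon> * q x powr (-1/3) * (pd 1 q x * v$1 + pd 2 q x * v$2))) (at x)"
      using has_derivative_compose[OF smooth_has_derivative_pd[OF smooth_q that] p[unfolded has_field_derivative_def]] .
    from has_derivative_diff[OF smooth_has_derivative_pd[OF smooth_grad_sq that] this]
    show ?thesis unfolding E_def by (simp add: pd_grad_sq[OF that] algebra_simps)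
  qed
  have "\<exists>C. \<forall>x\<in>ball x0 r1. E x = C"
  proof (rule has_derivative_zero_constant)
    show "(E has_derivative (\<lambda>h. 0)) (at x within ball x0 r1)" if "x \<in> ball x0 r1" for x
      by (rule has_derivative_at_withinI[OF dE]) (use r1(2) that in blast)
  qed simp
  then obtain C where C: "\<And>x. x \<in> ball x0 r1 \<Longrightarrow> E x = C" by blast
  have fC: "grad_sq x = C + 9 * \<epsilon> * q x powr (2/3)" if "x \<in> ball x0 r1" for x
    using C[OF that] by (simp add: E_def)
  have C0: "C + 9 * \<epsilon> * q x0 powr (2/3) > 0" using f_pos[of x0] fC[of x0] r1(1) by simp
  obtain l u \<Psi> Q where lu: "l < q x0" "q x0 < u" "0 < l"
    and pos: "\<And>y. y \<in> {l<..<u} \<Longrightarrow> C + 9 * \<epsilon> * y powr (2/3) > 0"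
    and dPsi: "\<And>y. y \<in> {l<..<u} \<Longrightarrow> (\<Psi> has_real_derivative 1 / sqrt (C + 9 * \<epsilon> * y powr (2/3))) (at y)"
    and Q: "\<And>y. y \<in> {l<..<u} \<Longrightarrow> Q (\<Psi> y) = y"
    and dQ: "\<And>y. y \<in> {l<..<u} \<Longrightarrow> (Q has_real_derivative sqrt (C + 9 * \<epsilon> * y powr (2/3))) (at (\<Psi> y))"
    and mono: "\<And>y z. y \<in> {l<..<u} \<Longrightarrow> z \<in> {l<..<u} \<Longrightarrow> \<Psi> y < \<Psi> z \<longleftrightarrow> y < z"
    by (rule profile_function[OF q_pos[OF x0] C0]) (rule that; assumption)
  have "open (ball x0 r1 \<inter> q -` {l<..<u})"
    by (rule continuous_open_preimage) (use smooth_on_continuous[OF smooth_q] r1(2) in \<open>auto intro: continuous_on_subset\<close>)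
  moreover have "x0 \<in> ball x0 r1 \<inter> q -` {l<..<u}" using lu r1(1) by simp
  ultimately obtain r2 where r2: "r2 > 0" "ball x0 r2 \<subseteq> ball x0 r1 \<inter> q -` {l<..<u}"
    by (rule openE)
  define B where "B = ball x0 r2"
  have oB: "open B" and x0B: "x0 \<in> B" using r2(1) by (auto simp: B_def)
  have B: "x \<in> S" "x \<in> ball x0 r1" "q x \<in> {l<..<u}" if "x \<in> B" for x
    using that r1(2) r2(2) by (auto simp: B_def)
  have fp: "grad_sq x > 0" if "x \<in> B" for x using f_pos B(2)[OF that] by blast
  have smB: "smooth_on B f" if "smooth_on S f" for f :: "real^2 \<Rightarrow> real"
    using smooth_on_subset[OF that] B(1) by blast
  \<comment> \<open>Since \<open>\<Psi>\<close> is an antiderivative of the reciprocal of the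
    gradient length as a function of \<open>q\<close>, this gives
    \<open>ds = dq / |\<nabla>q|\<close>.\<close>
  define s where "s x = \<Psi> (q x)" for x
  have ds: "(s has_derivative (\<lambda>v. pd 1 q x / sqrt (grad_sq x) * v$1 + pd 2 q x / sqrt (grad_sq x) * v$2)) (at x)" if x: "x \<in> B" for x
  proof -
    have "(s has_derivative (\<lambda>v. (1 / sqrt (grad_sq x)) * (pd 1 q x * v$1 + pd 2 q x * v$2))) (at x)"
      unfolding s_def fC[OF B(2)[OF x]]
      using has_derivative_compose[OF smooth_has_derivative_pd[OF smooth_q B(1)[OF x]] dPsi[OF B(3)[OF x], unfolded has_field_derivative_def]] .
    then show ?thesis by (simp add: algebra_simps add_divide_distrib)
  qed
  define \<nu> where "\<nu> i x = conj_form i x / grad_sq x" for i x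
  have sm_nu: "smooth_on B (\<nu> i)" for i
    unfolding \<nu>_def by (intro smooth_on_divide smB smooth_conj_form smooth_grad_sq oB) (use fp in fastforce)
  have "pd 1 (\<nu> 2) x = pd 2 (\<nu> 1) x" if x: "x \<in> B" for x
  proof -
    have p: "pd i (\<nu> j) x = (pd i (conj_form j) x * grad_sq x - conj_form j x * pd i grad_sq x) / (grad_sq x * grad_sq x)" for i j
    proof -
      have "(\<nu> j has_derivative (\<lambda>v. ((pd 1 (conj_form j) x * v$1 + pd 2 (conj_form j) x * v$2) * grad_sq x
        - conj_form j x * (pd 1 grad_sq x * v$1 + pd 2 grad_sq x * v$2)) / (grad_sq x * grad_sq x))) (at x)"
        unfolding \<nu>_def using fp[OF x]
        by (intro has_derivative_divide' smooth_has_derivative_pd[OF smooth_conj_form B(1)[OF x]]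
            smooth_has_derivative_pd[OF smooth_grad_sq B(1)[OF x]]) auto
      from pd_eqI[OF this, of i] show ?thesis using exhaust_2[of i] by (auto simp: axis_def)
    qed
    let ?h = "6 * \<epsilon> * q x powr (-1/3)"
    \<comment> \<open>Closedness by the quotient rule: the Laplacian from the numerator and the
      derivative of \<open>grad_sq\<close> from the denominator carry the same factor
      \<open>?h\<close> and cancel.\<close>
    have "rr x * ((pd 1 (conj_form 2) x * grad_sq x - conj_form 2 x * pd 1 grad_sq x)
      - (pd 2 (conj_form 1) x * grad_sq x - conj_form 1 x * pd 2 grad_sq x)) =
      rr x * (pd 1 (conj_form 2) x - pd 2 (conj_form 1) x) * grad_sq x
      - ?h * (rr x * (pd 1 q x * conj_form 2 x - pd 2 q x * conj_form 1 x))"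
      unfolding pd_grad_sq[OF B(1)[OF x]] by (simp add: algebra_simps)
    also have "\<dots> = 0"
      unfolding conj_form_curl[OF B(1)[OF x]] grad_sq_conj_form[OF B(1)[OF x], symmetric] by simp
    finally have "(pd 1 (conj_form 2) x * grad_sq x - conj_form 2 x * pd 1 grad_sq x)
      = (pd 2 (conj_form 1) x * grad_sq x - conj_form 1 x * pd 2 grad_sq x)"
      using rr_pos[OF B(1)[OF x]] by simp
    then show ?thesis unfolding p by simp
  qed
  then obtain t where dt: "\<And>x. x \<in> B \<Longrightarrow> (t has_derivative (\<lambda>v. \<nu> 1 x * v$1 + \<nu> 2 x * v$2)) (at x)"
    using closed_form_exact[of x0 r2 "\<nu> 1" "\<nu> 2"] sm_nu unfolding B_def by blast
  define \<psi> :: "real^2 \<Rightarrow> real^2" where "\<psi> x = vector [s x, t x]" for x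
  have psi: "(\<lambda>y. \<psi> y $ 1) = s" "(\<lambda>y. \<psi> y $ 2) = t" by (auto simp: \<psi>_def)
  have sm: "smooth_on B s" "smooth_on B t"
  proof -
    have "smooth_on B (\<lambda>x. pd i q x / sqrt (grad_sq x))" for i
      by (intro smooth_on_divide smooth_on_sqrt smB smooth_pd_q smooth_grad_sq oB fp) (use fp in fastforce)+
    then have "smooth_on B (\<lambda>x. pd 1 q x / sqrt (grad_sq x) * v$1 + pd 2 q x / sqrt (grad_sq x) * v$2)" for v :: "real^2"
      by (intro smooth_on_add smooth_on_mult smooth_on_const oB)
    with ds show "smooth_on B s" by (rule smooth_onI[OF oB])
    have "smooth_on B (\<lambda>x. \<nu> 1 x * v$1 + \<nu> 2 x * v$2)" for v :: "real^2"
      by (intro smooth_on_add smooth_on_mult smooth_on_const sm_nu oB)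
    with dt show "smooth_on B t" by (rule smooth_onI[OF oB])
  qed
  have sm_psi: "smooth_on B \<psi>"
  proof (rule smooth_on_vec[OF oB])
    fix i :: 2
    show "smooth_on B (\<lambda>x. \<psi> x $ i)" using exhaust_2[of i] sm psi by auto
  qed
  have pds: "pd 1 s x = pd 1 q x / sqrt (grad_sq x)" "pd 2 s x = pd 2 q x / sqrt (grad_sq x)"
    "pd 1 t x = \<nu> 1 x" "pd 2 t x = \<nu> 2 x" if "x \<in> B" for x
    using pd_eqI[OF ds[OF that], of 1] pd_eqI[OF ds[OF that], of 2] pd_eqI[OF dt[OF that], of 1] pd_eqI[OF dt[OF that], of 2]
    by (auto simp: axis_def)
  have det: "pd 1 s x * pd 2 t x - pd 2 s x * pd 1 t x \<noteq> 0" if x: "x \<in> B" for x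
  proof -
    \<comment> \<open>The Jacobian determinant is the area density divided by the gradient length,
      in particular nonzero.\<close>
    have "rr x * (sqrt (grad_sq x) * grad_sq x) * (pd 1 s x * pd 2 t x - pd 2 s x * pd 1 t x) = grad_sq x"
      using fp[OF x] by (subst (3) grad_sq_conj_form[OF B(1)[OF x]]) (simp add: pds[OF x] \<nu>_def field_simps)
    then show ?thesis using fp[OF x] by auto
  qed
  obtain W r h where W: "open W" "x0 \<in> W" "W \<subseteq> B" "r > 0" "homeomorphism W (ball (\<psi> x0) r) \<psi> h"
    "smooth_on (ball (\<psi> x0) r) h"
    using smooth_inverse_function_plane[OF oB x0B sm_psi, unfolded psi, OF det] by blast
  define Q' where "Q' z = sqrt (C + 9 * \<epsilon> * Q z powr (2/3))" for z
  \<comment> \<open>\<open>Q\<close> is controlled only at values of \<open>\<Psi>\<close>. Each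
    \<open>z\<close> in the interval is one, being the first coordinate of a point on the horizontal
    diameter of the image ball.\<close>
  have range: "\<exists>y\<in>{l<..<u}. z = \<Psi> y" if z: "z \<in> {\<psi> x0 $ 1 - r<..<\<psi> x0 $ 1 + r}" for z
  proof -
    define y :: "real^2" where "y = vector [z, \<psi> x0 $ 2]"
    have "y - \<psi> x0 = (z - \<psi> x0 $ 1) *\<^sub>R axis 1 1"
      by (simp add: vec_eq_iff forall_2 y_def axis_def)
    then have "dist y (\<psi> x0) < r" using z by (auto simp: dist_norm norm_axis_1)
    then have "y \<in> ball (\<psi> x0) r" by (simp add: dist_commute)
    then have "h y \<in> W" "\<psi> (h y) = y" using W(5) by (auto simp: homeomorphism_def)
    moreover have "\<psi> (h y) $ 1 = \<Psi> (q (h y))" by (simp add: \<psi>_def s_def)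
    ultimately have "z = \<Psi> (q (h y))" "q (h y) \<in> {l<..<u}" using B(3) W(3) by (auto simp: y_def)
    then show ?thesis by blast
  qed
  have Qx: "q x = Q (\<psi> x $ 1)" "(Q' (\<psi> x $ 1))\<^sup>2 = grad_sq x" if "x \<in> W" for x
  proof -
    have x: "x \<in> B" using that W(3) by blast
    show "q x = Q (\<psi> x $ 1)" using Q[OF B(3)[OF x]] by (simp add: \<psi>_def s_def)
    then show "(Q' (\<psi> x $ 1))\<^sup>2 = grad_sq x"
      using fC[OF B(2)[OF x]] fp[OF x] by (simp add: Q'_def)
  qed
  have fr: "frechet_derivative \<psi> (at x) v = vector [pd 1 q x / sqrt (grad_sq x) * v$1 + pd 2 q x / sqrt (grad_sq x) * v$2, \<nu> 1 x * v$1 + \<nu> 2 x * v$2]"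
    if x: "x \<in> W" for x v
  proof -
    have xB: "x \<in> B" using x W(3) by blast
    have "(\<psi> has_derivative (\<lambda>v. vector [pd 1 q x / sqrt (grad_sq x) * v$1 + pd 2 q x / sqrt (grad_sq x) * v$2, \<nu> 1 x * v$1 + \<nu> 2 x * v$2])) (at x)"
    proof (rule has_derivative_vec)
      fix i :: 2
      show "((\<lambda>x. \<psi> x $ i) has_derivative (\<lambda>v. (vector [pd 1 q x / sqrt (grad_sq x) * v$1 + pd 2 q x / sqrt (grad_sq x) * v$2, \<nu> 1 x * v$1 + \<nu> 2 x * v$2] :: real^2) $ i)) (at x)"
        using exhaust_2[of i] ds[OF xB] dt[OF xB] psi by auto
    qed
    from fun_cong[OF frechet_derivative_at[OF this], of v] show ?thesis by (rule sym)
  qed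
  show ?thesis
  proof (rule that[of W r \<psi> h Q Q'])
    show "open W" "x0 \<in> W" "r > 0" "homeomorphism W (ball (\<psi> x0) r) \<psi> h" "smooth_on (ball (\<psi> x0) r) h"
      by (rule W)+
    show "W \<subseteq> S" using W(3) B(1) by blast
    show "smooth_on W \<psi>" by (rule smooth_on_subset[OF sm_psi W(3)])
    show "q x = Q (\<psi> x $ 1)" if "x \<in> W" for x by (rule Qx[OF that])
    show "strict_mono_on {\<psi> x0 $ 1 - r<..<\<psi> x0 $ 1 + r} Q"
    proof (rule strict_mono_onI)
      fix a b assume ab: "a \<in> {\<psi> x0 $ 1 - r<..<\<psi> x0 $ 1 + r}" "b \<in> {\<psi> x0 $ 1 - r<..<\<psi> x0 $ 1 + r}" "a < b"
      obtain y z where "y \<in> {l<..<u}" "z \<in> {l<..<u}" "a = \<Psi> y" "b = \<Psi> z" using range ab by blast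
      then show "Q a < Q b" using mono Q ab(3) by simp
    qed
    show "(Q has_real_derivative Q' z) (at z) \<and> (Q' has_real_derivative 3 * \<epsilon> * Q z powr (-1/3)) (at z)"
      if z: "z \<in> {\<psi> x0 $ 1 - r<..<\<psi> x0 $ 1 + r}" for z
    proof -
      obtain y where y: "y \<in> {l<..<u}" "z = \<Psi> y" using range[OF z] by blast
      have Qz: "Q z = y" using Q y by simp
      have y0: "y > 0" using y lu by auto
      have 1: "(Q has_real_derivative Q' z) (at z)" using dQ[OF y(1)] by (simp add: Q'_def Qz y(2)[symmetric])
      have nz: "sqrt (C + 9 * \<epsilon> * y powr (2/3)) > 0" using pos[OF y(1)] by simp
      have "((\<lambda>y. C + 9 * \<epsilon> * y powr (2/3)) has_real_derivative 6 * \<epsilon> * y powr (-1/3)) (at y)"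
        using y0 by (auto intro!: derivative_eq_intros simp: powr_minus field_simps)
      from DERIV_chain2[OF DERIV_real_sqrt[OF pos[OF y(1)]] this]
      have "((\<lambda>y. sqrt (C + 9 * \<epsilon> * y powr (2/3))) has_real_derivative
        inverse (sqrt (C + 9 * \<epsilon> * y powr (2/3))) / 2 * (6 * \<epsilon> * y powr (-1/3))) (at (Q z))"
        unfolding Qz .
      \<comment> \<open>The factor \<open>Q' z\<close> from the chain rule cancels the square root
        in the denominator, leaving half of 6.\<close>
      from DERIV_chain2[OF this 1] have "(Q' has_real_derivative
        inverse (sqrt (C + 9 * \<epsilon> * y powr (2/3))) / 2 * (6 * \<epsilon> * y powr (-1/3)) * Q' z) (at z)"
        unfolding Q'_def[abs_def] .
      then have "(Q' has_real_derivative 3 * \<epsilon> * Q z powr (-1/3)) (at z)"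
        using nz by (simp add: Q'_def Qz field_simps)
      then show ?thesis using 1 by blast
    qed
    show "ip (G x) a b = frechet_derivative \<psi> (at x) a $ 1 * frechet_derivative \<psi> (at x) b $ 1
      + (Q' (\<psi> x $ 1))\<^sup>2 * frechet_derivative \<psi> (at x) a $ 2 * frechet_derivative \<psi> (at x) b $ 2" if x: "x \<in> W" for x a b
    proof -
      have xB: "x \<in> B" and xS: "x \<in> S" using x W(3) B(1) by auto
      have f: "grad_sq x > 0" by (rule fp[OF xB])
      have sq: "sqrt (grad_sq x) * sqrt (grad_sq x) = grad_sq x" using f by simp
      have g: "G x $ i $ j = (pd i q x * pd j q x + conj_form i x * conj_form j x) / grad_sq x" for i j
        using metric_eq_forms[OF xS, of i j] f by (simp add: field_simps)
      have "(pd 1 q x / sqrt (grad_sq x) * a$1 + pd 2 q x / sqrt (grad_sq x) * a$2) * (pd 1 q x / sqrt (grad_sq x) * b$1 + pd 2 q x / sqrt (grad_sq x) * b$2)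
        = (pd 1 q x * a$1 + pd 2 q x * a$2) * (pd 1 q x * b$1 + pd 2 q x * b$2) / (sqrt (grad_sq x) * sqrt (grad_sq x))"
        by (simp add: add_divide_distrib[symmetric])
      moreover have "grad_sq x * (\<nu> 1 x * a$1 + \<nu> 2 x * a$2) * (\<nu> 1 x * b$1 + \<nu> 2 x * b$2)
        = (conj_form 1 x * a$1 + conj_form 2 x * a$2) * (conj_form 1 x * b$1 + conj_form 2 x * b$2) / grad_sq x"
        using f by (simp add: \<nu>_def field_simps)
      ultimately show ?thesis
        unfolding Qx(2)[OF x] fr[OF x] ip_2 g sq by (simp add: sq add_divide_distrib algebra_simps)
    qed
    show "frechet_derivative \<psi> (at x) (rot_grad x) = vector [0, 1]" if x: "x \<in> W" for x
    proof -
      have xB: "x \<in> B" and xS: "x \<in> S" using x W(3) B(1) by auto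
      \<comment> \<open>The form \<open>\<nu>\<close> is dual to the Killing field divided by its
        squared length, so it takes the value 1 on that field; the other component vanishes because
        \<open>dq\<close> annihilates \<open>J \<nabla>q\<close>.\<close>
      have "\<nu> 1 x * rot_grad x $ 1 + \<nu> 2 x * rot_grad x $ 2 = rr x * (pd 1 q x * conj_form 2 x - pd 2 q x * conj_form 1 x) / grad_sq x"
        by (simp add: \<nu>_def rot_grad_def diff_divide_distrib algebra_simps)
      also have "\<dots> = 1" unfolding grad_sq_conj_form[OF xS, symmetric] using fp[OF xB] by simp
      finally show ?thesis
        unfolding fr[OF x] by (simp add: vec_eq_iff forall_2) (simp add: rot_grad_def)
    qed
  qed
qed

end

subsection \<open>Charts of surfaces\<close>

lemma chart_inj: "is_chart M c \<Longrightarrow> inj_on (snd c) (fst c)"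
  using homeomorphic_imp_injective_map[of "subtopology M (fst c)"] openin_subset[of M "fst c"]
  by (auto simp: is_chart_def Int_absorb1)

lemma chart_inv_left: "is_chart M c \<Longrightarrow> p \<in> fst c \<Longrightarrow> chart_inv c (snd c p) = p"
  unfolding chart_inv_def by (rule inv_into_f_f[OF chart_inj])

lemma chart_image_open:
  assumes "is_chart M c" "openin M U"
  shows "open (snd c ` (fst c \<inter> U))"
proof -
  have "openin (subtopology M (fst c)) (fst c \<inter> U)"
    using assms(2) by (auto simp: openin_subtopology)
  then have "openin (top_of_set (snd c ` fst c)) (snd c ` (fst c \<inter> U))"
    using assms(1) homeomorphic_imp_open_map unfolding is_chart_def open_map_def by blast
  then show ?thesis
    using assms(1) openin_open_eq by (auto simp: is_chart_def)
qed

lemma overlap_open: "is_chart M c \<Longrightarrow> is_chart M d \<Longrightarrow> open (overlap c d)"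
  unfolding overlap_def using chart_image_open is_chart_def by metis

lemma overlapE:
  assumes "is_chart M c" "x \<in> overlap c d"
  obtains p where "p \<in> fst c" "p \<in> fst d" "x = snd c p" "chart_inv c x = p" "transition c d x = snd d p"
  using assms chart_inv_left[OF assms(1)] by (auto simp: overlap_def transition_def)

lemma jacobian_mult:
  fixes f :: "real^'n \<Rightarrow> real^'m"
  assumes "f differentiable (at x)" shows "jacobian f (at x) *v u = frechet_derivative f (at x) u"
  using fun_cong[OF frechet_derivative_at[OF iffD1[OF jacobian_works assms]], of u] .

lemma ball_first_coordinate:
  fixes a :: "real^2" shows "(\<lambda>y. y $ 1) ` ball a r = {a $ 1 - r<..<a $ 1 + r}"
proof (intro set_eqI iffI)
  fix s assume "s \<in> (\<lambda>y. y $ 1) ` ball a r"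
  then obtain y where "s = y $ 1" "dist a y < r" by auto
  then show "s \<in> {a $ 1 - r<..<a $ 1 + r}"
    using dist_vec_nth_le[of a 1 y] by (auto simp: dist_real_def)
next
  fix s assume s: "s \<in> {a $ 1 - r<..<a $ 1 + r}"
  have "dist a (a + (s - a $ 1) *\<^sub>R axis 1 1) < r" using s by (auto simp: dist_norm norm_axis_1)
  then show "s \<in> (\<lambda>y. y $ 1) ` ball a r"
    by (intro image_eqI[of _ _ "a + (s - a $ 1) *\<^sub>R axis 1 1"]) (auto simp: axis_def)
qed

definition sub_chart :: "'a chart \<Rightarrow> (real^2) set \<Rightarrow> (real^2 \<Rightarrow> real^2) \<Rightarrow> 'a chart" where
  "sub_chart c W \<psi> = ({p \<in> fst c. snd c p \<in> W}, \<psi> \<circ> snd c)"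

lemma sub_chart_image: "W \<subseteq> snd c ` fst c \<Longrightarrow> snd (sub_chart c W \<psi>) ` fst (sub_chart c W \<psi>) = \<psi> ` W"
  by (auto simp: sub_chart_def image_iff)

lemma is_chart_sub_chart:
  assumes c: "is_chart M c" and W: "open W" "W \<subseteq> snd c ` fst c" and R: "open R" and hom: "homeomorphism W R \<psi> h"
  shows "is_chart M (sub_chart c W \<psi>)"
proof -
  let ?d = "sub_chart c W \<psi>"
  have sub: "fst c \<subseteq> topspace M" "openin M (fst c)"
    using c openin_subset by (auto simp: is_chart_def)
  have hc: "homeomorphic_map (subtopology M (fst c)) (top_of_set (snd c ` fst c)) (snd c)"
    using c by (simp add: is_chart_def)
  have "openin (top_of_set (snd c ` fst c)) W" using W by (simp add: openin_open_eq open_subset)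
  from openin_continuous_map_preimage[OF homeomorphic_imp_continuous_map[OF hc] this]
  have "openin (subtopology M (fst c)) (fst ?d)"
    using sub by (simp add: sub_chart_def Int_absorb1)
  then have 1: "openin M (fst ?d)" using sub(2) openin_trans_full by blast
  have im: "snd c ` fst ?d = W" using W(2) by (auto simp: sub_chart_def)
  have "homeomorphic_map (subtopology (subtopology M (fst c)) (fst ?d)) (subtopology (top_of_set (snd c ` fst c)) W) (snd c)"
    by (rule homeomorphic_map_subtopologies[OF hc]) (use W sub in \<open>auto simp: sub_chart_def\<close>)
  moreover have "fst c \<inter> fst ?d = fst ?d" "snd c ` fst c \<inter> W = W" using W(2) by (auto simp: sub_chart_def)
  ultimately have "homeomorphic_map (subtopology M (fst ?d)) (top_of_set W) (snd c)"
    by (simp add: subtopology_subtopology)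
  moreover have "homeomorphic_map (top_of_set W) (top_of_set R) \<psi>"
    unfolding homeomorphic_map_maps homeomorphic_maps_def
    using hom by (intro exI[of _ h]) (auto simp: homeomorphism_def continuous_map_in_subtopology)
  ultimately have "homeomorphic_map (subtopology M (fst ?d)) (top_of_set R) (\<psi> \<circ> snd c)"
    by (rule homeomorphic_map_compose)
  moreover have "snd ?d ` fst ?d = R"
    unfolding sub_chart_image[OF W(2)] using hom by (simp add: homeomorphism_def)
  ultimately show ?thesis using 1 R unfolding is_chart_def by (simp add: sub_chart_def)
qed

lemma transition_sub_chart:
  assumes a: "is_chart M a" and x: "x \<in> overlap a (sub_chart c W \<psi>)"
  shows "transition a (sub_chart c W \<psi>) x = \<psi> (transition a c x)" "transition a c x \<in> W" "x \<in> overlap a c"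
proof -
  obtain p where "p \<in> fst a" "p \<in> fst (sub_chart c W \<psi>)" "x = snd a p" "chart_inv a x = p"
    using overlapE[OF a x] by metis
  then show "transition a (sub_chart c W \<psi>) x = \<psi> (transition a c x)" "transition a c x \<in> W" "x \<in> overlap a c"
    by (auto simp: sub_chart_def transition_def overlap_def)
qed

text \<open>Transition maps into the new chart compose with \<open>\<psi>\<close>, those out of it
  with \<open>h\<close>; this is why both are asked to be smooth.\<close>

lemma smooth_chart_sub_chart:
  assumes surf: "oriented_surface M A" and cA: "c \<in> A" and W: "open W" "W \<subseteq> snd c ` fst c" and R: "open R"
    and hom: "homeomorphism W R \<psi> h" and sm: "smooth_on W \<psi>" "smooth_on R h"
  shows "smooth_chart M A (sub_chart c W \<psi>)"
proof -
  let ?d = "sub_chart c W \<psi>"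
  have chA: "is_chart M a" if "a \<in> A" for a using surf that by (simp add: oriented_surface_def)
  have smA: "smooth_on (overlap a b) (transition a b)" if "a \<in> A" "b \<in> A" for a b
    using surf that by (simp add: oriented_surface_def)
  note chd = is_chart_sub_chart[OF chA[OF cA] W R hom]
  have "smooth_on (overlap a ?d) (transition a ?d) \<and> smooth_on (overlap ?d a) (transition ?d a)" if a: "a \<in> A" for a
  proof
    note t = transition_sub_chart[OF chA[OF a], of _ c W \<psi>]
    note o = overlap_open[OF chA[OF a] chd] overlap_open[OF chd chA[OF a]] overlap_open[OF chA[OF cA] chA[OF a]]
    have "smooth_on (overlap a ?d) (\<lambda>x. \<psi> (transition a c x))"
    proof (rule smooth_on_compose[OF o(1) W(1) sm(1)])
      show "smooth_on (overlap a ?d) (transition a c)"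
        by (rule smooth_on_subset[OF smA[OF a cA]]) (use t(3) in blast)
    qed (rule t(2))
    then show "smooth_on (overlap a ?d) (transition a ?d)"
      by (rule smooth_on_cong[OF o(1)]) (simp add: t)
    have y: "y \<in> R" "h y \<in> overlap c a" "transition ?d a y = transition c a (h y)" if y: "y \<in> overlap ?d a" for y
    proof -
      obtain p where p: "p \<in> fst ?d" "p \<in> fst a" "y = snd ?d p" "transition ?d a y = snd a p"
        using overlapE[OF chd y] by metis
      then have pc: "p \<in> fst c" "snd c p \<in> W" and yp: "y = \<psi> (snd c p)" by (auto simp: sub_chart_def)
      then have h: "h y = snd c p" "y \<in> R" using hom by (auto simp: homeomorphism_def)
      then show "y \<in> R" "h y \<in> overlap c a" using pc p(2) by (auto simp: overlap_def)
      show "transition ?d a y = transition c a (h y)"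
        using p(4) h(1) chart_inv_left[OF chA[OF cA] pc(1)] by (simp add: transition_def)
    qed
    have "smooth_on (overlap ?d a) (\<lambda>y. transition c a (h y))"
    proof (rule smooth_on_compose[OF o(2,3) smA[OF cA a]])
      show "smooth_on (overlap ?d a) h" by (rule smooth_on_subset[OF sm(2)]) (use y(1) in blast)
    qed (rule y(2))
    then show "smooth_on (overlap ?d a) (transition ?d a)"
      by (rule smooth_on_cong[OF o(2)]) (simp add: y)
  qed
  then show ?thesis using chd by (simp add: smooth_chart_def)
qed

lemma jacobian_sub_chart:
  assumes surf: "oriented_surface M A" and A: "a \<in> A" "c \<in> A" and W: "open W" "W \<subseteq> snd c ` fst c" and R: "open R"
    and hom: "homeomorphism W R \<psi> h" and sm: "smooth_on W \<psi>" and x: "x \<in> overlap a (sub_chart c W \<psi>)"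
  shows "jacobian (transition a (sub_chart c W \<psi>)) (at x) *v u =
    frechet_derivative \<psi> (at (transition a c x)) (jacobian (transition a c) (at x) *v u)"
proof -
  let ?d = "sub_chart c W \<psi>"
  have chA: "is_chart M b" if "b \<in> A" for b using surf that by (simp add: oriented_surface_def)
  have smA: "smooth_on (overlap a c) (transition a c)" using surf A by (simp add: oriented_surface_def)
  have od: "open (overlap a ?d)" by (rule overlap_open[OF chA[OF A(1)] is_chart_sub_chart[OF chA[OF A(2)] W R hom]])
  note t = transition_sub_chart[OF chA[OF A(1)], of _ c W \<psi>]
  have 1: "(transition a c has_derivative frechet_derivative (transition a c) (at x)) (at x)"
    by (rule smooth_on_has_derivative[OF smA t(3)[OF x]])
  have "((\<lambda>x. \<psi> (transition a c x)) has_derivative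
     (\<lambda>u. frechet_derivative \<psi> (at (transition a c x)) (frechet_derivative (transition a c) (at x) u))) (at x)"
    using has_derivative_compose[OF 1 smooth_on_has_derivative[OF sm t(2)[OF x]]] by simp
  then have D: "(transition a ?d has_derivative
     (\<lambda>u. frechet_derivative \<psi> (at (transition a c x)) (frechet_derivative (transition a c) (at x) u))) (at x)"
    by (rule has_derivative_transform_within_open[OF _ od x]) (simp add: t(1))
  have "jacobian (transition a ?d) (at x) *v u = frechet_derivative (transition a ?d) (at x) u"
    by (rule jacobian_mult[OF differentiableI[OF D]])
  also have "\<dots> = frechet_derivative \<psi> (at (transition a c x)) (frechet_derivative (transition a c) (at x) u)"
    using fun_cong[OF frechet_derivative_at[OF D], of u] by simp
  finally show ?thesis using jacobian_mult[OF differentiableI[OF 1]] by simp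
qed

lemma metric_components_matrix:
  assumes "\<forall>u v. ip M u v = ip N (P *v u) (P *v v)"
  shows "M $ i $ j = (\<Sum>k\<in>UNIV. \<Sum>l\<in>UNIV. N $ k $ l * P $ k $ i * P $ l $ j)"
proof -
  have "M $ i $ j = ip M (axis i 1) (axis j 1)"
    using exhaust_2[of i] exhaust_2[of j] by (auto simp: ip_2 axis_def)
  also have "\<dots> = ip N (P *v axis i 1) (P *v axis j 1)" using assms by blast
  also have "\<dots> = (\<Sum>k\<in>UNIV. \<Sum>l\<in>UNIV. N $ k $ l * P $ k $ i * P $ l $ j)"
    by (simp add: ip_2 sum_2 matrix_vector_mul_component inner_axis row_def)
  finally show ?thesis .
qed

section \<open>The complex structure and the concircular equation in a chart\<close>

context riemannian_chart
begin

text \<open>An isometry with square -1 is skew, which fixes it up to scale; the square fixes the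
  scale up to sign, and the orientation fixes the sign.\<close>

lemma complex_structure_components:
  fixes J :: "real^2^2"
  assumes x: "x \<in> S" and J: "J ** J = - mat 1" "\<And>u v. ip (G x) (J *v u) (J *v v) = ip (G x) u v"
    "\<And>u. u \<noteq> 0 \<Longrightarrow> det (vector [u, J *v u] :: real^2^2) > 0"
  shows "J $ 1 $ 1 = - G x $ 1 $ 2 / sqrt (det (G x))" "J $ 1 $ 2 = - G x $ 2 $ 2 / sqrt (det (G x))"
    "J $ 2 $ 1 = G x $ 1 $ 1 / sqrt (det (G x))" "J $ 2 $ 2 = G x $ 1 $ 2 / sqrt (det (G x))"
proof -
  define a b c d where "a = J $ 1 $ 1" "b = J $ 1 $ 2" "c = J $ 2 $ 1" "d = J $ 2 $ 2"
  note abcd = this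
  define e f h where "e = G x $ 1 $ 1" "f = G x $ 1 $ 2" "h = G x $ 2 $ 2"
  note efh = this
  define r where "r = sqrt (det (G x))"
  have r: "r > 0" "r * r = e * h - f * f"
    using det_G_pos[OF x] by (simp_all add: r_def efh det_G[OF x] power2_eq_square)
  have e: "e > 0" using G_11_pos[OF x] by (simp add: efh)
  have JJ: "J *v (J *v v) = - v" for v
  proof -
    have "J *v (J *v v) = (- mat 1 :: real^2^2) *v v" by (simp only: matrix_vector_mul_assoc J(1))
    also have "\<dots> = - v" by (simp add: vec_eq_iff forall_2 matrix_vector_mult_def sum_2 mat_def)
    finally show ?thesis .
  qed
  have sk: "ip (G x) (J *v u) w = - ip (G x) u (J *v w)" for u w
  proof -
    have "ip (G x) (J *v u) (J *v (J *v w)) = ip (G x) u (J *v w)" by (rule J(2))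
    then show ?thesis unfolding JJ by (simp add: ip_2)
  qed
  have mv: "(J *v v) $ 1 = a * v$1 + b * v$2" "(J *v v) $ 2 = c * v$1 + d * v$2" for v
    by (simp_all add: matrix_vector_mult_def sum_2 abcd)
  have s1: "e * a + f * c = 0" and s2: "f * b + h * d = 0" and s3: "f * a + h * c + e * b + f * d = 0"
    using sk[of "axis 1 1" "axis 1 1"] sk[of "axis 2 1" "axis 2 1"] sk[of "axis 1 1" "axis 2 1"]
    by (simp_all add: ip_2 mv axis_def efh[symmetric] G_21[OF x] algebra_simps)
  have "det (vector [axis 1 1, J *v axis 1 1] :: real^2^2) > 0" by (rule J(3)) (simp add: axis_eq_0_iff)
  then have c: "c > 0" by (simp add: det_2 mv axis_def)
  have j: "a * a + b * c = - 1" "c * a + d * c = 0"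
    using arg_cong[OF J(1), of "\<lambda>M. M $ 1 $ 1"] arg_cong[OF J(1), of "\<lambda>M. M $ 2 $ 1"]
    by (simp_all add: matrix_matrix_mult_def sum_2 mat_def abcd)
  have "c * (a + d) = 0" using j(2) by (simp add: algebra_simps)
  then have d: "d = - a" using c by simp
  have eb: "e * b = - (h * c)" using s3 d by (simp add: algebra_simps)
  \<comment> \<open>Skewness expresses \<open>e * a\<close> and \<open>e * b\<close> through
    \<open>c\<close>, so the equation for the square of \<open>J\<close> determines \<open>c\<close>
    up to sign; orientation has given \<open>c > 0\<close>.\<close>
  have "(c * r) * (c * r) = c * c * (r * r)" by simp
  also have "\<dots> = e * e"
  proof -
    have "(e * a) * (e * a) + (e * b) * (e * c) = - (e * e)" using j(1) by algebra
    moreover have "e * a = - (f * c)" using s1 by simp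
    ultimately have "(f * c) * (f * c) - (h * c) * (e * c) = - (e * e)" using eb by simp
    then show ?thesis unfolding r(2) by (simp add: algebra_simps)
  qed
  finally have "(c * r)\<^sup>2 = e\<^sup>2" by (simp add: power2_eq_square)
  then have cr: "c * r = e" using c r(1) e by (simp add: power2_eq_iff_nonneg)
  have "e * (a * r) = e * (- f)" "e * (b * r) = e * (- h)"
  proof -
    have "e * (a * r) = - (f * (c * r))" using s1 by algebra
    then show "e * (a * r) = e * (- f)" by (simp add: cr)
    have "e * (b * r) = - (h * (c * r))" using eb by algebra
    then show "e * (b * r) = e * (- h)" by (simp add: cr)
  qed
  then have "a * r = - f" "b * r = - h" using e by (simp_all only: mult_cancel_left) auto
  then have "a = - f / r" "b = - h / r" "c = e / r" "d = f / r"
    using r(1) cr d by (simp_all add: field_simps)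
  then show "J $ 1 $ 1 = - G x $ 1 $ 2 / sqrt (det (G x))" "J $ 1 $ 2 = - G x $ 2 $ 2 / sqrt (det (G x))"
    "J $ 2 $ 1 = G x $ 1 $ 1 / sqrt (det (G x))" "J $ 2 $ 2 = G x $ 1 $ 2 / sqrt (det (G x))"
    by (simp_all add: abcd efh r_def)
qed

text \<open>Here \<open>\<kappa> = \<kappa>\<^sub>0 * exp (2 * l)\<close> with a constant
  \<open>\<kappa>\<^sub>0\<close> whose square is \<open>- \<epsilon>\<close>: 1 in the hyperbolic
  and \<open>\<i>\<close> in the elliptic case. The Hessian of \<open>exp (- 3 * l)\<close> is that
  function times \<open>9 dl \<otimes> dl\<close> minus 3 times the Hessian of \<open>l\<close>,
  where the terms in \<open>dl \<otimes> dl\<close> cancel.\<close>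

lemma concircular_of_frobenius:
  fixes \<kappa> :: "real^2 \<Rightarrow> 'k::real_normed_field"
  assumes cf: "contains_frobenius frame_bundle (thetas G) (singular_system G \<kappa>)"
    and \<epsilon>: "\<epsilon> = 1 \<or> \<epsilon> = -1" and K: "\<And>x. x \<in> S \<Longrightarrow> \<epsilon> * gauss_formula G x > 0"
    and k: "\<And>x. x \<in> S \<Longrightarrow> \<kappa> x = \<kappa>\<^sub>0 * of_real (sqrt \<bar>gauss_formula G x\<bar>)" "\<kappa>\<^sub>0 * \<kappa>\<^sub>0 = - of_real \<epsilon>"
    and q: "\<And>x. x \<in> S \<Longrightarrow> q x = (\<epsilon> * gauss_formula G x) powr (-3/4)"
  shows "concircular_chart S G q \<epsilon>"
proof -
  define l where "l x = ln (\<epsilon> * gauss_formula G x) / 4" for x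
  have sm_l: "smooth_on S l"
    unfolding l_def by (intro smooth_on_divide smooth_on_ln smooth_on_mult smooth_gauss_formula open_S smooth_on_const K) auto
  have gK: "gauss_formula G x = \<epsilon> * exp (4 * l x)" if "x \<in> S" for x
    using K[OF that] \<epsilon> by (auto simp: l_def)
  have ql: "q x = exp (- 3 * l x)" if "x \<in> S" for x
    using K[OF that] by (auto simp: q[OF that] l_def powr_def zero_less_mult_iff)
  have "\<kappa> x = \<kappa>\<^sub>0 * of_real (exp (2 * l x))" if "x \<in> S" for x
  proof -
    have "\<bar>gauss_formula G x\<bar> = (exp (2 * l x))\<^sup>2"
      using \<epsilon> by (auto simp: gK[OF that] exp_double[symmetric] abs_mult)
    then show ?thesis by (simp add: k(1)[OF that])
  qed
  note kl = this
  have k0: "\<kappa>\<^sub>0 \<noteq> 0" using k(2) \<epsilon> by auto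
  have ksq: "\<kappa> x * \<kappa> x = - of_real (gauss_formula G x)" if "x \<in> S" for x
  proof -
    have "\<kappa> x * \<kappa> x = (\<kappa>\<^sub>0 * \<kappa>\<^sub>0) * of_real (exp (2 * l x) * exp (2 * l x))" by (simp add: kl[OF that])
    also have "exp (2 * l x) * exp (2 * l x) = exp (4 * l x)" by (simp add: exp_add[symmetric])
    finally show ?thesis by (simp add: k(2) gK[OF that])
  qed
  have kd: "(\<kappa> has_derivative (\<lambda>h. 2 * \<kappa> x * of_real (pd 1 l x * h $ 1 + pd 2 l x * h $ 2))) (at x)" if x: "x \<in> S" for x
  proof -
    have "((\<lambda>y. exp (2 * l y)) has_derivative (\<lambda>h. 2 * exp (2 * l x) * (pd 1 l x * h $ 1 + pd 2 l x * h $ 2))) (at x)"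
      by (rule has_derivative_eq_rhs, rule has_derivative_exp[OF has_derivative_mult_right[OF smooth_has_derivative_pd[OF sm_l x]]])
        (simp add: fun_eq_iff)
    from has_derivative_mult_right[OF has_derivative_of_real[OF this], of \<kappa>\<^sub>0]
    have "((\<lambda>y. \<kappa>\<^sub>0 * of_real (exp (2 * l y))) has_derivative (\<lambda>h. 2 * \<kappa> x * of_real (pd 1 l x * h $ 1 + pd 2 l x * h $ 2))) (at x)"
      by (simp add: kl[OF x] algebra_simps)
    then show ?thesis by (rule has_derivative_transform_within_open[OF _ open_S x]) (simp add: kl)
  qed
  have H: "pd i (pd j l) x = (\<Sum>m\<in>UNIV. christoffel G m i j x * pd m l x) + 3 * pd i l x * pd j l x
    - gauss_formula G x * G x $ i $ j" if "x \<in> S" for i j x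
    by (rule hessian_equation[OF cf sm_l _ ksq kd that]) (use kl k0 in auto)
  have sm_q: "smooth_on S q"
    by (rule smooth_on_cong[OF open_S, of "\<lambda>x. exp (- 3 * l x)"])
      (intro smooth_on_exp smooth_on_mult smooth_on_const sm_l open_S, simp add: ql)
  have pq: "pd j q x = - 3 * q x * pd j l x" if x: "x \<in> S" for j x
  proof -
    have "pd j q x = pd j (\<lambda>y. exp (- 3 * l y)) x" by (rule pd_cong[OF open_S x ql])
    also have "\<dots> = (- 3 * exp (- 3 * l x)) * pd j l x"
      by (rule pd_chain_real[OF smooth_on_differentiable[OF sm_l x], where \<phi> = "\<lambda>t. exp (- 3 * t)"])
        (auto intro!: derivative_eq_intros)
    finally show ?thesis by (simp add: ql[OF x])
  qed
  show ?thesis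
  proof unfold_locales
    show "smooth_on S q" by (rule sm_q)
    show "q x > 0" if "x \<in> S" for x by (simp add: ql[OF that])
    fix x i j assume x: "x \<in> S"
    have d: "q differentiable (at x)" "pd j l differentiable (at x)"
      by (rule smooth_on_differentiable[OF _ x], rule sm_q smooth_on_pd[OF sm_l])+
    have "pd i (pd j q) x = pd i (\<lambda>y. - 3 * (q y * pd j l y)) x"
      by (rule pd_cong[OF open_S x]) (simp add: pq)
    also have "\<dots> = - 3 * (q x * pd i (pd j l) x + pd i q x * pd j l x)"
      by (simp add: pd_minus pd_mult pd_const differentiable_mult d algebra_simps)
    also have "\<dots> = (\<Sum>m\<in>UNIV. christoffel G m i j x * pd m q x) + 3 * (q x * gauss_formula G x) * G x $ i $ j"
      unfolding H[OF x] by (simp add: pq[OF x] sum_2 algebra_simps)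
    \<comment> \<open>In terms of \<open>l\<close> this is
      \<open>exp (- 3 * l) * exp (4 * l) = exp l\<close>, up to the sign
      \<open>\<epsilon>\<close>.\<close>
    also have "q x * gauss_formula G x = \<epsilon> * q x powr (-1/3)"
    proof -
      have "q x powr (-1/3) = exp (l x)" by (simp add: ql[OF x] powr_def)
      moreover have "exp (- 3 * l x) * exp (4 * l x) = exp (l x)" by (simp add: exp_add[symmetric])
      ultimately show ?thesis by (simp add: gK[OF x] ql[OF x] mult.left_commute)
    qed
    finally show "pd i (pd j q) x = (\<Sum>m\<in>UNIV. christoffel G m i j x * pd m q x) + 3 * \<epsilon> * q x powr (-1/3) * G x $ i $ j"
      by (simp add: mult.assoc)
  qed
qed

end

section \<open>From charts to the surface\<close>

theorem theorem6:
  fixes M :: "'a topology" and A :: "'a chart set" and g :: "'a metric"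
    and K q :: "'a \<Rightarrow> real" and \<epsilon> :: real
    and J :: "'a chart \<Rightarrow> real^2 \<Rightarrow> real^2^2" and V :: "'a vfield"
  assumes surface: "oriented_surface M A" "connected_space M"
    and metric: "riemannian_metric A g"
    and curvature: "is_gauss_curvature A g K"
    and sign: "\<epsilon> = 1 \<and> (\<forall>p\<in>topspace M. K p > 0) \<or> \<epsilon> = -1 \<and> (\<forall>p\<in>topspace M. K p < 0)"
    and darboux: "darboux_integrable M A g K"
    and q: "q = (\<lambda>p. (\<epsilon> * K p) powr (-3/4))"
    and J: "compatible_complex_structure A g J"
    and V: "V = (\<lambda>c x. J c x *v grad g q c x)"
  shows "killing_field A g V \<and>
    (\<forall>c\<in>A. \<forall>p\<in>fst c. V c (snd c p) \<noteq> 0 \<longrightarrow>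
      (\<exists>d a b Q Q'.
         smooth_chart M A d \<and> p \<in> fst d \<and>
         a < b \<and> (\<lambda>y. y $ 1) ` snd d ` fst d = {a<..<b} \<and>
         (\<forall>p'\<in>fst d. q p' = Q (snd d p' $ 1)) \<and>
         (strict_mono_on {a<..<b} Q \<or> strict_antimono_on {a<..<b} Q) \<and>
         (\<forall>s\<in>{a<..<b}. (Q has_real_derivative Q' s) (at s) \<and>
                        (Q' has_real_derivative 3 * \<epsilon> * Q s powr (-1/3)) (at s)) \<and>
         metric_components A g d (\<lambda>y. vector [vector [1, 0], vector [0, (Q' (y $ 1))\<^sup>2]]) \<and>
         vfield_components A V d (\<lambda>y. vector [0, 1])))"
proof -
  define S where "S c = snd c ` fst c" for c :: "'a chart"
  define qc where "qc c = q \<circ> chart_inv c" for c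
  have chart: "is_chart M c" if "c \<in> A" for c
    using surface(1) that by (simp add: oriented_surface_def)
  have smT: "smooth_on (overlap c d) (transition c d)" "\<And>x. x \<in> overlap c d \<Longrightarrow> det (jacobian (transition c d) (at x)) > 0"
    if "c \<in> A" "d \<in> A" for c d
    using surface(1) that by (auto simp: oriented_surface_def)
  have inS: "chart_inv c x \<in> fst c" "snd c (chart_inv c x) = x" if "c \<in> A" "x \<in> S c" for c x
    using that(2) chart_inv_left[OF chart[OF that(1)]] by (auto simp: S_def)
  have rc: "riemannian_chart (S c) (g c)" if "c \<in> A" for c
    using that metric chart[OF that] by unfold_locales (auto simp: riemannian_metric_def S_def is_chart_def)
  have gM: "metric_components A g c (g c)" if "c \<in> A" for c
    using metric that by (simp add: riemannian_metric_def)
  have Kc: "K (chart_inv c x) = gauss_formula (g c) x" if "c \<in> A" "x \<in> S c" for c x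
    using curvature that inS[OF that] by (auto simp: is_gauss_curvature_def)
  have top: "fst c \<subseteq> topspace M" if "c \<in> A" for c
    using chart[OF that] openin_subset by (auto simp: is_chart_def)
  have eps: "\<epsilon> = 1 \<or> \<epsilon> = -1" using sign by blast
  have Kpos: "\<epsilon> * gauss_formula (g c) x > 0" if "c \<in> A" "x \<in> S c" for c x
  proof -
    have "chart_inv c x \<in> topspace M" using top[OF that(1)] inS(1)[OF that] by blast
    then show ?thesis using sign Kc[OF that] by auto
  qed
  have con: "concircular_chart (S c) (g c) (qc c) \<epsilon>" if c: "c \<in> A" for c
  proof -
    interpret riemannian_chart "S c" "g c" by (rule rc[OF c])
    have fb: "frame_product g c = frame_bundle"
      by (simp only: frame_product_def frame_bundle_def frames_on_def orthonormal_frames_def S_def[symmetric])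
    have qv: "qc c x = (\<epsilon> * gauss_formula (g c) x) powr (-3/4)" if "x \<in> S c" for x
      by (simp add: qc_def q Kc[OF c that])
    show ?thesis
    \<comment> \<open>On the empty surface the sign \<open>\<epsilon>\<close> need not match the
      disjunct of \<open>darboux\<close> that holds, but the conditions on a chart are vacuous. A
      point of \<open>M\<close> makes the two agree.\<close>
    proof (cases "topspace M = {}")
      case True
      then have "S c = {}" using top[OF c] by (simp add: S_def)
      then show ?thesis by unfold_locales (use smooth_on_cong[of "{}" "\<lambda>x. 0" "qc c"] in auto)
    next
      case False
      then obtain p0 where p0: "p0 \<in> topspace M" by blast
      from darboux[unfolded darboux_integrable_def] show ?thesis
      proof
        assume d: "(\<forall>p\<in>topspace M. K p < 0) \<and> darboux_along A g (\<lambda>p. sqrt \<bar>K p\<bar>) \<and> darboux_along A g (\<lambda>p. - sqrt \<bar>K p\<bar>)"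
        then have e: "\<epsilon> = - 1" using sign p0 by force
        have "contains_frobenius frame_bundle (thetas (g c)) (singular_system (g c) ((\<lambda>p. sqrt \<bar>K p\<bar>) \<circ> chart_inv c))"
          using d c fb unfolding darboux_along_def by auto
        then show ?thesis
          by (rule concircular_of_frobenius[where \<kappa>\<^sub>0 = 1]) (use eps Kpos[OF c] Kc[OF c] qv e in auto)
      next
        assume d: "(\<forall>p\<in>topspace M. K p > 0) \<and> darboux_along A g (\<lambda>p. \<i> * complex_of_real (sqrt \<bar>K p\<bar>)) \<and>
          darboux_along A g (\<lambda>p. - \<i> * complex_of_real (sqrt \<bar>K p\<bar>))"
        then have e: "\<epsilon> = 1" using sign p0 by force
        have "contains_frobenius frame_bundle (thetas (g c)) (singular_system (g c) ((\<lambda>p. \<i> * complex_of_real (sqrt \<bar>K p\<bar>)) \<circ> chart_inv c))"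
          using d c fb unfolding darboux_along_def by auto
        then show ?thesis
          by (rule concircular_of_frobenius[where \<kappa>\<^sub>0 = \<i>]) (use eps Kpos[OF c] Kc[OF c] qv e in auto)
      qed
    qed
  qed
  have Vrot: "V c x = concircular_chart.rot_grad (g c) (qc c) x" if c: "c \<in> A" and x: "x \<in> S c" for c x
  proof -
    interpret concircular_chart "S c" "g c" "qc c" \<epsilon> by (rule con[OF c])
    have J': "J c x ** J c x = - mat 1" "\<And>u v. ip (g c x) (J c x *v u) (J c x *v v) = ip (g c x) u v"
      "\<And>u. u \<noteq> 0 \<Longrightarrow> det (vector [u, J c x *v u] :: real^2^2) > 0"
      using J c x by (auto simp: compatible_complex_structure_def S_def)
    note Jc = complex_structure_components[OF x J']
    have r: "1 / sqrt (det (g c x)) = rr x" "1 / det (g c x) = rr x * rr x"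
      using det_G_pos[OF x] by (simp_all add: rr_def)
    have div: "t / sqrt (det (g c x)) = t * rr x" "t / det (g c x) = t * (rr x * rr x)" for t
      using r by (metis times_divide_eq_right mult.right_neutral)+
    let ?D = "g c x $ 1 $ 1 * g c x $ 2 $ 2 - g c x $ 1 $ 2 * g c x $ 1 $ 2"
    \<comment> \<open>Both \<open>J\<close> and the inverse metric are given by entries of the
      metric; in their product these collapse to the determinant \<open>?D\<close>, which
      \<open>rr_sq\<close> normalises away.\<close>
    have "V c x $ 1 = - (rr x * rr x * ?D) * (rr x * pd 2 (qc c) x)" "V c x $ 2 = (rr x * rr x * ?D) * (rr x * pd 1 (qc c) x)"
      unfolding V grad_def qc_def[symmetric]
      by (simp_all add: matrix_vector_mult_def sum_2 Jc matrix_inv_G[OF x] div algebra_simps)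
    then show ?thesis unfolding rr_sq[OF x] by (simp add: rot_grad_def vec_eq_iff forall_2)
  qed
  have smV: "smooth_on (S c) (V c)" if c: "c \<in> A" for c
  proof -
    interpret concircular_chart "S c" "g c" "qc c" \<epsilon> by (rule con[OF c])
    show ?thesis by (rule smooth_on_cong[OF open_S smooth_rot_grad]) (simp add: Vrot[OF c])
  qed
  have trans: "transition c d x \<in> S d" "x \<in> S c" if "c \<in> A" "x \<in> overlap c d" for c d x
    using overlapE[OF chart[OF that(1)] that(2)] by (auto simp: S_def)
  have Vcomp: "vfield_components A V d (V d)" if d: "d \<in> A" for d
    unfolding vfield_components_def
  proof (intro ballI)
    fix c x assume c: "c \<in> A" and x: "x \<in> overlap c d"
    interpret C: concircular_chart "S c" "g c" "qc c" \<epsilon> by (rule con[OF c])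
    interpret D: concircular_chart "S d" "g d" "qc d" \<epsilon> by (rule con[OF d])
    let ?T = "transition c d"
    define P where "P = jacobian ?T (at x)"
    note xS = trans(2)[OF c x] and TS = trans(1)[OF c x]
    have T: "(?T has_derivative frechet_derivative ?T (at x)) (at x)"
      by (rule smooth_on_has_derivative[OF smT(1)[OF c d] x])
    then have T': "(?T has_derivative (\<lambda>h. P *v h)) (at x)"
      unfolding P_def by (simp add: jacobian_works[symmetric] differentiableI)
    have detP: "det P > 0" using smT(2)[OF c d x] by (simp add: P_def)
    have "((\<lambda>y. qc d (?T y)) has_derivative (\<lambda>h. pd 1 (qc d) (?T x) * (P *v h) $ 1 + pd 2 (qc d) (?T x) * (P *v h) $ 2)) (at x)"
      using has_derivative_compose[OF T' smooth_has_derivative_pd[OF D.smooth_q TS]] .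
    moreover have "qc d (?T y) = qc c y" if "y \<in> overlap c d" for y
      using overlapE[OF chart[OF c] that] chart_inv_left[OF chart[OF d]] by (metis comp_apply qc_def)
    ultimately have dq: "(qc c has_derivative (\<lambda>h. pd 1 (qc d) (?T x) * (P *v h) $ 1 + pd 2 (qc d) (?T x) * (P *v h) $ 2)) (at x)"
      using has_derivative_transform_within_open[OF _ overlap_open[OF chart[OF c] chart[OF d]] x] by blast
    have pq: "pd i (qc c) x = pd 1 (qc d) (?T x) * P $ 1 $ i + pd 2 (qc d) (?T x) * P $ 2 $ i" for i
      using pd_eqI[OF dq, of i] by (simp add: matrix_vector_mul_component inner_axis row_def)
    have "\<forall>u v. ip (g c x) u v = ip (g d (?T x)) (P *v u) (P *v v)"
      using gM[OF d] c x unfolding metric_components_def P_def by blast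
    note gP = metric_components_matrix[OF this]
    have "det (g c x) = (det P)\<^sup>2 * det (g d (?T x))"
      unfolding det_2 gP sum_2 by (simp add: power2_eq_square algebra_simps)
    \<comment> \<open>The determinant is the square of \<open>det P\<close> times the other one;
      taking the root without an absolute value uses that transition maps preserve
      orientation.\<close>
    then have rr: "C.rr x * det P = D.rr (?T x)"
      using detP D.det_G_pos[OF TS] by (simp add: C.rr_def D.rr_def real_sqrt_mult)
    have "(P *v C.rot_grad x) $ 1 = - (C.rr x * det P * pd 2 (qc d) (?T x))"
      "(P *v C.rot_grad x) $ 2 = C.rr x * det P * pd 1 (qc d) (?T x)"
      by (simp_all add: C.rot_grad_def matrix_vector_mult_def sum_2 pq det_2 algebra_simps)
    then show "jacobian ?T (at x) *v V c x = V d (?T x)"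
      unfolding Vrot[OF c xS] Vrot[OF d TS] P_def[symmetric] rr by (simp add: D.rot_grad_def vec_eq_iff forall_2)
  qed
  have "killing_field A g V"
    unfolding killing_field_def smooth_vfield_def
  proof (intro conjI ballI allI)
    fix c assume c: "c \<in> A"
    show "smooth_on (snd c ` fst c) (V c)" using smV[OF c] by (simp add: S_def)
    show "vfield_components A V c (V c)" by (rule Vcomp[OF c])
    fix x and i j :: 2 assume "x \<in> snd c ` fst c"
    then have x: "x \<in> S c" by (simp add: S_def)
    interpret concircular_chart "S c" "g c" "qc c" \<epsilon> by (rule con[OF c])
    have "pd a (\<lambda>y. V c y $ b) x = pd a (\<lambda>y. rot_grad y $ b) x" for a b
      by (rule pd_cong[OF open_S x]) (simp add: Vrot[OF c])
    then have "lie_metric (g c) (V c) i j x = lie_metric (g c) rot_grad i j x"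
      unfolding lie_metric_def Vrot[OF c x] by simp
    then show "lie_metric (g c) (V c) i j x = 0" using rot_grad_killing[OF x] by simp
  qed
  moreover have "\<exists>d a b Q Q'.
         smooth_chart M A d \<and> p \<in> fst d \<and>
         a < b \<and> (\<lambda>y. y $ 1) ` snd d ` fst d = {a<..<b} \<and>
         (\<forall>p'\<in>fst d. q p' = Q (snd d p' $ 1)) \<and>
         (strict_mono_on {a<..<b} Q \<or> strict_antimono_on {a<..<b} Q) \<and>
         (\<forall>s\<in>{a<..<b}. (Q has_real_derivative Q' s) (at s) \<and>
                        (Q' has_real_derivative 3 * \<epsilon> * Q s powr (-1/3)) (at s)) \<and>
         metric_components A g d (\<lambda>y. vector [vector [1, 0], vector [0, (Q' (y $ 1))\<^sup>2]]) \<and>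
         vfield_components A V d (\<lambda>y. vector [0, 1])"
    if c: "c \<in> A" and p: "p \<in> fst c" and nz: "V c (snd c p) \<noteq> 0" for c p
  proof -
    interpret concircular_chart "S c" "g c" "qc c" \<epsilon> by (rule con[OF c])
    have x0: "snd c p \<in> S c" using p by (simp add: S_def)
    have "rot_grad (snd c p) \<noteq> 0" using nz Vrot[OF c x0] by simp
    from local_coordinates[OF x0 this]
    obtain \<psi> h :: "real^2 \<Rightarrow> real^2" and W r Q Q' where W: "open W" "snd c p \<in> W" "W \<subseteq> S c" "r > 0"
      and hom: "homeomorphism W (ball (\<psi> (snd c p)) r) \<psi> h" and sm: "smooth_on W \<psi>" "smooth_on (ball (\<psi> (snd c p)) r) h"
      and Q: "\<And>x. x \<in> W \<Longrightarrow> qc c x = Q (\<psi> x $ 1)"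
      and mono: "strict_mono_on {\<psi> (snd c p) $ 1 - r<..<\<psi> (snd c p) $ 1 + r} Q"
      and ode: "\<And>s. s \<in> {\<psi> (snd c p) $ 1 - r<..<\<psi> (snd c p) $ 1 + r} \<Longrightarrow> (Q has_real_derivative Q' s) (at s) \<and>
        (Q' has_real_derivative 3 * \<epsilon> * Q s powr (-1/3)) (at s)"
      and met: "\<And>x u v. x \<in> W \<Longrightarrow> ip (g c x) u v = frechet_derivative \<psi> (at x) u $ 1 * frechet_derivative \<psi> (at x) v $ 1
        + (Q' (\<psi> x $ 1))\<^sup>2 * frechet_derivative \<psi> (at x) u $ 2 * frechet_derivative \<psi> (at x) v $ 2"
      and kil: "\<And>x. x \<in> W \<Longrightarrow> frechet_derivative \<psi> (at x) (rot_grad x) = vector [0, 1]"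
      by metis
    define d where "d = sub_chart c W \<psi>"
    note W' = W(3)[unfolded S_def]
    note jac = jacobian_sub_chart[OF surface(1) _ c W(1) W' open_ball hom sm(1), folded d_def]
    note ts = transition_sub_chart[OF chart, of _ _ c W \<psi>, folded d_def]
    show ?thesis
    proof (intro exI conjI)
      show "smooth_chart M A d"
        unfolding d_def by (rule smooth_chart_sub_chart[OF surface(1) c W(1) W' open_ball hom sm])
      show "p \<in> fst d" using p W(2) by (simp add: d_def sub_chart_def)
      show "\<psi> (snd c p) $ 1 - r < \<psi> (snd c p) $ 1 + r" using W(4) by simp
      have "snd d ` fst d = ball (\<psi> (snd c p)) r"
        unfolding d_def sub_chart_image[OF W'] using hom by (simp add: homeomorphism_def)
      then show "(\<lambda>y. y $ 1) ` snd d ` fst d = {\<psi> (snd c p) $ 1 - r<..<\<psi> (snd c p) $ 1 + r}"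
        by (simp add: ball_first_coordinate)
      show "\<forall>p'\<in>fst d. q p' = Q (snd d p' $ 1)"
      proof
        fix p' assume "p' \<in> fst d"
        then have "p' \<in> fst c" "snd c p' \<in> W" by (auto simp: d_def sub_chart_def)
        then show "q p' = Q (snd d p' $ 1)"
          using Q[of "snd c p'"] chart_inv_left[OF chart[OF c], of p'] by (simp add: d_def sub_chart_def qc_def)
      qed
      \<comment> \<open>The coordinate \<open>s\<close> grows along the gradient, so
        \<open>q\<close> is increasing in it.\<close>
      show "strict_mono_on {\<psi> (snd c p) $ 1 - r<..<\<psi> (snd c p) $ 1 + r} Q \<or>
        strict_antimono_on {\<psi> (snd c p) $ 1 - r<..<\<psi> (snd c p) $ 1 + r} Q" using mono by blast
      show "\<forall>s\<in>{\<psi> (snd c p) $ 1 - r<..<\<psi> (snd c p) $ 1 + r}. (Q has_real_derivative Q' s) (at s) \<and>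
        (Q' has_real_derivative 3 * \<epsilon> * Q s powr (-1/3)) (at s)" using ode by blast
      show "metric_components A g d (\<lambda>y. vector [vector [1, 0], vector [0, (Q' (y $ 1))\<^sup>2]])"
        unfolding metric_components_def
      proof (intro ballI allI)
        fix a x and u v :: "real^2" assume a: "a \<in> A" and x: "x \<in> overlap a d"
        note t = ts[OF a x]
        have "ip (g a x) u v = ip (g c (transition a c x)) (jacobian (transition a c) (at x) *v u) (jacobian (transition a c) (at x) *v v)"
          using gM[OF c] a t(3) unfolding metric_components_def by blast
        then show "ip (g a x) u v = ip (vector [vector [1, 0], vector [0, (Q' (transition a d x $ 1))\<^sup>2]])
          (jacobian (transition a d) (at x) *v u) (jacobian (transition a d) (at x) *v v)"
          unfolding jac[OF a x] met[OF t(2)] t(1) by (simp add: ip_2)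
      qed
      show "vfield_components A V d (\<lambda>y. vector [0, 1])"
        unfolding vfield_components_def
      proof (intro ballI)
        fix a x assume a: "a \<in> A" and x: "x \<in> overlap a d"
        note t = ts[OF a x]
        have "jacobian (transition a c) (at x) *v V a x = rot_grad (transition a c x)"
          using Vcomp[OF c] a t(3) Vrot[OF c, of "transition a c x"] t(2) W(3) unfolding vfield_components_def by auto
        then show "jacobian (transition a d) (at x) *v V a x = vector [0, 1]"
          unfolding jac[OF a x] by (simp add: kil[OF t(2)])
      qed
    qed
  qed
  ultimately show ?thesis by blast
qed

end
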